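(* Let $\Phi$ be a measurable linear RDS on a Banach space $X$ over a measure-preserving dynamical system $(\Omega,\mathcal F,\mathbb P,\theta)$ with time $\mathbb Z$, exhibiting an $\alpha$-trichotomy with bounds $\alpha=(\alpha^c,\alpha^s,\alpha^u)$ and associated projections $P^c,P^s,P^u$, and let $f\in\mathscr F$. Let $\Psi:\mathbb Z\times\Omega\times X\to X$ be the measurable RDS given by $$\Psi_\omega^n(x)=\begin{cases}\Phi_\omega^nx+\sum_{k=0}^{n-1}\Phi_{\theta^{k+1}\omega}^{n-k-1}f_{\theta^k\omega}(\Psi_\omega^k(x)),&n\ge1,\\ x,&n=0,\\ \Phi_\omega^nx-\sum_{k=n}^{-1}\Phi_{\theta^{k+1}\omega}^{n-k-1}f_{\theta^k\omega}(\Psi_\omega^k(x)),&n\le-1.\end{cases}$$ If $$\lim_{n\to-\infty}\alpha^s_{-n,\theta^n\omega}\,\alpha^c_{n,\omega}=\lim_{n\to+\infty}\alpha^u_{-n,\theta^n\omega}\,\alpha^c_{n,\omega}=0\quad\text{for all }\omega\in\Omega$$ and $\sigma+\tau<1/2$, then there are $N\in\,]0,1[$ and a unique $\varphi\in\mathfrak D_N$ such that $$\Psi^n_\omega(\Gamma_{\varphi,\omega})\subseteq\Gamma_{\varphi,\theta^n\omega}\quad\text{for all }(n,\omega)\in\mathbb Z\times\Omega.$$ Moreover, for all $(n,\omega)\in\mathbb Z\times\Omega$ and all $\xi,\xi'\in E^c_\omega$, $$\|\Psi^n_\omega(\xi,\varphi_\omega(\xi))-\Psi^n_\omega(\xi',\varphi_\omega(\xi'))\|\le\frac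 N\tau\,\alpha^c_{n,\omega}\,\|\xi-\xi'\|.$$
   Context: Measure-preserving dynamical system (time $\mathbb Z$): $(\Omega,\mathcal F,\mathbb P)$ is a measure space, $\theta:\mathbb Z\times\Omega\to\Omega$ is measurable, each $\theta^n=\theta(n,\cdot)$ preserves $\mathbb P$, $\theta^0=\mathrm{Id}$, $\theta^{n+m}=\theta^n\circ\theta^m$. A measurable RDS on $X$ is a map $\Phi:\mathbb Z\times\Omega\times X\to X$ such that $\Phi(\cdot,\cdot,x)$ is measurable for every $x\in X$ and $\Phi^n_\omega=\Phi(n,\omega,\cdot)$ satisfies $\Phi^0_\omega=\mathrm{Id}_X$, $\Phi^{n+m}_\omega=\Phi^n_{\theta^m\omega}\circ\Phi^m_\omega$ for all $m,n\in\mathbb Z$, $\omega\in\Omega$. It is linear if every $\Phi^n_\omega$ is a bounded linear operator. The measurable RDS $\Psi$ in the statement, which is part of the setting, encapsulates the solutions of the random nonlinear difference equation $x_{n+1}=\Phi^1_{\theta^n\omega}x_n+f_{\theta^n\omega}(x_n)$. $\alpha$-trichotomy: let $\alpha^c:\mathbb Z\times\Omega\to(0,\infty)$, $\alpha^s:\mathbb Z_{\ge0}\times\Omega\to(0,\infty)$, $\alpha^u:\mathbb Z_{\le0}\times\Omega\to(0,\infty)$, and write $\alpha^i_{n,\omega}=\alpha^i(n,\omega)$. A measurable linear RDS $\Phi$ exhibits an $\alpha$-trichotomy if there are maps $P^i:\Omega\times X\to X$, $i\in\{c,s,u\}$, $P^i_\omega=P^i(\omega,\cdot)$, such that: $P^i(\cdot,x)$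 is measurable for all $x$; each $P^i_\omega$ is a bounded linear projection; $P^c_\omega+P^s_\omega+P^u_\omega=\mathrm{Id}$; $P^c_\omega P^s_\omega=0$; $P^i_{\theta^n\omega}\Phi^n_\omega=\Phi^n_\omega P^i_\omega$ for all $n\in\mathbb Z$, $\omega\in\Omega$; and $\|\Phi^n_\omega P^c_\omega\|\le\alpha^c_{n,\omega}$ for $n\in\mathbb Z$, $\|\Phi^n_\omega P^s_\omega\|\le\alpha^s_{n,\omega}$ for $n\ge0$, $\|\Phi^n_\omega P^u_\omega\|\le\alpha^u_{n,\omega}$ for $n\le0$, for all $\omega$. Put $E^i_\omega=P^i_\omega(X)$ and identify $E^c_\omega\times E^s_\omega\times E^u_\omega$ with $E^c_\omega\oplus E^s_\omega\oplus E^u_\omega=X$; thus $(\xi,\eta)$ with $\xi\in E^c_\omega$, $\eta\in E^s_\omega\oplus E^u_\omega$ denotes $\xi+\eta$. $\mathscr F$ is the set of maps $f:\Omega\times X\to X$, $f_\omega=f(\omega,\cdot)$, such that $f(\cdot,x)$ is measurable for all $x\in X$, and $f_\omega(0)=0$ and the Lipschitz constant $\mathrm{Lip}(f_\omega)$ is finite for all $\omega$. Constants: $$\sigma^-_\omega=\sup_{n\ge1}\frac1{\alpha^c_{-n,\omega}}\sum_{k=-n}^{-1}\alpha^c_{-n-k-1,\theta^{k+1}\omega}\mathrm{Lip}(f_{\theta^k\omega})\alpha^c_{k,\omega},\quad \sigma^+_\omega=\sup_{n\ge1}\frac1{\alpha^c_{n,\omega}}\sum_{k=0}^{n-1}\alpha^c_{n-k-1,\theta^{k+1}\omega}\mathrm{Lip}(f_{\theta^k\omega})\alpha^c_{k,\omega},$$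 $$\sigma=\sup_{\omega\in\Omega}\max\{\sigma^-_\omega,\sigma^+_\omega\},$$ $$\tau^-_\omega=\sum_{k=-\infty}^{-1}\alpha^s_{-k-1,\theta^{k+1}\omega}\mathrm{Lip}(f_{\theta^k\omega})\alpha^c_{k,\omega},\quad \tau^+_\omega=\sum_{k=0}^{+\infty}\alpha^u_{-k-1,\theta^{k+1}\omega}\mathrm{Lip}(f_{\theta^k\omega})\alpha^c_{k,\omega},\quad \tau=\sup_{\omega\in\Omega}(\tau^-_\omega+\tau^+_\omega).$$ For $N>0$, $\mathfrak D_N$ is the set of maps $\varphi:\{(\omega,\xi)\in\Omega\times X:\xi\in E^c_\omega\}\to X$, $\varphi_\omega=\varphi(\omega,\cdot)$, such that $\omega\mapsto\varphi(\omega,P^c_\omega x)$ is measurable for all $x\in X$; $\varphi_\omega(0)=0$; $\varphi_\omega(E^c_\omega)\subseteq E^s_\omega\oplus E^u_\omega$; and $\|\varphi_\omega(\xi)-\varphi_\omega(\xi')\|\le N\|\xi-\xi'\|$ for all $\omega$ and $\xi,\xi'\in E^c_\omega$. Its graph at $\omega$ is $\Gamma_{\varphi,\omega}=\{(\xi,\varphi_\omega(\xi)):\xi\in E^c_\omega\}\subseteq X$.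
   Formalization: "Measurable" for X-valued maps means strongly measurable (pointwise limit of simple functions), which is Borel measurability for separable X; with Borel measurability the claim fails for some nonseparable X. For τ=0, where N/τ is undefined, N/τ is read as infinity. *)

theory Defs
  imports "HOL-Analysis.Analysis"
begin

text \<open>
  Measurability of maps into the Banach space \<open>X\<close> is strong (Bochner) measurability, i.e. being a
  pointwise limit of simple functions. If \<open>X\<close> is separable this is Borel measurability, see
  \<open>strongly_measurable_iff_borel\<close>. For a nonseparable \<open>X\<close> Borel measurability is not an adequate
  notion here: it is not preserved by sums, nor by passing from \<open>\<omega> \<mapsto> f \<omega> x\<close> (for each fixed \<open>x\<close>) and
  \<open>g\<close> to \<open>\<omega> \<mapsto> f \<omega> (g \<omega>)\<close>, even if every \<open>f \<omega>\<close> is Lipschitz.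
\<close>

definition strongly_measurable :: "'w measure \<Rightarrow> ('w \<Rightarrow> 'x::topological_space) \<Rightarrow> bool" where
  "strongly_measurable M g \<longleftrightarrow>
    (\<exists>s. (\<forall>i::nat. simple_function M (s i)) \<and> (\<forall>\<omega>\<in>space M. (\<lambda>i. s i \<omega>) \<longlonglongrightarrow> g \<omega>))"

lemma strongly_measurable_imp_borel:
  fixes g :: "'w \<Rightarrow> 'x::metric_space"
  assumes "strongly_measurable M g"
  shows "g \<in> borel_measurable M"
proof -
  obtain s where s: "\<And>i::nat. simple_function M (s i)" "\<And>\<omega>. \<omega> \<in> space M \<Longrightarrow> (\<lambda>i. s i \<omega>) \<longlonglongrightarrow> g \<omega>"
    using assms unfolding strongly_measurable_def by blast
  show ?thesis
    by (rule borel_measurable_LIMSEQ_metric[of s, OF borel_measurable_simple_function s(2)])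
       (use s in auto)
qed

lemma strongly_measurable_iff_borel:
  fixes g :: "'w \<Rightarrow> 'x::{metric_space, second_countable_topology}"
  shows "strongly_measurable M g \<longleftrightarrow> g \<in> borel_measurable M"
proof
  assume "g \<in> borel_measurable M"
  from borel_measurable_implies_sequence_metric[OF this]
  show "strongly_measurable M g"
    unfolding strongly_measurable_def by blast
qed (rule strongly_measurable_imp_borel)

text \<open>All conditions on \<open>\<omega>\<close> are relativised to \<open>\<Omega> = space M\<close>.\<close>

definition measure_preserving_ds :: "'w measure \<Rightarrow> (int \<Rightarrow> 'w \<Rightarrow> 'w) \<Rightarrow> bool" where
  "measure_preserving_ds M \<theta> \<longleftrightarrow>
    (\<lambda>(n, \<omega>). \<theta> n \<omega>) \<in> measurable (count_space UNIV \<Otimes>\<^sub>M M) M \<and>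
    (\<forall>n. \<forall>A\<in>sets M. emeasure M (\<theta> n -` A \<inter> space M) = emeasure M A) \<and>
    (\<forall>\<omega>\<in>space M. \<theta> 0 \<omega> = \<omega>) \<and>
    (\<forall>n m. \<forall>\<omega>\<in>space M. \<theta> (n + m) \<omega> = \<theta> n (\<theta> m \<omega>))"

definition measurable_rds ::
  "'w measure \<Rightarrow> (int \<Rightarrow> 'w \<Rightarrow> 'w) \<Rightarrow> (int \<Rightarrow> 'w \<Rightarrow> 'x::topological_space \<Rightarrow> 'x) \<Rightarrow> bool" where
  "measurable_rds M \<theta> \<Phi> \<longleftrightarrow>
    (\<forall>x. strongly_measurable (count_space UNIV \<Otimes>\<^sub>M M) (\<lambda>(n, \<omega>). \<Phi> n \<omega> x)) \<and>
    (\<forall>\<omega>\<in>space M. \<forall>x. \<Phi> 0 \<omega> x = x) \<and>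
    (\<forall>n m. \<forall>\<omega>\<in>space M. \<forall>x. \<Phi> (n + m) \<omega> x = \<Phi> n (\<theta> m \<omega>) (\<Phi> m \<omega> x))"

definition measurable_linear_rds ::
  "'w measure \<Rightarrow> (int \<Rightarrow> 'w \<Rightarrow> 'w) \<Rightarrow> (int \<Rightarrow> 'w \<Rightarrow> 'x::real_normed_vector \<Rightarrow> 'x) \<Rightarrow> bool" where
  "measurable_linear_rds M \<theta> \<Phi> \<longleftrightarrow>
    measurable_rds M \<theta> \<Phi> \<and> (\<forall>n. \<forall>\<omega>\<in>space M. bounded_linear (\<Phi> n \<omega>))"

definition bounded_projection :: "('x::real_normed_vector \<Rightarrow> 'x) \<Rightarrow> bool" where
  "bounded_projection P \<longleftrightarrow> bounded_linear P \<and> (\<forall>x. P (P x) = P x)"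

text \<open>
  The bounds \<open>\<alpha>s\<close> and \<open>\<alpha>u\<close> only matter for times \<open>n \<ge> 0\<close> and \<open>n \<le> 0\<close> respectively; their values
  at other times are never used.
\<close>

definition trichotomy ::
  "'w measure \<Rightarrow> (int \<Rightarrow> 'w \<Rightarrow> 'w) \<Rightarrow> (int \<Rightarrow> 'w \<Rightarrow> 'x::real_normed_vector \<Rightarrow> 'x) \<Rightarrow>
    (int \<Rightarrow> 'w \<Rightarrow> real) \<Rightarrow> (int \<Rightarrow> 'w \<Rightarrow> real) \<Rightarrow> (int \<Rightarrow> 'w \<Rightarrow> real) \<Rightarrow>
    ('w \<Rightarrow> 'x \<Rightarrow> 'x) \<Rightarrow> ('w \<Rightarrow> 'x \<Rightarrow> 'x) \<Rightarrow> ('w \<Rightarrow> 'x \<Rightarrow> 'x) \<Rightarrow> bool" where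
  "trichotomy M \<theta> \<Phi> \<alpha>c \<alpha>s \<alpha>u Pc Ps Pu \<longleftrightarrow>
    (\<forall>\<omega>\<in>space M. (\<forall>n. \<alpha>c n \<omega> > 0) \<and> (\<forall>n\<ge>0. \<alpha>s n \<omega> > 0) \<and> (\<forall>n\<le>0. \<alpha>u n \<omega> > 0)) \<and>
    (\<forall>P\<in>{Pc, Ps, Pu}.
      (\<forall>x. strongly_measurable M (\<lambda>\<omega>. P \<omega> x)) \<and>
      (\<forall>\<omega>\<in>space M. bounded_projection (P \<omega>)) \<and>
      (\<forall>n. \<forall>\<omega>\<in>space M. \<forall>x. P (\<theta> n \<omega>) (\<Phi> n \<omega> x) = \<Phi> n \<omega> (P \<omega> x))) \<and>
    (\<forall>\<omega>\<in>space M. \<forall>x. Pc \<omega> x + Ps \<omega> x + Pu \<omega> x = x) \<and>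
    (\<forall>\<omega>\<in>space M. \<forall>x. Pc \<omega> (Ps \<omega> x) = 0) \<and>
    (\<forall>\<omega>\<in>space M.
      (\<forall>n. onorm (\<lambda>x. \<Phi> n \<omega> (Pc \<omega> x)) \<le> \<alpha>c n \<omega>) \<and>
      (\<forall>n\<ge>0. onorm (\<lambda>x. \<Phi> n \<omega> (Ps \<omega> x)) \<le> \<alpha>s n \<omega>) \<and>
      (\<forall>n\<le>0. onorm (\<lambda>x. \<Phi> n \<omega> (Pu \<omega> x)) \<le> \<alpha>u n \<omega>))"

text \<open>The Lipschitz constant; meaningful only if some \<open>C\<close> with \<open>C-lipschitz_on UNIV g\<close> exists.\<close>

definition Lip :: "('x::metric_space \<Rightarrow> 'x) \<Rightarrow> real" where
  "Lip g = Inf {C. C-lipschitz_on UNIV g}"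

definition perturbations :: "'w measure \<Rightarrow> ('w \<Rightarrow> 'x::real_normed_vector \<Rightarrow> 'x) set" where
  "perturbations M =
    {f. (\<forall>x. strongly_measurable M (\<lambda>\<omega>. f \<omega> x)) \<and>
        (\<forall>\<omega>\<in>space M. f \<omega> 0 = 0 \<and> (\<exists>C. C-lipschitz_on UNIV (f \<omega>)))}"

text \<open>The suprema and series below may be infinite, so the constants are extended nonnegative reals.
  A quotient \<open>N / \<tau>\<close> with \<open>N > 0\<close> is then \<open>\<infinity>\<close> in the degenerate case \<open>\<tau> = 0\<close>, i.e. \<open>f = 0\<close>.\<close>

definition sigma_minus ::
  "(int \<Rightarrow> 'w \<Rightarrow> 'w) \<Rightarrow> (int \<Rightarrow> 'w \<Rightarrow> real) \<Rightarrow> ('w \<Rightarrow> 'x::metric_space \<Rightarrow> 'x) \<Rightarrow> 'w \<Rightarrow> ennreal" where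
  "sigma_minus \<theta> \<alpha>c f \<omega> =
    (SUP n\<in>{1::int..}. ennreal (1 / \<alpha>c (- n) \<omega> *
      (\<Sum>k=-n..-1. \<alpha>c (- n - k - 1) (\<theta> (k + 1) \<omega>) * Lip (f (\<theta> k \<omega>)) * \<alpha>c k \<omega>)))"

definition sigma_plus ::
  "(int \<Rightarrow> 'w \<Rightarrow> 'w) \<Rightarrow> (int \<Rightarrow> 'w \<Rightarrow> real) \<Rightarrow> ('w \<Rightarrow> 'x::metric_space \<Rightarrow> 'x) \<Rightarrow> 'w \<Rightarrow> ennreal" where
  "sigma_plus \<theta> \<alpha>c f \<omega> =
    (SUP n\<in>{1::int..}. ennreal (1 / \<alpha>c n \<omega> *
      (\<Sum>k=0..n-1. \<alpha>c (n - k - 1) (\<theta> (k + 1) \<omega>) * Lip (f (\<theta> k \<omega>)) * \<alpha>c k \<omega>)))"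

definition sigma_const ::
  "'w measure \<Rightarrow> (int \<Rightarrow> 'w \<Rightarrow> 'w) \<Rightarrow> (int \<Rightarrow> 'w \<Rightarrow> real) \<Rightarrow>
    ('w \<Rightarrow> 'x::metric_space \<Rightarrow> 'x) \<Rightarrow> ennreal" where
  "sigma_const M \<theta> \<alpha>c f =
    (SUP \<omega>\<in>space M. max (sigma_minus \<theta> \<alpha>c f \<omega>) (sigma_plus \<theta> \<alpha>c f \<omega>))"

definition tau_minus ::
  "(int \<Rightarrow> 'w \<Rightarrow> 'w) \<Rightarrow> (int \<Rightarrow> 'w \<Rightarrow> real) \<Rightarrow> (int \<Rightarrow> 'w \<Rightarrow> real) \<Rightarrow>
    ('w \<Rightarrow> 'x::metric_space \<Rightarrow> 'x) \<Rightarrow> 'w \<Rightarrow> ennreal" where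
  "tau_minus \<theta> \<alpha>c \<alpha>s f \<omega> =
    (\<Sum>\<^sub>\<infinity>k\<in>{..-1::int}.
      ennreal (\<alpha>s (- k - 1) (\<theta> (k + 1) \<omega>) * Lip (f (\<theta> k \<omega>)) * \<alpha>c k \<omega>))"

definition tau_plus ::
  "(int \<Rightarrow> 'w \<Rightarrow> 'w) \<Rightarrow> (int \<Rightarrow> 'w \<Rightarrow> real) \<Rightarrow> (int \<Rightarrow> 'w \<Rightarrow> real) \<Rightarrow>
    ('w \<Rightarrow> 'x::metric_space \<Rightarrow> 'x) \<Rightarrow> 'w \<Rightarrow> ennreal" where
  "tau_plus \<theta> \<alpha>c \<alpha>u f \<omega> =
    (\<Sum>\<^sub>\<infinity>k\<in>{0::int..}.
      ennreal (\<alpha>u (- k - 1) (\<theta> (k + 1) \<omega>) * Lip (f (\<theta> k \<omega>)) * \<alpha>c k \<omega>))"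

definition tau_const ::
  "'w measure \<Rightarrow> (int \<Rightarrow> 'w \<Rightarrow> 'w) \<Rightarrow> (int \<Rightarrow> 'w \<Rightarrow> real) \<Rightarrow> (int \<Rightarrow> 'w \<Rightarrow> real) \<Rightarrow>
    (int \<Rightarrow> 'w \<Rightarrow> real) \<Rightarrow> ('w \<Rightarrow> 'x::metric_space \<Rightarrow> 'x) \<Rightarrow> ennreal" where
  "tau_const M \<theta> \<alpha>c \<alpha>s \<alpha>u f =
    (SUP \<omega>\<in>space M. tau_minus \<theta> \<alpha>c \<alpha>s f \<omega> + tau_plus \<theta> \<alpha>c \<alpha>u f \<omega>)"

text \<open>
  The class of maps \<open>\<phi>\<close> on \<open>{(\<omega>, \<xi>). \<omega> \<in> \<Omega> \<and> \<xi> \<in> E\<^sup>c \<omega>}\<close>; membership in \<^const>\<open>extensional\<close> fixes the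
  irrelevant values outside this domain, so that equality in the class is equality on the domain.
\<close>

definition graph_maps ::
  "'w measure \<Rightarrow> ('w \<Rightarrow> 'x \<Rightarrow> 'x) \<Rightarrow> ('w \<Rightarrow> 'x \<Rightarrow> 'x) \<Rightarrow> ('w \<Rightarrow> 'x \<Rightarrow> 'x) \<Rightarrow> real \<Rightarrow>
    ('w \<times> 'x \<Rightarrow> 'x::real_normed_vector) set" where
  "graph_maps M Pc Ps Pu N =
    {\<phi> \<in> extensional (SIGMA \<omega>:space M. range (Pc \<omega>)).
      (\<forall>x. strongly_measurable M (\<lambda>\<omega>. \<phi> (\<omega>, Pc \<omega> x))) \<and>
      (\<forall>\<omega>\<in>space M.
        \<phi> (\<omega>, 0) = 0 \<and>
        (\<forall>\<xi>\<in>range (Pc \<omega>). \<phi> (\<omega>, \<xi>) \<in> {y + z | y z. y \<in> range (Ps \<omega>) \<and> z \<in> range (Pu \<omega>)}) \<and>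
        (\<forall>\<xi>\<in>range (Pc \<omega>). \<forall>\<xi>'\<in>range (Pc \<omega>).
          norm (\<phi> (\<omega>, \<xi>) - \<phi> (\<omega>, \<xi>')) \<le> N * norm (\<xi> - \<xi>')))}"

definition graph_at :: "('w \<Rightarrow> 'x \<Rightarrow> 'x) \<Rightarrow> ('w \<times> 'x \<Rightarrow> 'x) \<Rightarrow> 'w \<Rightarrow> 'x::real_normed_vector set" where
  "graph_at Pc \<phi> \<omega> = {\<xi> + \<phi> (\<omega>, \<xi>) | \<xi>. \<xi> \<in> range (Pc \<omega>)}"

definition invariant_graph ::
  "'w measure \<Rightarrow> (int \<Rightarrow> 'w \<Rightarrow> 'w) \<Rightarrow> ('w \<Rightarrow> 'x \<Rightarrow> 'x) \<Rightarrow> (int \<Rightarrow> 'w \<Rightarrow> 'x \<Rightarrow> 'x) \<Rightarrow>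
    ('w \<times> 'x \<Rightarrow> 'x::real_normed_vector) \<Rightarrow> bool" where
  "invariant_graph M \<theta> Pc \<Psi> \<phi> \<longleftrightarrow>
    (\<forall>n. \<forall>\<omega>\<in>space M. \<Psi> n \<omega> ` graph_at Pc \<phi> \<omega> \<subseteq> graph_at Pc \<phi> (\<theta> n \<omega>))"

end

theory Submission
  imports Defs
begin

text \<open>
  Write an orbit on the sought graph as \<open>x\<^sub>n + \<phi>(x\<^sub>n)\<close> with \<open>x\<^sub>n\<close> in the centre space. By the variation
  of constants formula the centre part of the orbit is \<open>\<Phi>\<^sup>n \<xi>\<close> plus a finite sum of \<open>P\<^sup>c f\<close>-terms, while
  the limit conditions turn the stable and unstable parts at time \<open>0\<close> into two series running over
  the whole past and the whole future. So invariant graphs correspond to fixed pairs \<open>(x, \<phi>)\<close> of a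
  Lyapunov--Perron operator. If \<open>N\<close> solves \<open>N = \<tau> K (1 + N)\<close> with \<open>K = 1 / (1 - \<sigma> (1 + N))\<close>, the
  operator preserves the bounds \<open>Lip x\<^sub>n \<le> K \<alpha>\<^sup>c\<^sub>n\<close>, \<open>Lip \<phi> \<le> N\<close> and contracts with rate
  \<open>(1 + N) \<sigma> + K \<tau> < 1\<close>, and its Picard iterates remain strongly measurable.
\<close>

section \<open>Strong measurability\<close>

text \<open>The two unknowns are coupled: the centre orbit is computed with \<phi>, while \<phi> at
  \<omega> needs the centre orbit through its whole past and future, hence \<phi> on every fibre
  \<theta>^k \<omega>. So the iteration acts on pairs, with distances uniform in \<omega>. If orbits
  are a-close and graphs b-close, the f-terms differ by a factor d = (1 + N) a + K b, and one
  application of the operator returns the distances \<sigma> d and \<tau> d; from then on d is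
  multiplied by (1 + N) \<sigma> + K \<tau> at each step. Eliminating K from N = \<tau> K (1 + N)
  leaves a quadratic p with p(0) = \<tau> and p(1) = 2 (\<sigma> + \<tau>) - 1, so the threshold 1/2
  is what places a root below 1; the same equation turns the orbit constant K (1 + N) into N /
  \<tau>. The two directions of the correspondence meet different obstacles. Orbits on an invariant
  graph come without a growth bound, and one is needed before the limit conditions can remove the
  remainders at times -m and m. The orbits of a fixed pair are not known to form a flow, which is
  needed before the series at \<theta>^1 \<omega> can be recognised as a shift of the series at
  \<omega>.\<close>

lemma strongly_measurable_iff_separable:
  fixes g :: "'w \<Rightarrow> 'x::metric_space"
  shows "strongly_measurable M g \<longleftrightarrow>
    g \<in> borel_measurable M \<and> (\<exists>D. countable D \<and> g ` space M \<subseteq> closure D)"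
proof
  assume g: "strongly_measurable M g"
  then obtain s where s: "\<And>i::nat. simple_function M (s i)"
      "\<And>\<omega>. \<omega> \<in> space M \<Longrightarrow> (\<lambda>i. s i \<omega>) \<longlonglongrightarrow> g \<omega>"
    unfolding strongly_measurable_def by blast
  let ?D = "\<Union>i. s i ` space M"
  have "countable ?D"
    using s(1) by (intro countable_UN) (auto simp: simple_function_def countable_finite)
  moreover have "g ` space M \<subseteq> closure ?D"
  proof (rule image_subsetI)
    fix \<omega> assume "\<omega> \<in> space M"
    then show "g \<omega> \<in> closure ?D"
      unfolding closure_sequential by (intro exI[of _ "\<lambda>i. s i \<omega>"]) (auto intro: s(2))
  qed
  ultimately show "g \<in> borel_measurable M \<and> (\<exists>D. countable D \<and> g ` space M \<subseteq> closure D)"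
    using strongly_measurable_imp_borel[OF g] by blast
next
  assume *: "g \<in> borel_measurable M \<and> (\<exists>D. countable D \<and> g ` space M \<subseteq> closure D)"
  then obtain D where D: "countable D" "g ` space M \<subseteq> closure D" by blast
  have [measurable]: "g \<in> borel_measurable M" using * by blast
  show "strongly_measurable M g"
  proof (cases "space M = {}")
    case True
    then show ?thesis
      unfolding strongly_measurable_def by (auto simp: simple_function_def)
  next
    case False
    then have "D \<noteq> {}" using D(2) by auto
    define d where "d = from_nat_into D"
    have d: "range d = D"
      unfolding d_def using \<open>D \<noteq> {}\<close> D(1) by (rule range_from_nat_into)
    \<comment> \<open>\<open>s i \<omega>\<close> is a point nearest to \<open>g \<omega>\<close>
      among \<open>d 0\<close>, ..., \<open>d i\<close>, replaced only on strict improvement. Its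
      distance to \<open>g \<omega>\<close> is a running minimum of real functions, which makes the
      branching condition measurable without knowing anything about \<open>s i\<close>.\<close>
    define s where "s = rec_nat (\<lambda>\<omega>. d 0)
      (\<lambda>i r \<omega>. if dist (d (Suc i)) (g \<omega>) < dist (r \<omega>) (g \<omega>) then d (Suc i) else r \<omega>)"
    have s0: "s 0 = (\<lambda>\<omega>. d 0)" and sS: "s (Suc i) =
      (\<lambda>\<omega>. if dist (d (Suc i)) (g \<omega>) < dist (s i \<omega>) (g \<omega>) then d (Suc i) else s i \<omega>)" for i
      unfolding s_def by simp_all
    have [measurable]: "(\<lambda>\<omega>. dist c (g \<omega>)) \<in> borel_measurable M" for c
      by (rule borel_measurable_continuous_on[OF _ \<open>g \<in> borel_measurable M\<close>])
         (intro continuous_intros)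
    have r: "(\<lambda>\<omega>. dist (s i \<omega>) (g \<omega>)) \<in> borel_measurable M" for i
    proof (induction i)
      case (Suc i)
      note [measurable] = Suc
      have "(\<lambda>\<omega>. dist (s (Suc i) \<omega>) (g \<omega>)) =
          (\<lambda>\<omega>. min (dist (d (Suc i)) (g \<omega>)) (dist (s i \<omega>) (g \<omega>)))"
        by (auto simp: sS min_def)
      then show ?case by simp
    qed (simp add: s0)
    have "simple_function M (s i)" for i
    proof (induction i)
      case (Suc i)
      note [measurable] = r[of i]
      show ?case unfolding sS using Suc by (intro simple_function_If) auto
    qed (simp add: s0)
    moreover have "(\<lambda>i. s i \<omega>) \<longlonglongrightarrow> g \<omega>" if "\<omega> \<in> space M" for \<omega>
    proof (rule metric_LIMSEQ_I)
      fix r :: real assume "r > 0"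
      have "g \<omega> \<in> closure D" using D(2) that by auto
      then obtain y where "y \<in> D" "dist y (g \<omega>) < r"
        using \<open>r > 0\<close> closure_approachable by metis
      then obtain l where l: "dist (d l) (g \<omega>) < r" using d by (metis imageE)
      have "dist (s i \<omega>) (g \<omega>) < r" if "i \<ge> l" for i
        using that
      proof (induction i rule: dec_induct)
        case base
        then show ?case using l by (cases l) (auto simp: s0 sS)
      next
        case (step n)
        then show ?case by (auto simp: sS)
      qed
      then show "\<exists>no. \<forall>n\<ge>no. dist (s n \<omega>) (g \<omega>) < r" by blast
    qed
    ultimately show ?thesis unfolding strongly_measurable_def by blast
  qed
qed

text \<open>Separable ranges make this short: the countable sets belonging to the \<open>u i\<close>
  have a countable union, so no diagonal sequence has to be extracted from the simple functions
  approximating each \<open>u i\<close>.\<close>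

lemma strongly_measurable_LIMSEQ:
  fixes g :: "'w \<Rightarrow> 'x::metric_space"
  assumes "\<And>i::nat. strongly_measurable M (u i)"
    and lim: "\<And>\<omega>. \<omega> \<in> space M \<Longrightarrow> (\<lambda>i. u i \<omega>) \<longlonglongrightarrow> g \<omega>"
  shows "strongly_measurable M g"
proof -
  have u: "u i \<in> borel_measurable M" "\<exists>D. countable D \<and> u i ` space M \<subseteq> closure D" for i
    using assms(1)[of i] unfolding strongly_measurable_iff_separable by auto
  have "\<forall>i. \<exists>D. countable D \<and> u i ` space M \<subseteq> closure D"
    using u(2) by blast
  from choice[OF this] obtain D
    where "\<forall>i. countable (D i) \<and> u i ` space M \<subseteq> closure (D i)" ..
  then have D: "countable (D i)" "u i ` space M \<subseteq> closure (D i)" for i by simp_all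
  have "u i \<omega> \<in> closure (\<Union>i. D i)" if "\<omega> \<in> space M" for i \<omega>
  proof -
    have "u i \<omega> \<in> closure (D i)" using D(2)[of i] that by auto
    then show ?thesis using closure_mono[of "D i" "\<Union>i. D i"] by auto
  qed
  then have "g ` space M \<subseteq> closure (\<Union>i. D i)"
    using closed_sequentially[OF closed_closure _ lim] by (simp add: image_subset_iff)
  moreover have "countable (\<Union>i. D i)" using D(1) by auto
  moreover have "g \<in> borel_measurable M"
    by (rule borel_measurable_LIMSEQ_metric[OF u(1) lim])
  ultimately show ?thesis
    unfolding strongly_measurable_iff_separable by (intro conjI exI[of _ "\<Union>i. D i"])
qed

lemma strongly_measurable_compose:
  fixes g :: "'w \<Rightarrow> 'x::metric_space"
  assumes g: "strongly_measurable M g" and T: "T \<in> measurable L M"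
  shows "strongly_measurable L (\<lambda>\<omega>. g (T \<omega>))"
proof -
  obtain D where "countable D" and D: "g ` space M \<subseteq> closure D" and [measurable]: "g \<in> borel_measurable M"
    using g unfolding strongly_measurable_iff_separable by blast
  moreover have "(\<lambda>\<omega>. g (T \<omega>)) \<in> borel_measurable L" using T by measurable
  moreover have "(\<lambda>\<omega>. g (T \<omega>)) ` space L \<subseteq> closure D"
    using measurable_space[OF T] D by (simp add: image_subset_iff)
  ultimately show ?thesis unfolding strongly_measurable_iff_separable by (intro conjI exI[of _ D])
qed

lemma strongly_measurable_const [simp]: "strongly_measurable M (\<lambda>_. c)"
  unfolding strongly_measurable_def by (auto intro!: exI[of _ "\<lambda>_ _. c"])

lemma strongly_measurable_cong:
  assumes "\<And>\<omega>. \<omega> \<in> space M \<Longrightarrow> g \<omega> = g' \<omega>" "strongly_measurable M g"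
  shows "strongly_measurable M g'"
  using assms unfolding strongly_measurable_def by simp

text \<open>Along the simple functions approximating \<open>g\<close> only finitely many of the maps
  \<open>F \<omega> y\<close> with fixed \<open>y\<close> occur at each stage; continuity in
  \<open>y\<close> carries the result to \<open>g\<close>. This keeps compositions such as
  \<open>f \<omega> (g \<omega>)\<close> measurable in a nonseparable X.\<close>

lemma strongly_measurable_caratheodory:
  fixes F :: "'w \<Rightarrow> 'y::topological_space \<Rightarrow> 'x::metric_space"
  assumes F: "\<And>y. strongly_measurable M (\<lambda>\<omega>. F \<omega> y)"
    and cont: "\<And>\<omega>. \<omega> \<in> space M \<Longrightarrow> continuous_on UNIV (F \<omega>)"
    and g: "strongly_measurable M g"
  shows "strongly_measurable M (\<lambda>\<omega>. F \<omega> (g \<omega>))"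
proof -
  obtain s where s: "\<And>i::nat. simple_function M (s i)"
      "\<And>\<omega>. \<omega> \<in> space M \<Longrightarrow> (\<lambda>i. s i \<omega>) \<longlonglongrightarrow> g \<omega>"
    using g unfolding strongly_measurable_def by blast
  have "\<forall>y. \<exists>D. countable D \<and> (\<lambda>\<omega>. F \<omega> y) ` space M \<subseteq> closure D"
    using F unfolding strongly_measurable_iff_separable by blast
  from choice[OF this] obtain D
    where "\<forall>y. countable (D y) \<and> (\<lambda>\<omega>. F \<omega> y) ` space M \<subseteq> closure (D y)" ..
  then have D: "countable (D y)" "(\<lambda>\<omega>. F \<omega> y) ` space M \<subseteq> closure (D y)" for y by simp_all
  have F_borel: "(\<lambda>\<omega>. F \<omega> y) \<in> borel_measurable M" for y
    using F unfolding strongly_measurable_iff_separable by blast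
  show ?thesis
  proof (rule strongly_measurable_LIMSEQ)
    fix i
    have fin: "finite (s i ` space M)" and
      pre: "\<And>y. y \<in> s i ` space M \<Longrightarrow> s i -` {y} \<inter> space M \<in> sets M"
      using s(1)[of i] by (auto simp: simple_function_def)
    have "(\<lambda>\<omega>. F \<omega> (s i \<omega>)) \<in> borel_measurable M"
    proof (rule measurableI)
      fix A :: "'x set" assume A: "A \<in> sets borel"
      have "(\<lambda>\<omega>. F \<omega> (s i \<omega>)) -` A \<inter> space M =
          (\<Union>y\<in>s i ` space M. (s i -` {y} \<inter> space M) \<inter> ((\<lambda>\<omega>. F \<omega> y) -` A \<inter> space M))"
        by auto
      also have "\<dots> \<in> sets M"
        by (intro sets.finite_UN sets.Int fin pre measurable_sets[OF F_borel A])
      finally show "(\<lambda>\<omega>. F \<omega> (s i \<omega>)) -` A \<inter> space M \<in> sets M" .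
    qed auto
    moreover have "(\<lambda>\<omega>. F \<omega> (s i \<omega>)) ` space M \<subseteq> closure (\<Union>y\<in>s i ` space M. D y)"
    proof (rule image_subsetI)
      fix \<omega> assume \<omega>: "\<omega> \<in> space M"
      then have "F \<omega> (s i \<omega>) \<in> closure (D (s i \<omega>))" using D(2)[of "s i \<omega>"] by auto
      also have "\<dots> \<subseteq> closure (\<Union>y\<in>s i ` space M. D y)"
        using \<omega> by (intro closure_mono) auto
      finally show "F \<omega> (s i \<omega>) \<in> closure (\<Union>y\<in>s i ` space M. D y)" .
    qed
    moreover have "countable (\<Union>y\<in>s i ` space M. D y)"
      using countable_finite[OF fin] D(1) by (intro countable_UN) auto
    ultimately show "strongly_measurable M (\<lambda>\<omega>. F \<omega> (s i \<omega>))"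
      unfolding strongly_measurable_iff_separable by blast
  next
    fix \<omega> assume "\<omega> \<in> space M"
    then show "(\<lambda>i. F \<omega> (s i \<omega>)) \<longlonglongrightarrow> F \<omega> (g \<omega>)"
      by (intro continuous_on_tendsto_compose[OF cont s(2)]) simp_all
  qed
qed

lemma strongly_measurable_continuous:
  fixes F :: "'y::topological_space \<Rightarrow> 'x::metric_space"
  assumes "continuous_on UNIV F" "strongly_measurable M g"
  shows "strongly_measurable M (\<lambda>\<omega>. F (g \<omega>))"
  by (rule strongly_measurable_caratheodory[where F = "\<lambda>_. F"]) (simp_all add: assms)

text \<open>Addition is a Caratheodory map of the second summand with the first as parameter, which
  avoids the Borel sets of X \<times> X.\<close>

lemma strongly_measurable_add:
  fixes g h :: "'w \<Rightarrow> 'x::real_normed_vector"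
  assumes g: "strongly_measurable M g" and h: "strongly_measurable M h"
  shows "strongly_measurable M (\<lambda>\<omega>. g \<omega> + h \<omega>)"
proof (rule strongly_measurable_caratheodory[where F = "\<lambda>\<omega> y. g \<omega> + y", OF _ _ h])
  show "strongly_measurable M (\<lambda>\<omega>. g \<omega> + y)" for y
    by (rule strongly_measurable_continuous[OF _ g]) (intro continuous_intros)
  show "continuous_on UNIV ((+) (g \<omega>))" for \<omega>
    by (intro continuous_intros)
qed

lemma strongly_measurable_diff:
  fixes g h :: "'w \<Rightarrow> 'x::real_normed_vector"
  assumes g: "strongly_measurable M g" and h: "strongly_measurable M h"
  shows "strongly_measurable M (\<lambda>\<omega>. g \<omega> - h \<omega>)"
proof -
  have "strongly_measurable M (\<lambda>\<omega>. - h \<omega>)"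
    by (rule strongly_measurable_continuous[OF _ h]) (intro continuous_intros)
  from strongly_measurable_add[OF g this] show ?thesis by simp
qed

lemma strongly_measurable_sum:
  fixes g :: "'i \<Rightarrow> 'w \<Rightarrow> 'x::real_normed_vector"
  assumes "\<And>i. i \<in> I \<Longrightarrow> strongly_measurable M (g i)"
  shows "strongly_measurable M (\<lambda>\<omega>. \<Sum>i\<in>I. g i \<omega>)"
  using assms by (induction I rule: infinite_finite_induct) (auto intro: strongly_measurable_add)

lemma strongly_measurable_suminf:
  fixes g :: "nat \<Rightarrow> 'w \<Rightarrow> 'x::real_normed_vector"
  assumes "\<And>i. strongly_measurable M (g i)" "\<And>\<omega>. \<omega> \<in> space M \<Longrightarrow> summable (\<lambda>i. g i \<omega>)"
  shows "strongly_measurable M (\<lambda>\<omega>. \<Sum>i. g i \<omega>)"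
proof (rule strongly_measurable_LIMSEQ)
  show "strongly_measurable M (\<lambda>\<omega>. \<Sum>i<n. g i \<omega>)" for n
    by (intro strongly_measurable_sum assms)
qed (auto intro: summable_LIMSEQ assms)

section \<open>Estimates from the trichotomy\<close>

text \<open>Every difference quotient is a lower bound of the set of Lipschitz constants, so the
  infimum is itself a Lipschitz constant.\<close>

lemma lipschitz_Lip:
  fixes g :: "'x::metric_space \<Rightarrow> 'x"
  assumes "\<exists>C. C-lipschitz_on UNIV g"
  shows "0 \<le> Lip g" "dist (g x) (g y) \<le> Lip g * dist x y"
proof -
  let ?S = "{C. C-lipschitz_on UNIV g}"
  have ne: "?S \<noteq> {}" using assms by auto
  show "0 \<le> Lip g"
    unfolding Lip_def by (rule cInf_greatest[OF ne]) (auto intro: lipschitz_on_nonneg)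
  show "dist (g x) (g y) \<le> Lip g * dist x y"
  proof (cases "x = y")
    case False
    have "dist (g x) (g y) / dist x y \<le> Lip g"
      unfolding Lip_def
    proof (rule cInf_greatest[OF ne])
      fix C assume "C \<in> ?S"
      then show "dist (g x) (g y) / dist x y \<le> C"
        using False lipschitz_onD[of C UNIV g x y] by (simp add: divide_simps)
    qed
    then show ?thesis using False by (simp add: divide_simps)
  qed simp
qed

text \<open>The explicit rate matters besides the convergence: it places the Picard iterates at a
  \<open>close_pairs\<close> distance from their limit, with constants uniform in time and
  fibre.\<close>

lemma geometric_limit:
  fixes s :: "nat \<Rightarrow> 'x::banach"
  assumes q: "0 \<le> q" "q < 1" and s: "\<And>i. norm (s (Suc i) - s i) \<le> c * q ^ i"
  shows "s \<longlonglongrightarrow> lim s" "norm (s i - lim s) \<le> c / (1 - q) * q ^ i"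
proof -
  have "summable (\<lambda>i. s (Suc i) - s i)"
  proof (rule summable_comparison_test'[of "\<lambda>i. c * q ^ i" 0])
    show "summable (\<lambda>i. c * q ^ i)" using q by (simp add: summable_mult summable_geometric)
  qed (rule s)
  then have "convergent (\<lambda>n. \<Sum>i<n. s (Suc i) - s i)"
    by (simp add: summable_iff_convergent)
  then have "convergent (\<lambda>n. (\<Sum>i<n. s (Suc i) - s i) + s 0)"
    by (intro convergent_add convergent_const)
  then show lim: "s \<longlonglongrightarrow> lim s"
    by (simp add: sum_lessThan_telescope convergent_LIMSEQ_iff)
  have "c \<ge> 0" using order_trans[OF norm_ge_zero s[of 0]] by simp
  \<comment> \<open>The partial geometric sum in closed form; the subtracted power is what lets the
    induction on \<open>m\<close> close.\<close>
  have *: "norm (s i - s (i + m)) \<le> c / (1 - q) * q ^ i - c / (1 - q) * q ^ (i + m)" for m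
  proof (induction m)
    case (Suc m)
    have "norm (s i - s (i + Suc m)) \<le> norm (s i - s (i + m)) + norm (s (Suc (i + m)) - s (i + m))"
      using norm_triangle_ineq4[of "s i - s (i + m)" "s (Suc (i + m)) - s (i + m)"] by simp
    also have "\<dots> \<le> (c / (1 - q) * q ^ i - c / (1 - q) * q ^ (i + m)) + c * q ^ (i + m)"
      by (intro add_mono Suc s)
    also have "c * q ^ (i + m) = c / (1 - q) * q ^ (i + m) - c / (1 - q) * q ^ (i + Suc m)"
    proof -
      define D where "D = c / (1 - q)"
      have c: "c = D * (1 - q)" using q by (simp add: D_def)
      show ?thesis unfolding D_def[symmetric] by (subst c) (simp add: algebra_simps)
    qed
    finally show ?case by simp
  qed simp
  have "norm (s i - s (i + m)) \<le> c / (1 - q) * q ^ i" for m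
    using *[of m] q \<open>c \<ge> 0\<close> by (smt (verit) divide_nonneg_pos mult_nonneg_nonneg zero_le_power)
  moreover have "(\<lambda>m. norm (s i - s (i + m))) \<longlonglongrightarrow> norm (s i - lim s)"
    using LIMSEQ_ignore_initial_segment[OF lim, of i]
    by (intro tendsto_intros) (simp add: add.commute)
  ultimately show "norm (s i - lim s) \<le> c / (1 - q) * q ^ i"
    by (intro LIMSEQ_le_const2[of "\<lambda>m. norm (s i - s (i + m))"]) auto
qed

lemma geometric_tendsto:
  fixes s :: "nat \<Rightarrow> 'x::real_normed_vector"
  assumes q: "0 \<le> q" "q < 1" and s: "\<And>i. norm (s i - l) \<le> c * q ^ i"
  shows "s \<longlonglongrightarrow> l"
proof (rule LIM_zero_cancel, rule Lim_null_comparison)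
  show "(\<lambda>i. c * q ^ i) \<longlonglongrightarrow> 0"
    using q by (intro tendsto_mult_right_zero LIMSEQ_realpow_zero)
qed (use s in auto)

text \<open>The hypotheses in finitary real form: the \<sigma>-bounds are cleared of denominators,
  the \<tau>-bound concerns partial sums with \<open>k = -1 - j\<close> on the negative half line,
  and the limits run over naturals. \<open>\<Psi>\<close> enters through its one-step equation and
  the cocycle law, which determine it at all integer times. The condition \<open>\<tau>_le\<close>
  is an inequality so that a positive \<open>N\<close> is available when
  \<open>\<tau> = 0\<close>.\<close>

locale trichotomy_estimates =
  fixes M :: "'w measure"
    and \<theta> :: "int \<Rightarrow> 'w \<Rightarrow> 'w"
    and \<Phi> \<Psi> :: "int \<Rightarrow> 'w \<Rightarrow> 'x::banach \<Rightarrow> 'x"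
    and \<alpha>c \<alpha>s \<alpha>u :: "int \<Rightarrow> 'w \<Rightarrow> real"
    and Pc Ps Pu f :: "'w \<Rightarrow> 'x \<Rightarrow> 'x"
    and \<sigma> \<tau> N K :: real
  assumes ds: "measure_preserving_ds M \<theta>"
    and \<Phi>: "measurable_linear_rds M \<theta> \<Phi>"
    and tri: "trichotomy M \<theta> \<Phi> \<alpha>c \<alpha>s \<alpha>u Pc Ps Pu"
    and f: "f \<in> perturbations M"
    and \<Psi>: "measurable_rds M \<theta> \<Psi>"
    and \<Psi>_one: "\<And>\<omega> x. \<omega> \<in> space M \<Longrightarrow> \<Psi> 1 \<omega> x = \<Phi> 1 \<omega> x + f \<omega> x"
    and lim_s: "\<And>\<omega>. \<omega> \<in> space M \<Longrightarrow>
      (\<lambda>m. \<alpha>s (int m) (\<theta> (- int m) \<omega>) * \<alpha>c (- int m) \<omega>) \<longlonglongrightarrow> 0"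
    and lim_u: "\<And>\<omega>. \<omega> \<in> space M \<Longrightarrow>
      (\<lambda>m. \<alpha>u (- int m) (\<theta> (int m) \<omega>) * \<alpha>c (int m) \<omega>) \<longlonglongrightarrow> 0"
    and \<sigma>_plus: "\<And>\<omega> n. \<omega> \<in> space M \<Longrightarrow> 1 \<le> n \<Longrightarrow>
      (\<Sum>k=0..n-1. \<alpha>c (n - k - 1) (\<theta> (k + 1) \<omega>) * Lip (f (\<theta> k \<omega>)) * \<alpha>c k \<omega>) \<le> \<sigma> * \<alpha>c n \<omega>"
    and \<sigma>_minus: "\<And>\<omega> n. \<omega> \<in> space M \<Longrightarrow> n \<le> -1 \<Longrightarrow>
      (\<Sum>k=n..-1. \<alpha>c (n - k - 1) (\<theta> (k + 1) \<omega>) * Lip (f (\<theta> k \<omega>)) * \<alpha>c k \<omega>) \<le> \<sigma> * \<alpha>c n \<omega>"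
    and \<tau>_sum: "\<And>\<omega> m. \<omega> \<in> space M \<Longrightarrow>
      (\<Sum>j<m. \<alpha>s (int j) (\<theta> (- int j) \<omega>) * Lip (f (\<theta> (-1 - int j) \<omega>)) * \<alpha>c (-1 - int j) \<omega>) +
      (\<Sum>j<m. \<alpha>u (- int j - 1) (\<theta> (int j + 1) \<omega>) * Lip (f (\<theta> (int j) \<omega>)) * \<alpha>c (int j) \<omega>) \<le> \<tau>"
    and \<sigma>_nonneg: "0 \<le> \<sigma>" and \<tau>_nonneg: "0 \<le> \<tau>"
    and N: "0 < N" "N < 1"
    and \<sigma>_lt: "\<sigma> * (1 + N) < 1"
    and K_def: "K = 1 / (1 - \<sigma> * (1 + N))"
    and \<tau>_le: "\<tau> * K * (1 + N) \<le> N"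
    and contraction: "(1 + N) * \<sigma> + K * \<tau> < 1"
begin

lemma \<theta>_in [simp]: "\<omega> \<in> space M \<Longrightarrow> \<theta> n \<omega> \<in> space M"
  using ds measurable_space[of "\<lambda>(n, \<omega>). \<theta> n \<omega>" "count_space UNIV \<Otimes>\<^sub>M M" M "(n, \<omega>)"]
  unfolding measure_preserving_ds_def by (simp add: space_pair_measure)

lemma \<theta>_0 [simp]: "\<omega> \<in> space M \<Longrightarrow> \<theta> 0 \<omega> = \<omega>"
  using ds unfolding measure_preserving_ds_def by simp

lemma \<theta>_\<theta> [simp]: "\<omega> \<in> space M \<Longrightarrow> \<theta> n (\<theta> m \<omega>) = \<theta> (n + m) \<omega>"
  using ds unfolding measure_preserving_ds_def by simp

lemma \<Phi>_bounded_linear: "\<omega> \<in> space M \<Longrightarrow> bounded_linear (\<Phi> n \<omega>)"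
  using \<Phi> unfolding measurable_linear_rds_def by simp

lemmas \<Phi>_linear = bounded_linear.linear[OF \<Phi>_bounded_linear]
lemmas \<Phi>_simps = linear_add[OF \<Phi>_linear] linear_diff[OF \<Phi>_linear]
  linear_neg[OF \<Phi>_linear] linear_sum[OF \<Phi>_linear]

lemma \<Phi>_zero [simp]: "\<omega> \<in> space M \<Longrightarrow> \<Phi> n \<omega> 0 = 0"
  by (rule linear_0[OF \<Phi>_linear])

lemma \<Phi>_0 [simp]: "\<omega> \<in> space M \<Longrightarrow> \<Phi> 0 \<omega> x = x"
  using \<Phi> unfolding measurable_linear_rds_def measurable_rds_def by simp

lemma \<Phi>_\<Phi>: "\<omega> \<in> space M \<Longrightarrow> p = m + k \<Longrightarrow> \<Phi> n (\<theta> p \<omega>) (\<Phi> m (\<theta> k \<omega>) x) = \<Phi> (n + m) (\<theta> k \<omega>) x"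
  using \<Phi> unfolding measurable_linear_rds_def measurable_rds_def by simp

lemma \<Phi>_\<Phi>': "\<omega> \<in> space M \<Longrightarrow> \<Phi> n (\<theta> m \<omega>) (\<Phi> m \<omega> x) = \<Phi> (n + m) \<omega> x"
  using \<Phi>_\<Phi>[of \<omega> m m 0 n x] by simp

lemma \<Psi>_0 [simp]: "\<omega> \<in> space M \<Longrightarrow> \<Psi> 0 \<omega> x = x"
  using \<Psi> unfolding measurable_rds_def by simp

lemma \<Psi>_\<Psi>: "\<omega> \<in> space M \<Longrightarrow> \<Psi> n (\<theta> m \<omega>) (\<Psi> m \<omega> x) = \<Psi> (n + m) \<omega> x"
  using \<Psi> unfolding measurable_rds_def by simp

lemma projections:
  assumes "P \<in> {Pc, Ps, Pu}" "\<omega> \<in> space M"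
  shows "bounded_linear (P \<omega>)" "P \<omega> (P \<omega> x) = P \<omega> x"
    "P (\<theta> n \<omega>) (\<Phi> n \<omega> x) = \<Phi> n \<omega> (P \<omega> x)"
  using assms tri unfolding trichotomy_def bounded_projection_def by blast+

lemma P_simps:
  assumes "P \<in> {Pc, Ps, Pu}" "\<omega> \<in> space M"
  shows "P \<omega> 0 = 0" "P \<omega> (x + y) = P \<omega> x + P \<omega> y" "P \<omega> (x - y) = P \<omega> x - P \<omega> y"
    "P \<omega> (- x) = - P \<omega> x" "P \<omega> (sum z A) = (\<Sum>i\<in>A. P \<omega> (z i))"
proof -
  have "linear (P \<omega>)" using projections(1)[OF assms] by (rule bounded_linear.linear)
  then show "P \<omega> 0 = 0" "P \<omega> (x + y) = P \<omega> x + P \<omega> y" "P \<omega> (x - y) = P \<omega> x - P \<omega> y"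
      "P \<omega> (- x) = - P \<omega> x" "P \<omega> (sum z A) = (\<Sum>i\<in>A. P \<omega> (z i))"
    by (simp_all add: linear_0 linear_add linear_diff linear_neg linear_sum)
qed

lemma P_\<Phi>: "P \<in> {Pc, Ps, Pu} \<Longrightarrow> \<omega> \<in> space M \<Longrightarrow> p = n + k \<Longrightarrow>
    P (\<theta> p \<omega>) (\<Phi> n (\<theta> k \<omega>) x) = \<Phi> n (\<theta> k \<omega>) (P (\<theta> k \<omega>) x)"
  using projections(3)[of P "\<theta> k \<omega>" n x] by simp

lemma P_sum: "\<omega> \<in> space M \<Longrightarrow> Pc \<omega> x + Ps \<omega> x + Pu \<omega> x = x"
  using tri unfolding trichotomy_def by blast

lemma PcPs: "\<omega> \<in> space M \<Longrightarrow> Pc \<omega> (Ps \<omega> x) = 0"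
  using tri unfolding trichotomy_def by blast

text \<open>Two moves generate all relations from \<open>PcPs\<close>: applying a projection to the
  decomposition of \<open>x\<close>, and decomposing a vector that is already projected. The order
  of the derivations matters.\<close>

lemma P_orthogonal [simp]:
  assumes \<omega>: "\<omega> \<in> space M"
  shows "Pc \<omega> (Ps \<omega> x) = 0" "Pc \<omega> (Pu \<omega> x) = 0" "Ps \<omega> (Pc \<omega> x) = 0"
    "Ps \<omega> (Pu \<omega> x) = 0" "Pu \<omega> (Pc \<omega> x) = 0" "Pu \<omega> (Ps \<omega> x) = 0"
proof -
  note s = P_simps[OF _ \<omega>] projections(2)[OF _ \<omega>]
  show cs: "Pc \<omega> (Ps \<omega> x) = 0" for x by (rule PcPs[OF \<omega>])
  show cu: "Pc \<omega> (Pu \<omega> x) = 0" for x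
    using arg_cong[OF P_sum[OF \<omega>, of x], of "Pc \<omega>"] by (simp add: s cs)
  show us: "Pu \<omega> (Ps \<omega> x) = 0" for x
    using P_sum[OF \<omega>, of "Ps \<omega> x"] by (simp add: s cs)
  show su: "Ps \<omega> (Pu \<omega> x) = 0" for x
    using P_sum[OF \<omega>, of "Pu \<omega> x"] by (simp add: s cu)
  show "Ps \<omega> (Pc \<omega> x) = 0"
    using arg_cong[OF P_sum[OF \<omega>, of x], of "Ps \<omega>"] by (simp add: s su)
  show "Pu \<omega> (Pc \<omega> x) = 0"
    using arg_cong[OF P_sum[OF \<omega>, of x], of "Pu \<omega>"] by (simp add: s us)
qed

lemma \<alpha>_pos: "\<omega> \<in> space M \<Longrightarrow> 0 < \<alpha>c n \<omega>"
    "\<omega> \<in> space M \<Longrightarrow> 0 \<le> n \<Longrightarrow> 0 < \<alpha>s n \<omega>" "\<omega> \<in> space M \<Longrightarrow> n \<le> 0 \<Longrightarrow> 0 < \<alpha>u n \<omega>"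
  using tri unfolding trichotomy_def by blast+

lemma \<Phi>P_bounded_linear:
  "P \<in> {Pc, Ps, Pu} \<Longrightarrow> \<omega> \<in> space M \<Longrightarrow> bounded_linear (\<lambda>x. \<Phi> n \<omega> (P \<omega> x))"
  by (intro bounded_linear_compose[OF \<Phi>_bounded_linear] projections(1))

lemma \<Phi>P_norm_le:
  assumes \<omega>: "\<omega> \<in> space M"
  shows "norm (\<Phi> n \<omega> (Pc \<omega> x)) \<le> \<alpha>c n \<omega> * norm x"
    "0 \<le> n \<Longrightarrow> norm (\<Phi> n \<omega> (Ps \<omega> x)) \<le> \<alpha>s n \<omega> * norm x"
    "n \<le> 0 \<Longrightarrow> norm (\<Phi> n \<omega> (Pu \<omega> x)) \<le> \<alpha>u n \<omega> * norm x"
proof -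
  have *: "norm (\<Phi> n \<omega> (P \<omega> x)) \<le> a * norm x"
    if "P \<in> {Pc, Ps, Pu}" "onorm (\<lambda>x. \<Phi> n \<omega> (P \<omega> x)) \<le> a" for P a
    using onorm[OF \<Phi>P_bounded_linear[OF that(1) \<omega>], of n x] mult_right_mono[OF that(2), of "norm x"]
    by simp
  show "norm (\<Phi> n \<omega> (Pc \<omega> x)) \<le> \<alpha>c n \<omega> * norm x"
    using \<omega> tri unfolding trichotomy_def by (intro *) blast+
  show "norm (\<Phi> n \<omega> (Ps \<omega> x)) \<le> \<alpha>s n \<omega> * norm x" if "0 \<le> n"
    using that \<omega> tri unfolding trichotomy_def by (intro *) blast+
  show "norm (\<Phi> n \<omega> (Pu \<omega> x)) \<le> \<alpha>u n \<omega> * norm x" if "n \<le> 0"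
    using that \<omega> tri unfolding trichotomy_def by (intro *) blast+
qed

lemma f_props:
  assumes "\<omega> \<in> space M"
  shows "f \<omega> 0 = 0" "0 \<le> Lip (f \<omega>)" "norm (f \<omega> x - f \<omega> y) \<le> Lip (f \<omega>) * norm (x - y)"
proof -
  have *: "\<exists>C. C-lipschitz_on UNIV (f \<omega>)" "f \<omega> 0 = 0"
    using f assms unfolding perturbations_def by auto
  from lipschitz_Lip[OF *(1)] *(2) show "f \<omega> 0 = 0" "0 \<le> Lip (f \<omega>)"
    "norm (f \<omega> x - f \<omega> y) \<le> Lip (f \<omega>) * norm (x - y)"
    by (simp_all add: dist_norm)
qed

text \<open>The third identity is the origin of \<open>K\<close>: 1 is the contribution of the
  linear flow and \<open>(1 + N) * \<sigma> * K\<close> that of the nonlinearity along orbits with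
  constant \<open>K\<close>, so the Lipschitz bound on centre orbits reproduces itself.\<close>

lemma K: "1 \<le> K" "0 < K" "K = 1 + (1 + N) * \<sigma> * K"
proof -
  have "0 \<le> \<sigma> * (1 + N)" using \<sigma>_nonneg N by simp
  then show "1 \<le> K" using \<sigma>_lt unfolding K_def by simp
  then show "0 < K" by simp
  show "K = 1 + (1 + N) * \<sigma> * K" using \<sigma>_lt unfolding K_def by (simp add: field_simps)
qed

section \<open>Variation of constants over all integer times\<close>

definition Dsum :: "int \<Rightarrow> 'w \<Rightarrow> (int \<Rightarrow> 'x) \<Rightarrow> 'x" where
  "Dsum n \<omega> w = (if 0 \<le> n then \<Sum>k=0..n-1. \<Phi> (n - k - 1) (\<theta> (k + 1) \<omega>) (w k)
    else - (\<Sum>k=n..-1. \<Phi> (n - k - 1) (\<theta> (k + 1) \<omega>) (w k)))"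

lemma Dsum_step:
  assumes \<omega>: "\<omega> \<in> space M"
  shows "Dsum (n + 1) \<omega> w = \<Phi> 1 (\<theta> n \<omega>) (Dsum n \<omega> w) + w n"
proof -
  have *: "\<Phi> 1 (\<theta> n \<omega>) (\<Phi> (n - k - 1) (\<theta> (k + 1) \<omega>) y) = \<Phi> (n - k) (\<theta> (k + 1) \<omega>) y" for k y
    using \<omega> by (simp add: \<Phi>_\<Phi>)
  show ?thesis
  proof (cases "0 \<le> n")
    case True
    then have "{0..n} = insert n {0..n-1}" by auto
    then show ?thesis
      using True \<omega> by (simp add: Dsum_def \<Phi>_simps *)
  next
    case False
    then have "{n..-1} = insert n {n+1..-1}" by auto
    \<comment> \<open>For \<open>n = -1\<close> the left side falls into the nonnegative branch of
      \<open>Dsum\<close>; both sums are then empty.\<close>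
    moreover have "Dsum (n + 1) \<omega> w = - (\<Sum>k=n+1..-1. \<Phi> (n - k) (\<theta> (k + 1) \<omega>) (w k))"
      using False by (cases "n = -1") (auto simp: Dsum_def)
    ultimately show ?thesis
      using False \<omega> *[of n] by (simp add: Dsum_def \<Phi>_simps *)
  qed
qed

text \<open>The forcing \<open>w\<close> may depend on the solution \<open>z\<close> itself, so this
  turns an implicit nonlinear recursion into an integral-type equation and back; both directions are
  used.\<close>

lemma variation_of_constants:
  assumes \<omega>: "\<omega> \<in> space M"
  shows "(\<forall>n. z (n + 1) = \<Phi> 1 (\<theta> n \<omega>) (z n) + w n) \<longleftrightarrow> (\<forall>n. z n = \<Phi> n \<omega> (z 0) + Dsum n \<omega> w)"
proof
  define v where "v n = \<Phi> n \<omega> (z 0) + Dsum n \<omega> w" for n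
  have v: "v (n + 1) = \<Phi> 1 (\<theta> n \<omega>) (v n) + w n" for n
    using \<omega> by (simp add: v_def Dsum_step \<Phi>_simps \<Phi>_\<Phi>' add.commute[of 1 n])
  {
    assume *: "\<forall>n. z n = \<Phi> n \<omega> (z 0) + Dsum n \<omega> w"
    have "z n = v n" for n unfolding v_def using * by (rule spec)
    then show "\<forall>n. z (n + 1) = \<Phi> 1 (\<theta> n \<omega>) (z n) + w n" using v by simp
  next
    assume z: "\<forall>n. z (n + 1) = \<Phi> 1 (\<theta> n \<omega>) (z n) + w n"
    have "z n = v n" for n
    proof (induction n rule: int_induct[where k = 0])
      case base
      then show ?case using \<omega> by (simp add: v_def Dsum_def)
    next
      case (step1 i)
      then show ?case using z v by simp
    next
      case (step2 i)
      then have "\<Phi> 1 (\<theta> (i - 1) \<omega>) (z (i - 1)) = \<Phi> 1 (\<theta> (i - 1) \<omega>) (v (i - 1))"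
        using z[rule_format, of "i - 1"] v[of "i - 1"] by simp
      \<comment> \<open>\<open>\<Phi> (-1)\<close> on the fibre over
        \<open>\<theta> i \<omega>\<close> inverts \<open>\<Phi> 1\<close> on the preceding one,
        which determines the solution backwards in time.\<close>
      from arg_cong[OF this, of "\<Phi> (-1) (\<theta> i \<omega>)"] show ?case
        using \<omega> by (simp add: \<Phi>_\<Phi>)
    qed
    then show "\<forall>n. z n = \<Phi> n \<omega> (z 0) + Dsum n \<omega> w" unfolding v_def by (rule allI)
  }
qed

text \<open>The forcing \<open>g k\<close> enters the orbit at time \<open>k + 1\<close>, hence the
  projection on the fibre over \<open>\<theta> (k + 1) \<omega>\<close>.\<close>

definition Csum :: "int \<Rightarrow> 'w \<Rightarrow> (int \<Rightarrow> 'x) \<Rightarrow> 'x" where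
  "Csum n \<omega> g = Dsum n \<omega> (\<lambda>k. Pc (\<theta> (k + 1) \<omega>) (g k))"

lemma Csum_diff: "\<omega> \<in> space M \<Longrightarrow> Csum n \<omega> (\<lambda>k. g k - g' k) = Csum n \<omega> g - Csum n \<omega> g'"
  by (simp add: Csum_def Dsum_def P_simps \<Phi>_simps sum_subtractf)

lemma Csum_zero [simp]: "\<omega> \<in> space M \<Longrightarrow> Csum n \<omega> (\<lambda>k. 0) = 0"
  by (simp add: Csum_def Dsum_def P_simps)

lemma Pc_Dsum: "\<omega> \<in> space M \<Longrightarrow> Pc (\<theta> n \<omega>) (Dsum n \<omega> w) = Csum n \<omega> w"
  by (simp add: Csum_def Dsum_def P_simps P_\<Phi>)

lemma Pc_Csum: "\<omega> \<in> space M \<Longrightarrow> Pc (\<theta> n \<omega>) (Csum n \<omega> g) = Csum n \<omega> g"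
  by (simp add: Csum_def Pc_Dsum) (simp add: Csum_def Dsum_def projections)

text \<open>The bound on \<open>g\<close> is demanded only at the times that occur between 0 and
  \<open>n\<close>, so that \<open>C\<close> may come from a finite window.\<close>

lemma Csum_norm_le:
  assumes \<omega>: "\<omega> \<in> space M" and C: "0 \<le> C"
    and g: "\<And>k. 0 \<le> k \<and> k < n \<or> n \<le> k \<and> k < 0 \<Longrightarrow> norm (g k) \<le> C * (Lip (f (\<theta> k \<omega>)) * \<alpha>c k \<omega>)"
  shows "norm (Csum n \<omega> g) \<le> C * \<sigma> * \<alpha>c n \<omega>"
proof -
  have *: "norm (\<Sum>k\<in>A. \<Phi> (n - k - 1) (\<theta> (k + 1) \<omega>) (Pc (\<theta> (k + 1) \<omega>) (g k))) \<le>
      C * (\<Sum>k\<in>A. \<alpha>c (n - k - 1) (\<theta> (k + 1) \<omega>) * Lip (f (\<theta> k \<omega>)) * \<alpha>c k \<omega>)"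
    if "\<And>k. k \<in> A \<Longrightarrow> 0 \<le> k \<and> k < n \<or> n \<le> k \<and> k < 0" for A
    unfolding sum_distrib_left
  proof (rule sum_norm_le)
    fix k assume "k \<in> A"
    have "norm (\<Phi> (n - k - 1) (\<theta> (k + 1) \<omega>) (Pc (\<theta> (k + 1) \<omega>) (g k)))
        \<le> \<alpha>c (n - k - 1) (\<theta> (k + 1) \<omega>) * norm (g k)"
      using \<omega> by (intro \<Phi>P_norm_le) simp
    also have "\<dots> \<le> \<alpha>c (n - k - 1) (\<theta> (k + 1) \<omega>) * (C * (Lip (f (\<theta> k \<omega>)) * \<alpha>c k \<omega>))"
      using \<omega> \<alpha>_pos(1)[of "\<theta> (k + 1) \<omega>"] by (intro mult_left_mono g that \<open>k \<in> A\<close>) (simp add: less_imp_le)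
    finally show "norm (\<Phi> (n - k - 1) (\<theta> (k + 1) \<omega>) (Pc (\<theta> (k + 1) \<omega>) (g k)))
        \<le> C * (\<alpha>c (n - k - 1) (\<theta> (k + 1) \<omega>) * Lip (f (\<theta> k \<omega>)) * \<alpha>c k \<omega>)"
      by (simp add: mult_ac)
  qed
  consider "n = 0" | "n \<ge> 1" | "n \<le> -1" by linarith
  then show ?thesis
  proof cases
    case 1
    then show ?thesis using C \<sigma>_nonneg \<alpha>_pos(1)[OF \<omega>, of 0] by (simp add: Csum_def Dsum_def)
  next
    case 2
    have "norm (Csum n \<omega> g) \<le>
        C * (\<Sum>k=0..n-1. \<alpha>c (n - k - 1) (\<theta> (k + 1) \<omega>) * Lip (f (\<theta> k \<omega>)) * \<alpha>c k \<omega>)"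
      using 2 *[of "{0..n-1}"] by (simp add: Csum_def Dsum_def)
    also have "\<dots> \<le> C * (\<sigma> * \<alpha>c n \<omega>)" using \<sigma>_plus[OF \<omega> 2] C by (rule mult_left_mono)
    finally show ?thesis by (simp add: mult_ac)
  next
    case 3
    have "norm (Csum n \<omega> g) \<le>
        C * (\<Sum>k=n..-1. \<alpha>c (n - k - 1) (\<theta> (k + 1) \<omega>) * Lip (f (\<theta> k \<omega>)) * \<alpha>c k \<omega>)"
      using 3 *[of "{n..-1}"] by (simp add: Csum_def Dsum_def)
    also have "\<dots> \<le> C * (\<sigma> * \<alpha>c n \<omega>)" using \<sigma>_minus[OF \<omega> 3] C by (rule mult_left_mono)
    finally show ?thesis by (simp add: mult_ac)
  qed
qed

section \<open>The stable and unstable series\<close>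

definition Sterm :: "'w \<Rightarrow> (int \<Rightarrow> 'x) \<Rightarrow> nat \<Rightarrow> 'x" where
  "Sterm \<omega> g j = \<Phi> (int j) (\<theta> (- int j) \<omega>) (Ps (\<theta> (- int j) \<omega>) (g (-1 - int j)))"

definition Uterm :: "'w \<Rightarrow> (int \<Rightarrow> 'x) \<Rightarrow> nat \<Rightarrow> 'x" where
  "Uterm \<omega> g j = \<Phi> (- int j - 1) (\<theta> (int j + 1) \<omega>) (Pu (\<theta> (int j + 1) \<omega>) (g (int j)))"

text \<open>The stable component accumulates forcing from the infinite past. The unstable one is
  solved backwards from the infinite future, which produces the minus sign.\<close>

definition SUsum :: "'w \<Rightarrow> (int \<Rightarrow> 'x) \<Rightarrow> 'x" where
  "SUsum \<omega> g = (\<Sum>j. Sterm \<omega> g j) - (\<Sum>j. Uterm \<omega> g j)"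

lemma term_diff:
  assumes "\<omega> \<in> space M"
  shows "Sterm \<omega> (\<lambda>k. g k - g' k) j = Sterm \<omega> g j - Sterm \<omega> g' j"
    "Uterm \<omega> (\<lambda>k. g k - g' k) j = Uterm \<omega> g j - Uterm \<omega> g' j"
  using assms by (simp_all add: Sterm_def Uterm_def P_simps \<Phi>_simps)

lemma SUsum_zero [simp]: "\<omega> \<in> space M \<Longrightarrow> SUsum \<omega> (\<lambda>k. 0) = 0"
  by (simp add: SUsum_def Sterm_def Uterm_def P_simps)

lemma SUsum_bounds:
  assumes \<omega>: "\<omega> \<in> space M"
    and g: "\<And>k. norm (g k) \<le> C * (Lip (f (\<theta> k \<omega>)) * \<alpha>c k \<omega>)"
  shows "summable (Sterm \<omega> g)" "summable (Uterm \<omega> g)"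
    "0 \<le> C \<Longrightarrow> norm (SUsum \<omega> g) \<le> C * \<tau>"
proof -
  define a where "a j = \<alpha>s (int j) (\<theta> (- int j) \<omega>) * Lip (f (\<theta> (-1 - int j) \<omega>)) * \<alpha>c (-1 - int j) \<omega>" for j
  define b where "b j = \<alpha>u (- int j - 1) (\<theta> (int j + 1) \<omega>) * Lip (f (\<theta> (int j) \<omega>)) * \<alpha>c (int j) \<omega>" for j
  have a0: "0 \<le> a j" and b0: "0 \<le> b j" for j
    using \<omega> unfolding a_def b_def
    by (intro mult_nonneg_nonneg f_props less_imp_le[OF \<alpha>_pos(1)] less_imp_le[OF \<alpha>_pos(2)]
        less_imp_le[OF \<alpha>_pos(3)]; simp)+
  have ab: "(\<Sum>j<m. a j) + (\<Sum>j<m. b j) \<le> \<tau>" for m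
    using \<tau>_sum[OF \<omega>] unfolding a_def b_def .
  have "(\<Sum>j<m. a j) \<le> \<tau>" "(\<Sum>j<m. b j) \<le> \<tau>" for m
    using ab[of m] sum_nonneg[of "{..<m}" a] sum_nonneg[of "{..<m}" b] a0 b0 by auto
  then have sa: "summable a" and sb: "summable b"
    using a0 b0 by (auto intro!: summableI_nonneg_bounded[where x = \<tau>])
  \<comment> \<open>Taking the limit of the joint partial sums keeps the constant
    \<open>\<tau>\<close>; adding separate bounds for the two series would give twice that.\<close>
  have "(\<lambda>m. (\<Sum>j<m. a j) + (\<Sum>j<m. b j)) \<longlonglongrightarrow> suminf a + suminf b"
    using sa sb by (intro tendsto_add summable_LIMSEQ)
  then have sum_ab: "suminf a + suminf b \<le> \<tau>"
    by (rule LIMSEQ_le_const2) (use ab in auto)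
  have S: "norm (Sterm \<omega> g j) \<le> C * a j" for j
  proof -
    have "norm (Sterm \<omega> g j) \<le> \<alpha>s (int j) (\<theta> (- int j) \<omega>) * norm (g (-1 - int j))"
      using \<omega> unfolding Sterm_def by (intro \<Phi>P_norm_le) simp_all
    also have "\<dots> \<le> \<alpha>s (int j) (\<theta> (- int j) \<omega>) * (C * (Lip (f (\<theta> (-1 - int j) \<omega>)) * \<alpha>c (-1 - int j) \<omega>))"
      using \<omega> by (intro mult_left_mono g less_imp_le[OF \<alpha>_pos(2)]) simp_all
    finally show ?thesis by (simp add: a_def mult_ac)
  qed
  have U: "norm (Uterm \<omega> g j) \<le> C * b j" for j
  proof -
    have "norm (Uterm \<omega> g j) \<le> \<alpha>u (- int j - 1) (\<theta> (int j + 1) \<omega>) * norm (g (int j))"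
      using \<omega> unfolding Uterm_def by (intro \<Phi>P_norm_le) simp_all
    also have "\<dots> \<le> \<alpha>u (- int j - 1) (\<theta> (int j + 1) \<omega>) * (C * (Lip (f (\<theta> (int j) \<omega>)) * \<alpha>c (int j) \<omega>))"
      using \<omega> by (intro mult_left_mono g less_imp_le[OF \<alpha>_pos(3)]) simp_all
    finally show ?thesis by (simp add: b_def mult_ac)
  qed
  have Ca: "summable (\<lambda>j. C * a j)" and Cb: "summable (\<lambda>j. C * b j)"
    using sa sb by (auto intro: summable_mult)
  show "summable (Sterm \<omega> g)" "summable (Uterm \<omega> g)"
    using summable_comparison_test'[OF Ca, of 0 "Sterm \<omega> g"] S
      summable_comparison_test'[OF Cb, of 0 "Uterm \<omega> g"] U by auto
  assume C: "0 \<le> C"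
  have "norm (SUsum \<omega> g) \<le> norm (\<Sum>j. Sterm \<omega> g j) + norm (\<Sum>j. Uterm \<omega> g j)"
    unfolding SUsum_def by (rule norm_triangle_ineq4)
  also have "\<dots> \<le> (\<Sum>j. C * a j) + (\<Sum>j. C * b j)"
    by (intro add_mono norm_suminf_le S U Ca Cb)
  also have "\<dots> = C * (suminf a + suminf b)"
    using sa sb by (simp add: suminf_mult distrib_left)
  also have "\<dots> \<le> C * \<tau>" using sum_ab C by (rule mult_left_mono)
  finally show "norm (SUsum \<omega> g) \<le> C * \<tau>" .
qed

lemma SUsum_diff:
  assumes \<omega>: "\<omega> \<in> space M"
    and g: "\<And>k. norm (g k) \<le> C * (Lip (f (\<theta> k \<omega>)) * \<alpha>c k \<omega>)"
    and g': "\<And>k. norm (g' k) \<le> C' * (Lip (f (\<theta> k \<omega>)) * \<alpha>c k \<omega>)"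
  shows "SUsum \<omega> (\<lambda>k. g k - g' k) = SUsum \<omega> g - SUsum \<omega> g'"
  by (simp add: SUsum_def term_diff[OF \<omega>]
      suminf_diff[OF SUsum_bounds(1)[OF \<omega> g] SUsum_bounds(1)[OF \<omega> g'], symmetric]
      suminf_diff[OF SUsum_bounds(2)[OF \<omega> g] SUsum_bounds(2)[OF \<omega> g'], symmetric])

lemma Pc_SUsum:
  assumes \<omega>: "\<omega> \<in> space M"
    and g: "\<And>k. norm (g k) \<le> C * (Lip (f (\<theta> k \<omega>)) * \<alpha>c k \<omega>)"
  shows "Pc \<omega> (SUsum \<omega> g) = 0"
proof -
  have "Pc \<omega> (Sterm \<omega> g j) = 0" "Pc \<omega> (Uterm \<omega> g j) = 0" for j
    using \<omega> P_\<Phi>[of Pc \<omega> 0 "int j" "- int j"] P_\<Phi>[of Pc \<omega> 0 "- int j - 1" "int j + 1"]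
    by (simp_all add: Sterm_def Uterm_def)
  moreover have "Pc \<omega> (suminf (Sterm \<omega> g)) = (\<Sum>j. Pc \<omega> (Sterm \<omega> g j))"
    "Pc \<omega> (suminf (Uterm \<omega> g)) = (\<Sum>j. Pc \<omega> (Uterm \<omega> g j))"
    using bounded_linear.suminf[OF projections(1)[of Pc \<omega>]] SUsum_bounds(1,2)[OF \<omega> g] \<omega> by auto
  ultimately show ?thesis by (simp add: SUsum_def P_simps \<omega>)
qed

text \<open>Moving the base point one step forward turns time 0 from future into past: the term
  \<open>g 0\<close> leaves the unstable series and enters the stable one. The two signs in
  \<open>SUsum\<close> make both effects add up to the noncentral part of one step of the
  recursion.\<close>

lemma SUsum_shift:
  assumes \<omega>: "\<omega> \<in> space M"
    and g: "\<And>k. norm (g k) \<le> C * (Lip (f (\<theta> k \<omega>)) * \<alpha>c k \<omega>)"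
  shows "SUsum (\<theta> 1 \<omega>) (\<lambda>k. g (k + 1)) =
    \<Phi> 1 \<omega> (SUsum \<omega> g) + Ps (\<theta> 1 \<omega>) (g 0) + Pu (\<theta> 1 \<omega>) (g 0)"
proof -
  let ?S = "Sterm (\<theta> 1 \<omega>) (\<lambda>k. g (k + 1))" and ?U = "Uterm (\<theta> 1 \<omega>) (\<lambda>k. g (k + 1))"
  note sums = SUsum_bounds(1,2)[OF \<omega> g]
  note bl = \<Phi>_bounded_linear[OF \<omega>, of 1]
  have S: "\<Phi> 1 \<omega> (Sterm \<omega> g j) = ?S (Suc j)" "?S 0 = Ps (\<theta> 1 \<omega>) (g 0)" for j
    using \<omega> \<Phi>_\<Phi>[of \<omega> 0 "int j" "- int j" 1] by (simp_all add: Sterm_def)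
  have U: "\<Phi> 1 \<omega> (Uterm \<omega> g (Suc j)) = ?U j" "\<Phi> 1 \<omega> (Uterm \<omega> g 0) = Pu (\<theta> 1 \<omega>) (g 0)" for j
    using \<omega> \<Phi>_\<Phi>[of \<omega> 0 "- int j - 2" "int j + 2" 1] \<Phi>_\<Phi>[of \<omega> 0 "-1" 1 1]
    by (simp_all add: Uterm_def algebra_simps minus_diff_commute[of 1])
  note sS = bounded_linear.sums[OF bl summable_sums[OF sums(1)]]
  note sU = bounded_linear.sums[OF bl summable_sums[OF sums(2)]]
  have "suminf ?S = \<Phi> 1 \<omega> (suminf (Sterm \<omega> g)) + Ps (\<theta> 1 \<omega>) (g 0)"
    using sS by (simp add: S(1) sums_Suc_iff S(2) sums_iff)
  moreover have "suminf ?U = \<Phi> 1 \<omega> (suminf (Uterm \<omega> g)) - Pu (\<theta> 1 \<omega>) (g 0)"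
    using sums_Suc_iff[of "\<lambda>j. \<Phi> 1 \<omega> (Uterm \<omega> g j)"
        "\<Phi> 1 \<omega> (suminf (Uterm \<omega> g)) - Pu (\<theta> 1 \<omega>) (g 0)"] sU by (simp add: U sums_iff)
  ultimately show ?thesis
    using \<omega> by (simp add: SUsum_def \<Phi>_simps)
qed

text \<open>The maximum of \<open>norm (u k) / \<alpha>c k \<omega>\<close> over the finite window between \<open>0\<close> and \<open>n\<close> bounds itself, so
  that no a priori growth bound on \<open>u\<close> is needed.\<close>

lemma window_bound:
  assumes \<omega>: "\<omega> \<in> space M" and \<xi>: "Pc \<omega> \<xi> = \<xi>"
    and u: "\<And>n. u n = \<Phi> n \<omega> \<xi> + Csum n \<omega> g"
    and g: "\<And>k. norm (g k) \<le> Lip (f (\<theta> k \<omega>)) * ((1 + N) * norm (u k))"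
  shows "norm (u n) \<le> K * \<alpha>c n \<omega> * norm \<xi>"
proof -
  define W where "W = {min 0 n..max 0 n}"
  have "finite W" "n \<in> W" by (auto simp: W_def)
  define m where "m = Max ((\<lambda>k. norm (u k) / \<alpha>c k \<omega>) ` W)"
  have m: "norm (u k) \<le> m * \<alpha>c k \<omega>" if "k \<in> W" for k
  proof -
    have "norm (u k) / \<alpha>c k \<omega> \<le> m"
      unfolding m_def using \<open>finite W\<close> that by (intro Max_ge) auto
    then show ?thesis using \<alpha>_pos(1)[OF \<omega>, of k] by (simp add: divide_simps)
  qed
  have "m \<ge> 0"
  proof (rule ccontr)
    assume "\<not> m \<ge> 0"
    then have "m * \<alpha>c n \<omega> < 0" using \<alpha>_pos(1)[OF \<omega>, of n] by (simp add: mult_neg_pos)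
    then show False using m[OF \<open>n \<in> W\<close>] norm_ge_zero[of "u n"] by linarith
  qed
  have step: "norm (u k) / \<alpha>c k \<omega> \<le> norm \<xi> + (1 + N) * m * \<sigma>" if "k \<in> W" for k
  proof -
    have "norm (Csum k \<omega> g) \<le> (1 + N) * m * \<sigma> * \<alpha>c k \<omega>"
    proof (rule Csum_norm_le[OF \<omega>])
      show "0 \<le> (1 + N) * m" using N \<open>m \<ge> 0\<close> by simp
      fix l assume "0 \<le> l \<and> l < k \<or> k \<le> l \<and> l < 0"
      \<comment> \<open>For every \<open>k\<close> in the window, all times between 0 and
        \<open>k\<close> lie in it too, so \<open>m\<close> bounds every term occurring in
        \<open>Csum k\<close>.\<close>
      then have "l \<in> W" using that by (auto simp: W_def)
      have "norm (g l) \<le> Lip (f (\<theta> l \<omega>)) * ((1 + N) * norm (u l))" by (rule g)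
      also have "\<dots> \<le> Lip (f (\<theta> l \<omega>)) * ((1 + N) * (m * \<alpha>c l \<omega>))"
        using N \<omega> by (intro mult_left_mono m \<open>l \<in> W\<close> f_props) auto
      finally show "norm (g l) \<le> (1 + N) * m * (Lip (f (\<theta> l \<omega>)) * \<alpha>c l \<omega>)"
        by (simp add: mult_ac)
    qed
    moreover have "norm (\<Phi> k \<omega> \<xi>) \<le> \<alpha>c k \<omega> * norm \<xi>"
      using \<Phi>P_norm_le(1)[OF \<omega>, of k \<xi>] \<xi> by simp
    ultimately have "norm (u k) \<le> (norm \<xi> + (1 + N) * m * \<sigma>) * \<alpha>c k \<omega>"
      using norm_triangle_ineq[of "\<Phi> k \<omega> \<xi>" "Csum k \<omega> g"] by (simp add: u algebra_simps)
    then show ?thesis using \<alpha>_pos(1)[OF \<omega>, of k] by (simp add: divide_simps)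
  qed
  have "m \<in> (\<lambda>k. norm (u k) / \<alpha>c k \<omega>) ` W"
    unfolding m_def using \<open>finite W\<close> \<open>n \<in> W\<close> by (intro Max_in) auto
  \<comment> \<open>The estimate is evaluated where the maximum is attained;
    \<open>\<sigma> * (1 + N) < 1\<close> then allows \<open>m\<close> to be absorbed on the
    left.\<close>
  then have "m \<le> norm \<xi> + (1 + N) * m * \<sigma>" using step by auto
  then have "m \<le> K * norm \<xi>"
    using \<sigma>_lt unfolding K_def by (simp add: field_simps)
  then have "m * \<alpha>c n \<omega> \<le> K * norm \<xi> * \<alpha>c n \<omega>"
    using \<alpha>_pos(1)[OF \<omega>, of n] by (intro mult_right_mono) auto
  with m[OF \<open>n \<in> W\<close>] show ?thesis by (simp add: mult_ac)
qed

section \<open>The Lyapunov--Perron operator\<close>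

text \<open>A total function on X with no condition off E^c. Measurability is carried separately by
  \<open>measurable_pair\<close>, so the estimates below are purely fibrewise.\<close>

definition lipschitz_graph :: "('w \<Rightarrow> 'x \<Rightarrow> 'x) \<Rightarrow> bool" where
  "lipschitz_graph h \<longleftrightarrow> (\<forall>\<omega>\<in>space M. h \<omega> 0 = 0 \<and>
    (\<forall>\<xi>. Pc \<omega> \<xi> = \<xi> \<longrightarrow> Pc \<omega> (h \<omega> \<xi>) = 0) \<and>
    (\<forall>\<xi> \<xi>'. Pc \<omega> \<xi> = \<xi> \<longrightarrow> Pc \<omega> \<xi>' = \<xi>' \<longrightarrow> norm (h \<omega> \<xi> - h \<omega> \<xi>') \<le> N * norm (\<xi> - \<xi>')))"

text \<open>No flow property is imposed, since the operator need not preserve one; for fixed pairs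
  it is recovered in \<open>center_flow\<close>.\<close>

definition center_family :: "(int \<Rightarrow> 'w \<Rightarrow> 'x \<Rightarrow> 'x) \<Rightarrow> bool" where
  "center_family x \<longleftrightarrow> (\<forall>\<omega>\<in>space M. \<forall>n. x n \<omega> 0 = 0 \<and>
    (\<forall>\<xi>. Pc \<omega> \<xi> = \<xi> \<longrightarrow> Pc (\<theta> n \<omega>) (x n \<omega> \<xi>) = x n \<omega> \<xi>) \<and>
    (\<forall>\<xi> \<xi>'. Pc \<omega> \<xi> = \<xi> \<longrightarrow> Pc \<omega> \<xi>' = \<xi>' \<longrightarrow>
      norm (x n \<omega> \<xi> - x n \<omega> \<xi>') \<le> K * \<alpha>c n \<omega> * norm (\<xi> - \<xi>')))"

definition nonlin :: "(int \<Rightarrow> 'w \<Rightarrow> 'x \<Rightarrow> 'x) \<Rightarrow> ('w \<Rightarrow> 'x \<Rightarrow> 'x) \<Rightarrow> 'w \<Rightarrow> 'x \<Rightarrow> int \<Rightarrow> 'x" where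
  "nonlin x h \<omega> \<xi> k = f (\<theta> k \<omega>) (x k \<omega> \<xi> + h (\<theta> k \<omega>) (x k \<omega> \<xi>))"

definition Cop :: "(int \<Rightarrow> 'w \<Rightarrow> 'x \<Rightarrow> 'x) \<Rightarrow> ('w \<Rightarrow> 'x \<Rightarrow> 'x) \<Rightarrow> int \<Rightarrow> 'w \<Rightarrow> 'x \<Rightarrow> 'x" where
  "Cop x h n \<omega> \<xi> = \<Phi> n \<omega> \<xi> + Csum n \<omega> (nonlin x h \<omega> \<xi>)"

definition SUop :: "(int \<Rightarrow> 'w \<Rightarrow> 'x \<Rightarrow> 'x) \<Rightarrow> ('w \<Rightarrow> 'x \<Rightarrow> 'x) \<Rightarrow> 'w \<Rightarrow> 'x \<Rightarrow> 'x" where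
  "SUop x h \<omega> \<xi> = SUsum \<omega> (nonlin x h \<omega> \<xi>)"

definition fixed_pair :: "(int \<Rightarrow> 'w \<Rightarrow> 'x \<Rightarrow> 'x) \<Rightarrow> ('w \<Rightarrow> 'x \<Rightarrow> 'x) \<Rightarrow> bool" where
  "fixed_pair x h \<longleftrightarrow> (\<forall>\<omega>\<in>space M. \<forall>\<xi>. Pc \<omega> \<xi> = \<xi> \<longrightarrow>
    h \<omega> \<xi> = SUop x h \<omega> \<xi> \<and> (\<forall>n. x n \<omega> \<xi> = Cop x h n \<omega> \<xi>))"

text \<open>A bound on a weighted distance, uniform in fibre and time. It is relative to
  \<open>norm \<xi>\<close> because all maps concerned vanish at 0 and are Lipschitz; stating it as
  an inequality avoids suprema and a function space.\<close>

definition close_pairs :: "real \<Rightarrow> real \<Rightarrow> (int \<Rightarrow> 'w \<Rightarrow> 'x \<Rightarrow> 'x) \<Rightarrow> ('w \<Rightarrow> 'x \<Rightarrow> 'x) \<Rightarrow>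
    (int \<Rightarrow> 'w \<Rightarrow> 'x \<Rightarrow> 'x) \<Rightarrow> ('w \<Rightarrow> 'x \<Rightarrow> 'x) \<Rightarrow> bool" where
  "close_pairs a b x h y l \<longleftrightarrow> (\<forall>\<omega>\<in>space M. \<forall>\<xi>. Pc \<omega> \<xi> = \<xi> \<longrightarrow>
    norm (h \<omega> \<xi> - l \<omega> \<xi>) \<le> b * norm \<xi> \<and>
    (\<forall>n. norm (x n \<omega> \<xi> - y n \<omega> \<xi>) \<le> a * \<alpha>c n \<omega> * norm \<xi>))"

lemma Pc_zero [simp]: "\<omega> \<in> space M \<Longrightarrow> Pc \<omega> 0 = 0"
  by (simp add: P_simps)

lemma graphD:
  assumes "lipschitz_graph h" "\<omega> \<in> space M"
  shows "h \<omega> 0 = 0" "Pc \<omega> \<xi> = \<xi> \<Longrightarrow> Pc \<omega> (h \<omega> \<xi>) = 0"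
    "Pc \<omega> \<xi> = \<xi> \<Longrightarrow> Pc \<omega> \<xi>' = \<xi>' \<Longrightarrow> norm (h \<omega> \<xi> - h \<omega> \<xi>') \<le> N * norm (\<xi> - \<xi>')"
    "Pc \<omega> \<xi> = \<xi> \<Longrightarrow> norm (h \<omega> \<xi>) \<le> N * norm \<xi>"
proof -
  show *: "h \<omega> 0 = 0" "Pc \<omega> \<xi> = \<xi> \<Longrightarrow> Pc \<omega> (h \<omega> \<xi>) = 0"
    "Pc \<omega> \<xi> = \<xi> \<Longrightarrow> Pc \<omega> \<xi>' = \<xi>' \<Longrightarrow> norm (h \<omega> \<xi> - h \<omega> \<xi>') \<le> N * norm (\<xi> - \<xi>')" for \<xi> \<xi>'
    using assms unfolding lipschitz_graph_def by blast+
  show "Pc \<omega> \<xi> = \<xi> \<Longrightarrow> norm (h \<omega> \<xi>) \<le> N * norm \<xi>"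
    using *(3)[of \<xi> 0] *(1) assms(2) by simp
qed

lemma centerD:
  assumes "center_family x" "\<omega> \<in> space M"
  shows "x n \<omega> 0 = 0" "Pc \<omega> \<xi> = \<xi> \<Longrightarrow> Pc (\<theta> n \<omega>) (x n \<omega> \<xi>) = x n \<omega> \<xi>"
    "Pc \<omega> \<xi> = \<xi> \<Longrightarrow> Pc \<omega> \<xi>' = \<xi>' \<Longrightarrow>
      norm (x n \<omega> \<xi> - x n \<omega> \<xi>') \<le> K * \<alpha>c n \<omega> * norm (\<xi> - \<xi>')"
    "Pc \<omega> \<xi> = \<xi> \<Longrightarrow> norm (x n \<omega> \<xi>) \<le> K * \<alpha>c n \<omega> * norm \<xi>"
proof -
  show *: "x n \<omega> 0 = 0" "Pc \<omega> \<xi> = \<xi> \<Longrightarrow> Pc (\<theta> n \<omega>) (x n \<omega> \<xi>) = x n \<omega> \<xi>"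
    "Pc \<omega> \<xi> = \<xi> \<Longrightarrow> Pc \<omega> \<xi>' = \<xi>' \<Longrightarrow>
      norm (x n \<omega> \<xi> - x n \<omega> \<xi>') \<le> K * \<alpha>c n \<omega> * norm (\<xi> - \<xi>')" for \<xi> \<xi>'
    using assms unfolding center_family_def by blast+
  show "Pc \<omega> \<xi> = \<xi> \<Longrightarrow> norm (x n \<omega> \<xi>) \<le> K * \<alpha>c n \<omega> * norm \<xi>"
    using *(3)[of \<xi> 0] *(1) assms(2) by simp
qed

text \<open>Inserting \<open>h \<omega> \<zeta>'\<close> splits the difference into a move along the
  graph of \<open>h\<close>, which costs \<open>1 + N\<close>, and the vertical gap between two
  graphs over \<open>\<zeta>'\<close>. For \<open>l = h\<close> the gap vanishes.\<close>

lemma f_graph_diff: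
  assumes h: "lipschitz_graph h" and \<omega>: "\<omega> \<in> space M" and "Pc \<omega> \<zeta> = \<zeta>" "Pc \<omega> \<zeta>' = \<zeta>'"
  shows "norm (f \<omega> (\<zeta> + h \<omega> \<zeta>) - f \<omega> (\<zeta>' + l \<omega> \<zeta>'))
    \<le> Lip (f \<omega>) * ((1 + N) * norm (\<zeta> - \<zeta>') + norm (h \<omega> \<zeta>' - l \<omega> \<zeta>'))"
proof -
  have "norm ((\<zeta> + h \<omega> \<zeta>) - (\<zeta>' + l \<omega> \<zeta>'))
      = norm ((\<zeta> - \<zeta>') + (h \<omega> \<zeta> - h \<omega> \<zeta>') + (h \<omega> \<zeta>' - l \<omega> \<zeta>'))"
    by (simp add: algebra_simps)
  also have "\<dots> \<le> norm (\<zeta> - \<zeta>') + norm (h \<omega> \<zeta> - h \<omega> \<zeta>') + norm (h \<omega> \<zeta>' - l \<omega> \<zeta>')"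
    by (intro norm_triangle_le add_mono norm_triangle_ineq order_refl)
  also have "\<dots> \<le> (1 + N) * norm (\<zeta> - \<zeta>') + norm (h \<omega> \<zeta>' - l \<omega> \<zeta>')"
    using graphD(3)[OF h \<omega> assms(3,4)] by (simp add: algebra_simps)
  finally have "norm ((\<zeta> + h \<omega> \<zeta>) - (\<zeta>' + l \<omega> \<zeta>'))
      \<le> (1 + N) * norm (\<zeta> - \<zeta>') + norm (h \<omega> \<zeta>' - l \<omega> \<zeta>')" .
  from mult_left_mono[OF this f_props(2)[OF \<omega>]] f_props(3)[OF \<omega>] show ?thesis
    by (rule order_trans[rotated])
qed

lemma nonlin_lipschitz:
  assumes "center_family x" "lipschitz_graph h" and \<omega>: "\<omega> \<in> space M"
    and \<xi>: "Pc \<omega> \<xi> = \<xi>" "Pc \<omega> \<xi>' = \<xi>'"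
  shows "norm (nonlin x h \<omega> \<xi> k - nonlin x h \<omega> \<xi>' k)
    \<le> (1 + N) * K * norm (\<xi> - \<xi>') * (Lip (f (\<theta> k \<omega>)) * \<alpha>c k \<omega>)"
proof -
  have "norm (nonlin x h \<omega> \<xi> k - nonlin x h \<omega> \<xi>' k)
      \<le> Lip (f (\<theta> k \<omega>)) * ((1 + N) * norm (x k \<omega> \<xi> - x k \<omega> \<xi>'))"
    using f_graph_diff[OF assms(2), of "\<theta> k \<omega>" "x k \<omega> \<xi>" "x k \<omega> \<xi>'" h] assms centerD(2)
    by (simp add: nonlin_def)
  also have "\<dots> \<le> Lip (f (\<theta> k \<omega>)) * ((1 + N) * (K * \<alpha>c k \<omega> * norm (\<xi> - \<xi>')))"
    using N \<omega> by (intro mult_left_mono centerD(3)[OF assms(1)] \<xi> f_props) auto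
  finally show ?thesis by (simp add: mult_ac)
qed

lemma nonlin_zero:
  assumes "center_family x" "lipschitz_graph h" and \<omega>: "\<omega> \<in> space M"
  shows "nonlin x h \<omega> 0 = (\<lambda>k. 0)"
  using \<omega> by (simp add: fun_eq_iff nonlin_def centerD(1)[OF assms(1)] graphD(1)[OF assms(2)] f_props(1))

lemma nonlin_le:
  assumes "center_family x" "lipschitz_graph h" and \<omega>: "\<omega> \<in> space M" and "Pc \<omega> \<xi> = \<xi>"
  shows "norm (nonlin x h \<omega> \<xi> k) \<le> (1 + N) * K * norm \<xi> * (Lip (f (\<theta> k \<omega>)) * \<alpha>c k \<omega>)"
  using nonlin_lipschitz[OF assms(1-4), of 0 k] \<omega> nonlin_zero[OF assms(1-3)] by simp

text \<open>The gap between the graphs is taken over the point \<open>y k \<omega> \<xi>\<close>,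
  whose norm is at most \<open>K * \<alpha>c k \<omega> * norm \<xi>\<close>; this is where
  \<open>K * b\<close> comes from.\<close>

lemma nonlin_close:
  assumes "center_family x" "lipschitz_graph h" "center_family y"
    and cl: "close_pairs a b x h y l" and b: "0 \<le> b" and \<omega>: "\<omega> \<in> space M" and \<xi>: "Pc \<omega> \<xi> = \<xi>"
  shows "norm (nonlin x h \<omega> \<xi> k - nonlin y l \<omega> \<xi> k)
    \<le> ((1 + N) * a + K * b) * norm \<xi> * (Lip (f (\<theta> k \<omega>)) * \<alpha>c k \<omega>)"
proof -
  let ?x = "x k \<omega> \<xi>" and ?y = "y k \<omega> \<xi>"
  have y: "Pc (\<theta> k \<omega>) ?y = ?y" using centerD(2)[OF assms(3) \<omega> \<xi>] .
  have "norm (nonlin x h \<omega> \<xi> k - nonlin y l \<omega> \<xi> k)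
      \<le> Lip (f (\<theta> k \<omega>)) * ((1 + N) * norm (?x - ?y) + norm (h (\<theta> k \<omega>) ?y - l (\<theta> k \<omega>) ?y))"
    unfolding nonlin_def using \<omega> \<xi> y centerD(2)[OF assms(1)] by (intro f_graph_diff assms(2)) auto
  also have "\<dots> \<le> Lip (f (\<theta> k \<omega>)) * ((1 + N) * (a * \<alpha>c k \<omega> * norm \<xi>) + b * (K * \<alpha>c k \<omega> * norm \<xi>))"
  proof (intro mult_left_mono add_mono)
    show "norm (?x - ?y) \<le> a * \<alpha>c k \<omega> * norm \<xi>"
      using cl \<omega> \<xi> unfolding close_pairs_def by blast
    have "norm (h (\<theta> k \<omega>) ?y - l (\<theta> k \<omega>) ?y) \<le> b * norm ?y"
      using cl y \<theta>_in[OF \<omega>] unfolding close_pairs_def by blast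
    also have "\<dots> \<le> b * (K * \<alpha>c k \<omega> * norm \<xi>)"
      using centerD(4)[OF assms(3) \<omega> \<xi>] b by (rule mult_left_mono)
    finally show "norm (h (\<theta> k \<omega>) ?y - l (\<theta> k \<omega>) ?y) \<le> b * (K * \<alpha>c k \<omega> * norm \<xi>)" .
  qed (use N \<omega> f_props in auto)
  finally show ?thesis by (simp add: algebra_simps)
qed

section \<open>Invariance of the admissible pairs and contraction\<close>

lemma operator_close:
  assumes x: "center_family x" "lipschitz_graph h" and y: "center_family y" "lipschitz_graph l"
    and cl: "close_pairs a b x h y l" and ab: "0 \<le> a" "0 \<le> b"
  shows "close_pairs (\<sigma> * ((1 + N) * a + K * b)) (\<tau> * ((1 + N) * a + K * b))
    (Cop x h) (SUop x h) (Cop y l) (SUop y l)"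
  unfolding close_pairs_def
proof (intro ballI allI impI conjI)
  fix \<omega> \<xi> assume \<omega>: "\<omega> \<in> space M" and \<xi>: "Pc \<omega> \<xi> = \<xi>"
  let ?d = "(1 + N) * a + K * b"
  have d: "0 \<le> ?d * norm \<xi>" using N K(2) ab by simp
  note g = nonlin_close[OF x y(1) cl ab(2) \<omega> \<xi>]
  have "norm (SUop x h \<omega> \<xi> - SUop y l \<omega> \<xi>)
      = norm (SUsum \<omega> (\<lambda>k. nonlin x h \<omega> \<xi> k - nonlin y l \<omega> \<xi> k))"
    unfolding SUop_def by (simp add: SUsum_diff[OF \<omega> nonlin_le[OF x \<omega> \<xi>] nonlin_le[OF y \<omega> \<xi>]])
  also have "\<dots> \<le> ?d * norm \<xi> * \<tau>"
    by (rule SUsum_bounds(3)[OF \<omega> g d])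
  finally show "norm (SUop x h \<omega> \<xi> - SUop y l \<omega> \<xi>) \<le> \<tau> * ?d * norm \<xi>"
    by (simp add: mult_ac)
  fix n
  have "norm (Cop x h n \<omega> \<xi> - Cop y l n \<omega> \<xi>)
      = norm (Csum n \<omega> (\<lambda>k. nonlin x h \<omega> \<xi> k - nonlin y l \<omega> \<xi> k))"
    unfolding Cop_def by (simp add: Csum_diff[OF \<omega>])
  also have "\<dots> \<le> ?d * norm \<xi> * \<sigma> * \<alpha>c n \<omega>"
    by (rule Csum_norm_le[OF \<omega> d g])
  finally show "norm (Cop x h n \<omega> \<xi> - Cop y l n \<omega> \<xi>) \<le> \<sigma> * ?d * \<alpha>c n \<omega> * norm \<xi>"
    by (simp add: mult_ac)
qed

lemma operator_maps:
  assumes x: "center_family x" "lipschitz_graph h"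
  shows "center_family (Cop x h)" "lipschitz_graph (SUop x h)"
proof -
  have nn: "0 \<le> (1 + N) * K * norm v" for v :: 'x using N K(2) by simp
  show "center_family (Cop x h)"
    unfolding center_family_def
  proof (intro ballI allI impI conjI)
    fix \<omega> n assume \<omega>: "\<omega> \<in> space M"
    show "Cop x h n \<omega> 0 = 0"
      using \<omega> by (simp add: Cop_def nonlin_zero[OF x])
    fix \<xi> assume \<xi>: "Pc \<omega> \<xi> = \<xi>"
    show "Pc (\<theta> n \<omega>) (Cop x h n \<omega> \<xi>) = Cop x h n \<omega> \<xi>"
      using \<omega> \<xi> by (simp add: Cop_def P_simps Pc_Csum projections(3))
    fix \<xi>' assume \<xi>': "Pc \<omega> \<xi>' = \<xi>'"
    have "norm (Cop x h n \<omega> \<xi> - Cop x h n \<omega> \<xi>')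
        = norm (\<Phi> n \<omega> (Pc \<omega> (\<xi> - \<xi>')) + Csum n \<omega> (\<lambda>k. nonlin x h \<omega> \<xi> k - nonlin x h \<omega> \<xi>' k))"
      using \<omega> \<xi> \<xi>' by (simp add: Cop_def Csum_diff \<Phi>_simps P_simps algebra_simps)
    also have "\<dots> \<le> \<alpha>c n \<omega> * norm (\<xi> - \<xi>') + (1 + N) * K * norm (\<xi> - \<xi>') * \<sigma> * \<alpha>c n \<omega>"
      by (intro norm_triangle_le add_mono \<Phi>P_norm_le[OF \<omega>]
          Csum_norm_le[OF \<omega> nn nonlin_lipschitz[OF x \<omega> \<xi> \<xi>']])
    also have "\<dots> = (1 + (1 + N) * \<sigma> * K) * (\<alpha>c n \<omega> * norm (\<xi> - \<xi>'))"
      by (simp add: algebra_simps)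
    finally show "norm (Cop x h n \<omega> \<xi> - Cop x h n \<omega> \<xi>') \<le> K * \<alpha>c n \<omega> * norm (\<xi> - \<xi>')"
      unfolding K(3)[symmetric] by simp
  qed
  show "lipschitz_graph (SUop x h)"
    unfolding lipschitz_graph_def
  proof (intro ballI allI impI conjI)
    fix \<omega> assume \<omega>: "\<omega> \<in> space M"
    show "SUop x h \<omega> 0 = 0"
      using \<omega> by (simp add: SUop_def nonlin_zero[OF x])
    fix \<xi> assume \<xi>: "Pc \<omega> \<xi> = \<xi>"
    show "Pc \<omega> (SUop x h \<omega> \<xi>) = 0"
      unfolding SUop_def by (rule Pc_SUsum[OF \<omega> nonlin_le[OF x \<omega> \<xi>]])
    fix \<xi>' assume \<xi>': "Pc \<omega> \<xi>' = \<xi>'"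
    have "norm (SUop x h \<omega> \<xi> - SUop x h \<omega> \<xi>')
        = norm (SUsum \<omega> (\<lambda>k. nonlin x h \<omega> \<xi> k - nonlin x h \<omega> \<xi>' k))"
      unfolding SUop_def by (simp add: SUsum_diff[OF \<omega> nonlin_le[OF x \<omega> \<xi>] nonlin_le[OF x \<omega> \<xi>']])
    also have "\<dots> \<le> (1 + N) * K * norm (\<xi> - \<xi>') * \<tau>"
      by (rule SUsum_bounds(3)[OF \<omega> nonlin_lipschitz[OF x \<omega> \<xi> \<xi>'] nn])
    also have "\<dots> = (\<tau> * K * (1 + N)) * norm (\<xi> - \<xi>')"
      by (simp add: mult_ac)
    also have "\<dots> \<le> N * norm (\<xi> - \<xi>')"
      by (intro mult_right_mono \<tau>_le) simp
    finally show "norm (SUop x h \<omega> \<xi> - SUop x h \<omega> \<xi>') \<le> N * norm (\<xi> - \<xi>')" .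
  qed
qed

text \<open>Any two admissible pairs are at a finite distance, which gives the contraction a
  starting value.\<close>

lemma close_trivial:
  assumes x: "center_family x" "lipschitz_graph h" and y: "center_family y" "lipschitz_graph l"
  shows "close_pairs (2 * K) (2 * N) x h y l"
  unfolding close_pairs_def
proof (intro ballI allI impI conjI)
  fix \<omega> \<xi> assume *: "\<omega> \<in> space M" "Pc \<omega> \<xi> = \<xi>"
  show "norm (h \<omega> \<xi> - l \<omega> \<xi>) \<le> 2 * N * norm \<xi>"
    using norm_triangle_ineq4[of "h \<omega> \<xi>" "l \<omega> \<xi>"] graphD(4)[OF x(2) *] graphD(4)[OF y(2) *] by simp
  fix n
  show "norm (x n \<omega> \<xi> - y n \<omega> \<xi>) \<le> 2 * K * \<alpha>c n \<omega> * norm \<xi>"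
    using norm_triangle_ineq4[of "x n \<omega> \<xi>" "y n \<omega> \<xi>"] centerD(4)[OF x(1) *, of n]
      centerD(4)[OF y(1) *, of n] by simp
qed

definition q :: real where "q = (1 + N) * \<sigma> + K * \<tau>"
text \<open>The factor \<open>(1 + N) * a + K * b\<close> of \<open>operator_close\<close> at the
  values \<open>a = 2 * K\<close>, \<open>b = 2 * N\<close> of \<open>close_trivial\<close>.\<close>

definition d\<^sub>0 :: real where "d\<^sub>0 = (1 + N) * (2 * K) + K * (2 * N)"

lemma q: "0 \<le> q" "q < 1"
  using contraction N K(2) \<sigma>_nonneg \<tau>_nonneg by (simp_all add: q_def)

lemma d\<^sub>0: "0 \<le> d\<^sub>0"
  using N K(2) by (simp add: d\<^sub>0_def)

lemma operator_close_first:
  assumes "center_family x" "lipschitz_graph h" "center_family y" "lipschitz_graph l"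
  shows "close_pairs (\<sigma> * d\<^sub>0) (\<tau> * d\<^sub>0) (Cop x h) (SUop x h) (Cop y l) (SUop y l)"
  using operator_close[OF assms close_trivial[OF assms]] N K(2) unfolding d\<^sub>0_def by simp

text \<open>Images under the operator always have distances proportional to \<open>\<sigma>\<close>
  and \<open>\<tau>\<close>. Within this form a single scalar \<open>d\<close> governs both
  components, and one step multiplies it by \<open>q\<close>.\<close>

lemma operator_contracts:
  assumes "center_family x" "lipschitz_graph h" "center_family y" "lipschitz_graph l"
    and "close_pairs (\<sigma> * d) (\<tau> * d) x h y l" "0 \<le> d"
  shows "close_pairs (\<sigma> * (d * q)) (\<tau> * (d * q)) (Cop x h) (SUop x h) (Cop y l) (SUop y l)"
proof -
  have "(1 + N) * (\<sigma> * d) + K * (\<tau> * d) = d * q" by (simp add: q_def algebra_simps)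
  with operator_close[OF assms(1-5)] assms(6) \<sigma>_nonneg \<tau>_nonneg show ?thesis by simp
qed

lemma close_pairs_cong:
  assumes "fixed_pair x h" "fixed_pair y l"
    and "close_pairs a b (Cop x h) (SUop x h) (Cop y l) (SUop y l)"
  shows "close_pairs a b x h y l"
  unfolding close_pairs_def
proof (intro ballI impI allI)
  fix \<omega> \<xi> assume "\<omega> \<in> space M" "Pc \<omega> \<xi> = \<xi>"
  with assms have "h \<omega> \<xi> = SUop x h \<omega> \<xi>" "\<And>n. x n \<omega> \<xi> = Cop x h n \<omega> \<xi>"
    "l \<omega> \<xi> = SUop y l \<omega> \<xi>" "\<And>n. y n \<omega> \<xi> = Cop y l n \<omega> \<xi>"
    and cl: "norm (SUop x h \<omega> \<xi> - SUop y l \<omega> \<xi>) \<le> b * norm \<xi> \<and>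
      (\<forall>n. norm (Cop x h n \<omega> \<xi> - Cop y l n \<omega> \<xi>) \<le> a * \<alpha>c n \<omega> * norm \<xi>)"
    unfolding fixed_pair_def close_pairs_def by blast+
  note eqs = this(1-4)
  show "norm (h \<omega> \<xi> - l \<omega> \<xi>) \<le> b * norm \<xi> \<and>
      (\<forall>n. norm (x n \<omega> \<xi> - y n \<omega> \<xi>) \<le> a * \<alpha>c n \<omega> * norm \<xi>)"
    unfolding eqs by (rule cl)
qed

text \<open>A fixed pair agrees with its image on E^c, so the contraction applies any number of
  times to the same two pairs and drives their distance to 0.\<close>

lemma fixed_pair_unique:
  assumes x: "center_family x" "lipschitz_graph h" "fixed_pair x h"
    and y: "center_family y" "lipschitz_graph l" "fixed_pair y l"
    and \<omega>: "\<omega> \<in> space M" and \<xi>: "Pc \<omega> \<xi> = \<xi>"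
  shows "h \<omega> \<xi> = l \<omega> \<xi>"
proof -
  have cl: "close_pairs (\<sigma> * (d\<^sub>0 * q ^ i)) (\<tau> * (d\<^sub>0 * q ^ i)) x h y l" for i
  proof (induction i)
    case 0
    then show ?case
      using close_pairs_cong[OF x(3) y(3) operator_close_first[OF x(1,2) y(1,2)]] by simp
  next
    case (Suc i)
    have "0 \<le> d\<^sub>0 * q ^ i" using d\<^sub>0 q by simp
    from close_pairs_cong[OF x(3) y(3) operator_contracts[OF x(1,2) y(1,2) Suc this]]
    show ?case by (simp add: mult_ac)
  qed
  have "norm (h \<omega> \<xi> - l \<omega> \<xi>) \<le> \<tau> * d\<^sub>0 * norm \<xi> * q ^ i" for i
    using cl[of i] \<omega> \<xi> unfolding close_pairs_def by (simp add: mult_ac)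
  then have "(\<lambda>i. h \<omega> \<xi>) \<longlonglongrightarrow> l \<omega> \<xi>"
    by (rule geometric_tendsto[OF q])
  then show ?thesis using LIMSEQ_const_iff by blast
qed

section \<open>Invariant graphs and fixed points\<close>

lemma fixed_pairD:
  assumes "fixed_pair x h" "\<omega> \<in> space M" "Pc \<omega> \<xi> = \<xi>"
  shows "h \<omega> \<xi> = SUsum \<omega> (nonlin x h \<omega> \<xi>)" "x n \<omega> \<xi> = \<Phi> n \<omega> \<xi> + Csum n \<omega> (nonlin x h \<omega> \<xi>)"
  using assms unfolding fixed_pair_def SUop_def Cop_def by blast+

lemma fixed_pair_0:
  assumes "fixed_pair x h" "\<omega> \<in> space M" "Pc \<omega> \<xi> = \<xi>"
  shows "x 0 \<omega> \<xi> = \<xi>"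
  using fixed_pairD(2)[OF assms, of 0] assms(2) by (simp add: Csum_def Dsum_def)

lemma fixed_pair_step:
  assumes "fixed_pair x h" "\<omega> \<in> space M" "Pc \<omega> \<xi> = \<xi>"
  shows "x (n + 1) \<omega> \<xi> =
    \<Phi> 1 (\<theta> n \<omega>) (x n \<omega> \<xi>) + Pc (\<theta> (n + 1) \<omega>) (nonlin x h \<omega> \<xi> n)"
proof -
  have "\<forall>n. x n \<omega> \<xi> = \<Phi> n \<omega> (x 0 \<omega> \<xi>) + Dsum n \<omega> (\<lambda>k. Pc (\<theta> (k + 1) \<omega>) (nonlin x h \<omega> \<xi> k))"
    using fixed_pairD(2)[OF assms] unfolding fixed_pair_0[OF assms] Csum_def by (rule allI)
  then show ?thesis
    unfolding variation_of_constants[OF assms(2), of "\<lambda>n. x n \<omega> \<xi>", symmetric] by (rule spec)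
qed

text \<open>Both sides solve the same equation over \<open>\<theta> 1 \<omega>\<close>, and \<open>window_bound\<close> shows that its solution is unique.\<close>

lemma center_flow:
  assumes x: "center_family x" and h: "lipschitz_graph h" and fp: "fixed_pair x h"
    and \<omega>: "\<omega> \<in> space M" and \<xi>: "Pc \<omega> \<xi> = \<xi>"
  shows "x m (\<theta> 1 \<omega>) (x 1 \<omega> \<xi>) = x (m + 1) \<omega> \<xi>"
proof -
  let ?\<omega> = "\<theta> 1 \<omega>" and ?\<xi> = "x 1 \<omega> \<xi>"
  let ?g = "\<lambda>k. nonlin x h \<omega> \<xi> (k + 1)" and ?g' = "nonlin x h ?\<omega> ?\<xi>"
  have \<omega>': "?\<omega> \<in> space M" using \<omega> by simp
  have \<xi>': "Pc ?\<omega> ?\<xi> = ?\<xi>" using centerD(2)[OF x \<omega> \<xi>] .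
  \<comment> \<open>The orbit advanced by one step solves the centre recursion over
    \<open>\<theta> 1 \<omega>\<close> with initial value \<open>x 1 \<omega> \<xi>\<close>.\<close>
  have "\<forall>n. x (n + 1 + 1) \<omega> \<xi> =
      \<Phi> 1 (\<theta> n ?\<omega>) (x (n + 1) \<omega> \<xi>) + Pc (\<theta> (n + 1) ?\<omega>) (?g n)"
    using fixed_pair_step[OF fp \<omega> \<xi>, of "_ + 1"] \<omega> by (simp add: add.assoc)
  then have "\<forall>n. x (n + 1) \<omega> \<xi> = \<Phi> n ?\<omega> (x (0 + 1) \<omega> \<xi>) +
      Dsum n ?\<omega> (\<lambda>k. Pc (\<theta> (k + 1) ?\<omega>) (?g k))"
    by (subst (asm) variation_of_constants[OF \<omega>', of "\<lambda>n. x (n + 1) \<omega> \<xi>"])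
  then have z: "x (n + 1) \<omega> \<xi> = \<Phi> n ?\<omega> ?\<xi> + Csum n ?\<omega> ?g" for n
    unfolding Csum_def by simp
  define u where "u n = x (n + 1) \<omega> \<xi> - x n ?\<omega> ?\<xi>" for n
  have "norm (u m) \<le> K * \<alpha>c m ?\<omega> * norm (0 :: 'x)"
  proof (rule window_bound[OF \<omega>'])
    show "u n = \<Phi> n ?\<omega> 0 + Csum n ?\<omega> (\<lambda>k. ?g k - ?g' k)" for n
      using \<omega>' by (simp add: u_def z fixed_pairD(2)[OF fp \<omega>' \<xi>'] Csum_diff)
    show "norm (?g k - ?g' k) \<le> Lip (f (\<theta> k ?\<omega>)) * ((1 + N) * norm (u k))" for k
      using f_graph_diff[OF h, of "\<theta> (k + 1) \<omega>" "x (k + 1) \<omega> \<xi>" "x k ?\<omega> ?\<xi>" h]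
        centerD(2)[OF x \<omega> \<xi>, of "k + 1"] centerD(2)[OF x \<omega>' \<xi>', of k] \<omega>
      by (simp add: nonlin_def u_def)
  qed (simp add: \<omega>')
  then show ?thesis by (simp add: u_def)
qed

text \<open>By \<open>center_flow\<close> the nonlinear terms over
  \<open>\<theta> 1 \<omega>\<close> are those over \<open>\<omega>\<close> shifted by one, so
  \<open>SUsum_shift\<close> yields the noncentral part of the step. Together with the centre
  recursion the three projections of the f-term add up to the whole.\<close>

lemma fixed_pair_graph_step:
  assumes x: "center_family x" and h: "lipschitz_graph h" and fp: "fixed_pair x h"
    and \<omega>: "\<omega> \<in> space M" and \<xi>: "Pc \<omega> \<xi> = \<xi>"
  shows "x 1 \<omega> \<xi> + h (\<theta> 1 \<omega>) (x 1 \<omega> \<xi>) = \<Psi> 1 \<omega> (\<xi> + h \<omega> \<xi>)"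
proof -
  have \<omega>': "\<theta> 1 \<omega> \<in> space M" using \<omega> by simp
  have "nonlin x h (\<theta> 1 \<omega>) (x 1 \<omega> \<xi>) = (\<lambda>k. nonlin x h \<omega> \<xi> (k + 1))"
    using \<omega> by (simp add: fun_eq_iff nonlin_def center_flow[OF x h fp \<omega> \<xi>])
  moreover have n0: "nonlin x h \<omega> \<xi> 0 = f \<omega> (\<xi> + h \<omega> \<xi>)"
    using \<omega> by (simp add: nonlin_def fixed_pair_0[OF fp \<omega> \<xi>])
  ultimately have "h (\<theta> 1 \<omega>) (x 1 \<omega> \<xi>) = \<Phi> 1 \<omega> (h \<omega> \<xi>) +
      Ps (\<theta> 1 \<omega>) (f \<omega> (\<xi> + h \<omega> \<xi>)) + Pu (\<theta> 1 \<omega>) (f \<omega> (\<xi> + h \<omega> \<xi>))"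
    using fixed_pairD(1)[OF fp \<omega>' centerD(2)[OF x \<omega> \<xi>]]
      SUsum_shift[OF \<omega> nonlin_le[OF x h \<omega> \<xi>]] fixed_pairD(1)[OF fp \<omega> \<xi>] by simp
  moreover have "x 1 \<omega> \<xi> = \<Phi> 1 \<omega> \<xi> + Pc (\<theta> 1 \<omega>) (f \<omega> (\<xi> + h \<omega> \<xi>))"
    using fixed_pair_step[OF fp \<omega> \<xi>, of 0] n0 \<omega> by (simp add: fixed_pair_0[OF fp \<omega> \<xi>])
  ultimately show ?thesis
    using \<omega> P_sum[OF \<omega>', of "f \<omega> (\<xi> + h \<omega> \<xi>)"]
    by (simp add: \<Psi>_one \<Phi>_simps algebra_simps)
qed

lemma fixed_pair_orbit:
  assumes x: "center_family x" and h: "lipschitz_graph h" and fp: "fixed_pair x h"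
    and \<omega>: "\<omega> \<in> space M" and \<xi>: "Pc \<omega> \<xi> = \<xi>"
  shows "\<Psi> n \<omega> (\<xi> + h \<omega> \<xi>) = x n \<omega> \<xi> + h (\<theta> n \<omega>) (x n \<omega> \<xi>)"
proof -
  define z where "z n = x n \<omega> \<xi> + h (\<theta> n \<omega>) (x n \<omega> \<xi>)" for n
  have z: "z (n + 1) = \<Psi> 1 (\<theta> n \<omega>) (z n)" for n
  proof -
    have \<omega>': "\<theta> n \<omega> \<in> space M" using \<omega> by simp
    note \<xi>' = centerD(2)[OF x \<omega> \<xi>, of n]
    have "x 1 (\<theta> n \<omega>) (x n \<omega> \<xi>) = x (n + 1) \<omega> \<xi>"
      using fixed_pair_step[OF fp \<omega>' \<xi>', of 0] fixed_pair_step[OF fp \<omega> \<xi>, of n] \<omega>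
      by (simp add: fixed_pair_0[OF fp \<omega>' \<xi>'] nonlin_def add.commute)
    then show ?thesis
      using fixed_pair_graph_step[OF x h fp \<omega>' \<xi>'] \<omega> by (simp add: z_def add.commute)
  qed
  have "\<Psi> n \<omega> (z 0) = z n"
  proof (induction n rule: int_induct[where k = 0])
    case (step1 i)
    then show ?case using z[of i] \<Psi>_\<Psi>[OF \<omega>, of 1 i "z 0"] by (simp add: add.commute)
  next
    case (step2 i)
    have "\<Psi> (i - 1) \<omega> (z 0) = \<Psi> (-1) (\<theta> i \<omega>) (\<Psi> i \<omega> (z 0))"
      using \<Psi>_\<Psi>[OF \<omega>, of "-1" i "z 0"] by simp
    also have "\<dots> = \<Psi> (-1) (\<theta> 1 (\<theta> (i - 1) \<omega>)) (\<Psi> 1 (\<theta> (i - 1) \<omega>) (z (i - 1)))"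
      using step2 z[of "i - 1"] \<omega> by simp
    also have "\<dots> = z (i - 1)"
      using \<omega> by (subst \<Psi>_\<Psi>) simp_all
    finally show ?case .
  qed (simp add: \<omega>)
  then show ?thesis
    using \<omega> by (simp add: z_def fixed_pair_0[OF fp \<omega> \<xi>])
qed

section \<open>From invariant graphs to fixed pairs\<close>

definition center_part :: "('w \<Rightarrow> 'x \<Rightarrow> 'x) \<Rightarrow> int \<Rightarrow> 'w \<Rightarrow> 'x \<Rightarrow> 'x" where
  "center_part h n \<omega> \<xi> = Pc (\<theta> n \<omega>) (\<Psi> n \<omega> (\<xi> + h \<omega> \<xi>))"

definition invariant :: "('w \<Rightarrow> 'x \<Rightarrow> 'x) \<Rightarrow> bool" where
  "invariant h \<longleftrightarrow> (\<forall>n. \<forall>\<omega>\<in>space M. \<forall>\<xi>. Pc \<omega> \<xi> = \<xi> \<longrightarrow>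
    (\<exists>\<zeta>. Pc (\<theta> n \<omega>) \<zeta> = \<zeta> \<and> \<Psi> n \<omega> (\<xi> + h \<omega> \<xi>) = \<zeta> + h (\<theta> n \<omega>) \<zeta>))"

lemma orbit_decomposition:
  assumes h: "lipschitz_graph h" "invariant h" and \<omega>: "\<omega> \<in> space M" and \<xi>: "Pc \<omega> \<xi> = \<xi>"
  shows "Pc (\<theta> n \<omega>) (center_part h n \<omega> \<xi>) = center_part h n \<omega> \<xi>"
    "\<Psi> n \<omega> (\<xi> + h \<omega> \<xi>) = center_part h n \<omega> \<xi> + h (\<theta> n \<omega>) (center_part h n \<omega> \<xi>)"
proof -
  obtain \<zeta> where \<zeta>: "Pc (\<theta> n \<omega>) \<zeta> = \<zeta>" "\<Psi> n \<omega> (\<xi> + h \<omega> \<xi>) = \<zeta> + h (\<theta> n \<omega>) \<zeta>"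
    using h(2) \<omega> \<xi> unfolding invariant_def by blast
  have "center_part h n \<omega> \<xi> = \<zeta>"
    using \<omega> \<zeta> graphD(2)[OF h(1) _ \<zeta>(1)] by (simp add: center_part_def P_simps)
  then show "Pc (\<theta> n \<omega>) (center_part h n \<omega> \<xi>) = center_part h n \<omega> \<xi>"
    "\<Psi> n \<omega> (\<xi> + h \<omega> \<xi>) = center_part h n \<omega> \<xi> + h (\<theta> n \<omega>) (center_part h n \<omega> \<xi>)"
    using \<zeta> by simp_all
qed

lemma orbit_step:
  assumes h: "lipschitz_graph h" "invariant h" and \<omega>: "\<omega> \<in> space M" and \<xi>: "Pc \<omega> \<xi> = \<xi>"
  shows "\<Psi> (n + 1) \<omega> (\<xi> + h \<omega> \<xi>) =
    \<Phi> 1 (\<theta> n \<omega>) (\<Psi> n \<omega> (\<xi> + h \<omega> \<xi>)) + nonlin (center_part h) h \<omega> \<xi> n"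
  using \<Psi>_\<Psi>[OF \<omega>, of 1 n "\<xi> + h \<omega> \<xi>"] orbit_decomposition(2)[OF assms, of n] \<omega>
  by (simp add: nonlin_def \<Psi>_one add.commute)

lemma center_part_equation:
  assumes h: "lipschitz_graph h" "invariant h" and \<omega>: "\<omega> \<in> space M" and \<xi>: "Pc \<omega> \<xi> = \<xi>"
  shows "center_part h n \<omega> \<xi> = Cop (center_part h) h n \<omega> \<xi>"
proof -
  let ?v = "\<xi> + h \<omega> \<xi>"
  have "\<forall>n. \<Psi> (n + 1) \<omega> ?v = \<Phi> 1 (\<theta> n \<omega>) (\<Psi> n \<omega> ?v) + nonlin (center_part h) h \<omega> \<xi> n"
    using orbit_step[OF assms] by (rule allI)
  then have "\<forall>n. \<Psi> n \<omega> ?v = \<Phi> n \<omega> (\<Psi> 0 \<omega> ?v) + Dsum n \<omega> (nonlin (center_part h) h \<omega> \<xi>)"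
    by (subst (asm) variation_of_constants[OF \<omega>, of "\<lambda>n. \<Psi> n \<omega> ?v"])
  then have "\<Psi> n \<omega> ?v = \<Phi> n \<omega> ?v + Dsum n \<omega> (nonlin (center_part h) h \<omega> \<xi>)"
    using \<omega> by simp
  then have "center_part h n \<omega> \<xi> = Pc (\<theta> n \<omega>) (\<Phi> n \<omega> ?v + Dsum n \<omega> (nonlin (center_part h) h \<omega> \<xi>))"
    by (simp add: center_part_def)
  also have "\<dots> = \<Phi> n \<omega> (Pc \<omega> ?v) + Csum n \<omega> (nonlin (center_part h) h \<omega> \<xi>)"
    using \<omega> by (simp add: P_simps Pc_Dsum projections(3) \<Phi>_simps)
  also have "Pc \<omega> ?v = \<xi>"
    using \<omega> \<xi> graphD(2)[OF h(1) \<omega> \<xi>] by (simp add: P_simps)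
  finally show ?thesis unfolding Cop_def .
qed

text \<open>Invariance alone forces the growth bound: differences of centre parts satisfy the
  self-referential hypothesis of \<open>window_bound\<close>, because both orbits stay on a graph
  with constant \<open>N\<close>.\<close>

lemma center_part_family:
  assumes h: "lipschitz_graph h" "invariant h"
  shows "center_family (center_part h)"
proof -
  have lip: "norm (center_part h n \<omega> \<xi> - center_part h n \<omega> \<xi>') \<le> K * \<alpha>c n \<omega> * norm (\<xi> - \<xi>')"
    if \<omega>: "\<omega> \<in> space M" and \<xi>: "Pc \<omega> \<xi> = \<xi>" and \<xi>': "Pc \<omega> \<xi>' = \<xi>'" for n \<omega> \<xi> \<xi>'
  proof -
    let ?g = "\<lambda>k. nonlin (center_part h) h \<omega> \<xi> k - nonlin (center_part h) h \<omega> \<xi>' k"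
    define u where "u n = center_part h n \<omega> \<xi> - center_part h n \<omega> \<xi>'" for n
    have "norm (u n) \<le> K * \<alpha>c n \<omega> * norm (\<xi> - \<xi>')"
    proof (rule window_bound[OF \<omega>])
      show "u n = \<Phi> n \<omega> (\<xi> - \<xi>') + Csum n \<omega> ?g" for n
        unfolding u_def center_part_equation[OF h \<omega> \<xi>, of n] center_part_equation[OF h \<omega> \<xi>', of n]
        using \<omega> by (simp add: Cop_def Csum_diff \<Phi>_simps)
      show "norm (?g k) \<le> Lip (f (\<theta> k \<omega>)) * ((1 + N) * norm (u k))" for k
        using f_graph_diff[OF h(1), of "\<theta> k \<omega>" "center_part h k \<omega> \<xi>" "center_part h k \<omega> \<xi>'" h]
          orbit_decomposition(1)[OF h \<omega> \<xi>, of k] orbit_decomposition(1)[OF h \<omega> \<xi>', of k] \<omega>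
        by (simp add: nonlin_def u_def)
    qed (simp add: P_simps \<omega> \<xi> \<xi>')
    then show ?thesis by (simp add: u_def)
  qed
  show ?thesis
    unfolding center_family_def
  proof (intro ballI allI impI conjI)
    fix \<omega> n assume \<omega>: "\<omega> \<in> space M"
    \<comment> \<open>That the centre orbit of 0 stays at 0 follows from the same bound with initial
      vector 0.\<close>
    define u where "u n = center_part h n \<omega> 0" for n
    have "norm (u n) \<le> K * \<alpha>c n \<omega> * norm (0 :: 'x)"
    proof (rule window_bound[OF \<omega>])
      show "u n = \<Phi> n \<omega> 0 + Csum n \<omega> (nonlin (center_part h) h \<omega> 0)" for n
        unfolding u_def using center_part_equation[OF h \<omega>, of 0 n] \<omega> by (simp add: Cop_def)
      show "norm (nonlin (center_part h) h \<omega> 0 k) \<le> Lip (f (\<theta> k \<omega>)) * ((1 + N) * norm (u k))" for k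
        using f_graph_diff[OF h(1), of "\<theta> k \<omega>" "center_part h k \<omega> 0" 0 h]
          orbit_decomposition(1)[OF h \<omega>, of 0 k] \<omega> graphD(1)[OF h(1)]
        by (simp add: nonlin_def u_def f_props(1))
    qed (simp add: \<omega>)
    then show "center_part h n \<omega> 0 = 0" by (simp add: u_def)
  qed (use lip orbit_decomposition(1)[OF h] in auto)
qed

text \<open>Here the limit conditions enter. The noncentral parts at time 0 are transported from
  times -m and m; the transported remainders are bounded by products of \<alpha>-bounds that tend to
  0, and what is left are the two series.\<close>

lemma invariant_fixed_pair:
  assumes h: "lipschitz_graph h" "invariant h"
  shows "fixed_pair (center_part h) h"
  unfolding fixed_pair_def
proof (intro ballI allI impI conjI)
  fix \<omega> \<xi> assume \<omega>: "\<omega> \<in> space M" and \<xi>: "Pc \<omega> \<xi> = \<xi>"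
  show "center_part h n \<omega> \<xi> = Cop (center_part h) h n \<omega> \<xi>" for n
    by (rule center_part_equation[OF h \<omega> \<xi>])
  define z where "z n = \<Psi> n \<omega> (\<xi> + h \<omega> \<xi>)" for n
  define g where "g = nonlin (center_part h) h \<omega> \<xi>"
  let ?y = "\<lambda>n. center_part h n \<omega> \<xi>"
  have z0: "z 0 = \<xi> + h \<omega> \<xi>" using \<omega> by (simp add: z_def)
  have step: "z (n + 1) = \<Phi> 1 (\<theta> n \<omega>) (z n) + g n" for n
    unfolding z_def g_def by (rule orbit_step[OF h \<omega> \<xi>])
  have z: "z n = ?y n + h (\<theta> n \<omega>) (?y n)" and y: "Pc (\<theta> n \<omega>) (?y n) = ?y n" for n
    unfolding z_def using orbit_decomposition[OF h \<omega> \<xi>] by auto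
  have P_y: "Ps (\<theta> n \<omega>) (?y n) = 0" "Pu (\<theta> n \<omega>) (?y n) = 0" for n
    using P_orthogonal(3,5)[of "\<theta> n \<omega>" "?y n"] \<omega> y[of n] by simp_all
  have y0: "?y 0 = \<xi>"
    using \<omega> \<xi> graphD(2)[OF h(1) \<omega> \<xi>] by (simp add: center_part_def P_simps)
  \<comment> \<open>\<open>Ps\<close> and \<open>Pu\<close> annihilate \<open>?y n\<close>, so this
    bounds all of \<open>z n\<close> that survives in the remainders.\<close>
  have hy: "norm (h (\<theta> n \<omega>) (?y n)) \<le> N * (K * \<alpha>c n \<omega> * norm \<xi>)" for n
    using graphD(4)[OF h(1) \<theta>_in[OF \<omega>] y[of n]] N(1)
      mult_left_mono[OF centerD(4)[OF center_part_family[OF h] \<omega> \<xi>, of n], of N] by linarith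
  define C where "C = N * K * norm \<xi>"
  \<comment> \<open>The stable part at time 0 is the one at time -m carried forward, plus the
    forcing picked up on the way.\<close>
  have s: "Ps \<omega> (h \<omega> \<xi>) = \<Phi> (int m) (\<theta> (- int m) \<omega>) (Ps (\<theta> (- int m) \<omega>) (z (- int m))) +
      (\<Sum>j<m. Sterm \<omega> g j)" for m
  proof (induction m)
    case 0
    then show ?case using \<omega> P_y(1)[of 0] by (simp add: z0 y0 P_simps)
  next
    case (Suc m)
    have "z (- int m) = \<Phi> 1 (\<theta> (-1 - int m) \<omega>) (z (-1 - int m)) + g (-1 - int m)"
      using step[of "-1 - int m"] by simp
    then have "\<Phi> (int m) (\<theta> (- int m) \<omega>) (Ps (\<theta> (- int m) \<omega>) (z (- int m))) =
        \<Phi> (1 + int m) (\<theta> (-1 - int m) \<omega>) (Ps (\<theta> (-1 - int m) \<omega>) (z (-1 - int m))) + Sterm \<omega> g m"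
      using \<omega> by (simp add: Sterm_def P_simps P_\<Phi> \<Phi>_simps \<Phi>_\<Phi> add.commute)
    then show ?case using Suc by (simp add: add.assoc)
  qed
  have s': "(\<Sum>j<m. Sterm \<omega> g j) =
      Ps \<omega> (h \<omega> \<xi>) - \<Phi> (int m) (\<theta> (- int m) \<omega>) (Ps (\<theta> (- int m) \<omega>) (z (- int m)))" for m
    using s[of m] by (simp add: algebra_simps)
  \<comment> \<open>The unstable part is carried back from time m, so the forcing of the
    intermediate steps is subtracted.\<close>
  have u: "Pu \<omega> (h \<omega> \<xi>) = \<Phi> (- int m) (\<theta> (int m) \<omega>) (Pu (\<theta> (int m) \<omega>) (z (int m))) -
      (\<Sum>j<m. Uterm \<omega> g j)" for m
  proof (induction m)
    case 0
    then show ?case using \<omega> P_y(2)[of 0] by (simp add: z0 y0 P_simps)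
  next
    case (Suc m)
    have "\<Phi> (- int m - 1) (\<theta> (int m + 1) \<omega>) (Pu (\<theta> (int m + 1) \<omega>) (z (int m + 1))) =
        \<Phi> (- int m) (\<theta> (int m) \<omega>) (Pu (\<theta> (int m) \<omega>) (z (int m))) + Uterm \<omega> g m"
      using \<omega> by (simp add: step Uterm_def P_simps P_\<Phi> \<Phi>_simps \<Phi>_\<Phi>)
    then show ?case using Suc by (simp add: algebra_simps minus_diff_commute[of 1])
  qed
  have u': "(\<Sum>j<m. Uterm \<omega> g j) =
      \<Phi> (- int m) (\<theta> (int m) \<omega>) (Pu (\<theta> (int m) \<omega>) (z (int m))) - Pu \<omega> (h \<omega> \<xi>)" for m
    using u[of m] by (simp add: algebra_simps)
  have "norm (\<Phi> (int m) (\<theta> (- int m) \<omega>) (Ps (\<theta> (- int m) \<omega>) (z (- int m)))) \<le>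
      C * (\<alpha>s (int m) (\<theta> (- int m) \<omega>) * \<alpha>c (- int m) \<omega>)" for m
  proof -
    have "norm (\<Phi> (int m) (\<theta> (- int m) \<omega>) (Ps (\<theta> (- int m) \<omega>) (z (- int m)))) \<le>
        \<alpha>s (int m) (\<theta> (- int m) \<omega>) * norm (h (\<theta> (- int m) \<omega>) (?y (- int m)))"
      using \<omega> by (simp add: z P_simps P_y \<Phi>P_norm_le)
    also have "\<dots> \<le> \<alpha>s (int m) (\<theta> (- int m) \<omega>) * (N * (K * \<alpha>c (- int m) \<omega> * norm \<xi>))"
      using \<omega> by (intro mult_left_mono hy less_imp_le[OF \<alpha>_pos(2)]) simp_all
    finally show ?thesis by (simp add: C_def mult_ac)
  qed
  then have "(\<lambda>m. \<Phi> (int m) (\<theta> (- int m) \<omega>) (Ps (\<theta> (- int m) \<omega>) (z (- int m)))) \<longlonglongrightarrow> 0"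
    by (intro Lim_null_comparison[OF always_eventually tendsto_mult_right_zero[OF lim_s[OF \<omega>]]]) blast
  from tendsto_diff[OF tendsto_const[of "Ps \<omega> (h \<omega> \<xi>)"] this]
  have S: "Sterm \<omega> g sums Ps \<omega> (h \<omega> \<xi>)"
    unfolding sums_def s' by simp
  have "norm (\<Phi> (- int m) (\<theta> (int m) \<omega>) (Pu (\<theta> (int m) \<omega>) (z (int m)))) \<le>
      C * (\<alpha>u (- int m) (\<theta> (int m) \<omega>) * \<alpha>c (int m) \<omega>)" for m
  proof -
    have "norm (\<Phi> (- int m) (\<theta> (int m) \<omega>) (Pu (\<theta> (int m) \<omega>) (z (int m)))) \<le>
        \<alpha>u (- int m) (\<theta> (int m) \<omega>) * norm (h (\<theta> (int m) \<omega>) (?y (int m)))"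
      using \<omega> by (simp add: z P_simps P_y \<Phi>P_norm_le)
    also have "\<dots> \<le> \<alpha>u (- int m) (\<theta> (int m) \<omega>) * (N * (K * \<alpha>c (int m) \<omega> * norm \<xi>))"
      using \<omega> by (intro mult_left_mono hy less_imp_le[OF \<alpha>_pos(3)]) simp_all
    finally show ?thesis by (simp add: C_def mult_ac)
  qed
  then have "(\<lambda>m. \<Phi> (- int m) (\<theta> (int m) \<omega>) (Pu (\<theta> (int m) \<omega>) (z (int m)))) \<longlonglongrightarrow> 0"
    by (intro Lim_null_comparison[OF always_eventually tendsto_mult_right_zero[OF lim_u[OF \<omega>]]]) blast
  from tendsto_diff[OF this tendsto_const[of "Pu \<omega> (h \<omega> \<xi>)"]]
  have U: "Uterm \<omega> g sums (- Pu \<omega> (h \<omega> \<xi>))"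
    unfolding sums_def u' by simp
  have "SUop (center_part h) h \<omega> \<xi> = Ps \<omega> (h \<omega> \<xi>) + Pu \<omega> (h \<omega> \<xi>)"
    unfolding SUop_def SUsum_def g_def[symmetric] using S U by (simp add: sums_iff)
  also have "\<dots> = h \<omega> \<xi>"
    using P_sum[OF \<omega>, of "h \<omega> \<xi>"] graphD(2)[OF h(1) \<omega> \<xi>] by simp
  finally show "h \<omega> \<xi> = SUop (center_part h) h \<omega> \<xi>" ..
qed

lemma invariant_unique:
  assumes "lipschitz_graph h" "invariant h" "lipschitz_graph l" "invariant l"
    and "\<omega> \<in> space M" "Pc \<omega> \<xi> = \<xi>"
  shows "h \<omega> \<xi> = l \<omega> \<xi>"
  using assms by (intro fixed_pair_unique[of "center_part h" h "center_part l" l])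
    (auto intro: center_part_family invariant_fixed_pair)

text \<open>The centre part contributes \<open>K\<close> and lifting to the graph the factor
  \<open>1 + N\<close>. For \<open>\<tau> \<noteq> 0\<close> the choice of \<open>N\<close> makes
  the product equal to \<open>N / \<tau>\<close>.\<close>

lemma invariant_orbit_lipschitz:
  assumes h: "lipschitz_graph h" "invariant h"
    and \<omega>: "\<omega> \<in> space M" and \<xi>: "Pc \<omega> \<xi> = \<xi>" and \<xi>': "Pc \<omega> \<xi>' = \<xi>'"
  shows "norm (\<Psi> n \<omega> (\<xi> + h \<omega> \<xi>) - \<Psi> n \<omega> (\<xi>' + h \<omega> \<xi>')) \<le> K * (1 + N) * \<alpha>c n \<omega> * norm (\<xi> - \<xi>')"
proof -
  let ?y = "center_part h n \<omega> \<xi>" and ?y' = "center_part h n \<omega> \<xi>'"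
  have "norm (\<Psi> n \<omega> (\<xi> + h \<omega> \<xi>) - \<Psi> n \<omega> (\<xi>' + h \<omega> \<xi>'))
      = norm ((?y - ?y') + (h (\<theta> n \<omega>) ?y - h (\<theta> n \<omega>) ?y'))"
    unfolding orbit_decomposition(2)[OF h \<omega> \<xi>, of n] orbit_decomposition(2)[OF h \<omega> \<xi>', of n]
    by (simp add: algebra_simps)
  also have "\<dots> \<le> norm (?y - ?y') + N * norm (?y - ?y')"
    using \<omega> by (intro norm_triangle_le add_left_mono graphD(3)[OF h(1)] orbit_decomposition(1)[OF h] \<xi> \<xi>') simp
  also have "\<dots> = (1 + N) * norm (?y - ?y')" by (simp add: algebra_simps)
  also have "\<dots> \<le> (1 + N) * (K * \<alpha>c n \<omega> * norm (\<xi> - \<xi>'))"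
    using N by (intro mult_left_mono centerD(3)[OF center_part_family[OF h] \<omega> \<xi> \<xi>']) simp
  finally show ?thesis by (simp add: mult_ac)
qed

section \<open>Existence of the invariant graph\<close>

text \<open>The space E^c varies with \<omega>, so measurability is tested along the sections
  \<open>Pc \<omega> y\<close> with \<open>y\<close> fixed.\<close>

definition measurable_pair :: "(int \<Rightarrow> 'w \<Rightarrow> 'x \<Rightarrow> 'x) \<Rightarrow> ('w \<Rightarrow> 'x \<Rightarrow> 'x) \<Rightarrow> bool" where
  "measurable_pair x h \<longleftrightarrow> (\<forall>n y. strongly_measurable M (\<lambda>\<omega>. x n \<omega> (Pc \<omega> y))) \<and>
    (\<forall>y. strongly_measurable M (\<lambda>\<omega>. h \<omega> (Pc \<omega> y)))"

lemma \<theta>_measurable: "\<theta> n \<in> measurable M M"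
proof -
  have "(\<lambda>(n, \<omega>). \<theta> n \<omega>) \<in> measurable (count_space UNIV \<Otimes>\<^sub>M M) M"
    using ds unfolding measure_preserving_ds_def by blast
  from measurable_compose[OF measurable_Pair1' this, of n] show ?thesis by simp
qed

lemma strongly_measurable_\<theta>:
  "strongly_measurable M g \<Longrightarrow> strongly_measurable M (\<lambda>\<omega>. g (\<theta> k \<omega>) :: 'x)"
  by (rule strongly_measurable_compose[OF _ \<theta>_measurable])

lemma strongly_measurable_\<Phi>: "strongly_measurable M (\<lambda>\<omega>. \<Phi> n \<omega> y)"
proof -
  have "strongly_measurable (count_space UNIV \<Otimes>\<^sub>M M) (\<lambda>(n, \<omega>). \<Phi> n \<omega> y)"
    using \<Phi> unfolding measurable_linear_rds_def measurable_rds_def by blast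
  from strongly_measurable_compose[OF this measurable_Pair1', of n] show ?thesis by simp
qed

lemma strongly_measurable_P:
  "P \<in> {Pc, Ps, Pu} \<Longrightarrow> strongly_measurable M (\<lambda>\<omega>. P \<omega> y)"
  using tri unfolding trichotomy_def by blast

lemma strongly_measurable_\<Phi>P:
  assumes P: "P \<in> {Pc, Ps, Pu}" and g: "strongly_measurable M g"
  shows "strongly_measurable M (\<lambda>\<omega>. \<Phi> n (\<theta> k \<omega>) (P (\<theta> k \<omega>) (g \<omega>)))"
proof (rule strongly_measurable_caratheodory[of M "\<lambda>\<omega>. \<Phi> n (\<theta> k \<omega>)"])
  show "strongly_measurable M (\<lambda>\<omega>. \<Phi> n (\<theta> k \<omega>) y)" for y
    by (rule strongly_measurable_\<theta>[OF strongly_measurable_\<Phi>])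
  show "continuous_on UNIV (\<Phi> n (\<theta> k \<omega>))" if "\<omega> \<in> space M" for \<omega>
    using that by (intro linear_continuous_on \<Phi>_bounded_linear) simp
  show "strongly_measurable M (\<lambda>\<omega>. P (\<theta> k \<omega>) (g \<omega>))"
  proof (rule strongly_measurable_caratheodory[OF _ _ g])
    show "strongly_measurable M (\<lambda>\<omega>. P (\<theta> k \<omega>) y)" for y
      by (rule strongly_measurable_\<theta>[OF strongly_measurable_P[OF P]])
    show "continuous_on UNIV (P (\<theta> k \<omega>))" if "\<omega> \<in> space M" for \<omega>
      using that by (intro linear_continuous_on projections(1)[OF P]) simp
  qed
qed

lemma range_Pc: "\<omega> \<in> space M \<Longrightarrow> \<xi> \<in> range (Pc \<omega>) \<longleftrightarrow> Pc \<omega> \<xi> = \<xi>"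
  using projections(2)[of Pc \<omega>] by (metis insertI1 rangeE rangeI)

lemma nonlin_measurable:
  assumes x: "center_family x" "lipschitz_graph h" and m: "measurable_pair x h"
  shows "strongly_measurable M (\<lambda>\<omega>. nonlin x h \<omega> (Pc \<omega> y) k)"
proof -
  have xm: "strongly_measurable M (\<lambda>\<omega>. x k \<omega> (Pc \<omega> y))"
    using m unfolding measurable_pair_def by blast
  \<comment> \<open>\<open>h\<close> is controlled only on E^c, so it is precomposed with
    \<open>Pc\<close> to become continuous on all of X; the values are unchanged because
    \<open>x k \<omega> (Pc \<omega> y)\<close> already lies in the centre space.\<close>
  have hm: "strongly_measurable M (\<lambda>\<omega>. h (\<theta> k \<omega>) (Pc (\<theta> k \<omega>) (x k \<omega> (Pc \<omega> y))))"
  proof (rule strongly_measurable_caratheodory[OF _ _ xm])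
    show "strongly_measurable M (\<lambda>\<omega>. h (\<theta> k \<omega>) (Pc (\<theta> k \<omega>) v))" for v
      using m unfolding measurable_pair_def by (intro strongly_measurable_\<theta>) blast
    fix \<omega> assume "\<omega> \<in> space M"
    then have \<omega>: "\<theta> k \<omega> \<in> space M" by simp
    have "N-lipschitz_on (range (Pc (\<theta> k \<omega>))) (h (\<theta> k \<omega>))"
      using N(1) range_Pc[OF \<omega>] graphD(3)[OF x(2) \<omega>]
      by (intro lipschitz_onI) (simp_all add: dist_norm)
    from continuous_on_compose2[OF lipschitz_on_continuous_on[OF this]
        linear_continuous_on[OF projections(1)[of Pc, OF _ \<omega>]]]
    show "continuous_on UNIV (\<lambda>v. h (\<theta> k \<omega>) (Pc (\<theta> k \<omega>) v))" by simp
  qed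
  have sum: "strongly_measurable M (\<lambda>\<omega>. x k \<omega> (Pc \<omega> y) + h (\<theta> k \<omega>) (x k \<omega> (Pc \<omega> y)))"
    by (rule strongly_measurable_cong[OF _ strongly_measurable_add[OF xm hm]])
       (simp add: centerD(2)[OF x(1)] projections(2))
  show ?thesis
    unfolding nonlin_def
  proof (rule strongly_measurable_caratheodory[OF _ _ sum])
    show "strongly_measurable M (\<lambda>\<omega>. f (\<theta> k \<omega>) v)" for v
      using f unfolding perturbations_def by (intro strongly_measurable_\<theta>) blast
    fix \<omega> assume "\<omega> \<in> space M"
    then obtain C where "C-lipschitz_on UNIV (f (\<theta> k \<omega>))"
      using f \<theta>_in unfolding perturbations_def by blast
    then show "continuous_on UNIV (f (\<theta> k \<omega>))" by (rule lipschitz_on_continuous_on)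
  qed
qed

lemma operator_measurable:
  assumes x: "center_family x" "lipschitz_graph h" and m: "measurable_pair x h"
  shows "measurable_pair (Cop x h) (SUop x h)"
  unfolding measurable_pair_def
proof (intro conjI allI)
  note nm = nonlin_measurable[OF x m]
  fix y n
  have \<Phi>P: "strongly_measurable M (\<lambda>\<omega>. \<Phi> n \<omega> (Pc \<omega> y))"
    by (rule strongly_measurable_cong[OF _ strongly_measurable_\<Phi>P[of Pc "\<lambda>_. y" n 0]]) simp_all
  have sum: "strongly_measurable M (\<lambda>\<omega>. \<Sum>k\<in>A. \<Phi> (n - k - 1) (\<theta> (k + 1) \<omega>)
      (Pc (\<theta> (k + 1) \<omega>) (nonlin x h \<omega> (Pc \<omega> y) k)))" for A :: "int set"
    by (intro strongly_measurable_sum strongly_measurable_\<Phi>P nm) simp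
  show "strongly_measurable M (\<lambda>\<omega>. Cop x h n \<omega> (Pc \<omega> y))"
    using strongly_measurable_add[OF \<Phi>P sum] strongly_measurable_diff[OF \<Phi>P sum]
    by (cases "0 \<le> n") (simp_all add: Cop_def Csum_def Dsum_def)
next
  note nm = nonlin_measurable[OF x m]
  fix y
  have s: "summable (Sterm \<omega> (nonlin x h \<omega> (Pc \<omega> y)))" "summable (Uterm \<omega> (nonlin x h \<omega> (Pc \<omega> y)))"
    if "\<omega> \<in> space M" for \<omega>
    using SUsum_bounds(1,2)[OF that nonlin_le[OF x that, of "Pc \<omega> y"]] projections(2) that by simp_all
  have "strongly_measurable M (\<lambda>\<omega>. Sterm \<omega> (nonlin x h \<omega> (Pc \<omega> y)) j)"
    "strongly_measurable M (\<lambda>\<omega>. Uterm \<omega> (nonlin x h \<omega> (Pc \<omega> y)) j)" for j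
    unfolding Sterm_def Uterm_def by (intro strongly_measurable_\<Phi>P nm; simp)+
  then show "strongly_measurable M (\<lambda>\<omega>. SUop x h \<omega> (Pc \<omega> y))"
    unfolding SUop_def SUsum_def
    by (intro strongly_measurable_diff strongly_measurable_suminf s)
qed

section \<open>Picard iteration and its limit\<close>

primrec picard :: "nat \<Rightarrow> (int \<Rightarrow> 'w \<Rightarrow> 'x \<Rightarrow> 'x) \<times> ('w \<Rightarrow> 'x \<Rightarrow> 'x)" where
  "picard 0 = (\<Phi>, \<lambda>_ _. 0)"
| "picard (Suc i) = (Cop (fst (picard i)) (snd (picard i)), SUop (fst (picard i)) (snd (picard i)))"

abbreviation "px i \<equiv> fst (picard i)"
abbreviation "ph i \<equiv> snd (picard i)"

text \<open>The iteration starts at the solution for \<open>f = 0\<close>, the linear flow with the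
  zero graph, which is admissible because \<open>1 \<le> K\<close>.\<close>

lemma picard_maps: "center_family (px i)" "lipschitz_graph (ph i)" "measurable_pair (px i) (ph i)"
proof (induction i)
  case 0
  have "norm (\<Phi> n \<omega> \<xi> - \<Phi> n \<omega> \<xi>') \<le> K * \<alpha>c n \<omega> * norm (\<xi> - \<xi>')"
    if "\<omega> \<in> space M" "Pc \<omega> \<xi> = \<xi>" "Pc \<omega> \<xi>' = \<xi>'" for n \<omega> \<xi> \<xi>'
  proof -
    have "norm (\<Phi> n \<omega> \<xi> - \<Phi> n \<omega> \<xi>') \<le> \<alpha>c n \<omega> * norm (\<xi> - \<xi>')"
      using \<Phi>P_norm_le(1)[OF that(1), of n "\<xi> - \<xi>'"] that by (simp add: P_simps \<Phi>_simps)
    also have "\<dots> \<le> K * (\<alpha>c n \<omega> * norm (\<xi> - \<xi>'))"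
      using mult_right_mono[OF K(1), of "\<alpha>c n \<omega> * norm (\<xi> - \<xi>')"] \<alpha>_pos(1)[OF that(1), of n] by simp
    finally show ?thesis by (simp add: mult.assoc)
  qed
  then show "center_family (px 0)" by (simp add: center_family_def projections(3))
  show "lipschitz_graph (ph 0)" using N by (simp add: lipschitz_graph_def)
  have "strongly_measurable M (\<lambda>\<omega>. \<Phi> n \<omega> (Pc \<omega> y))" for n y
    by (rule strongly_measurable_cong[OF _ strongly_measurable_\<Phi>P[of Pc "\<lambda>_. y" n 0]]) simp_all
  then show "measurable_pair (px 0) (ph 0)" by (simp add: measurable_pair_def)
next
  case (Suc i)
  then show "center_family (px (Suc i))" "lipschitz_graph (ph (Suc i))"
    "measurable_pair (px (Suc i)) (ph (Suc i))"
    using operator_maps operator_measurable by simp_all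
qed

text \<open>The comparison starts at index 1: \<open>operator_contracts\<close> needs distances
  proportional to \<open>\<sigma>\<close> and \<open>\<tau>\<close>, and
  \<open>operator_close_first\<close> provides them only for images of the operator.\<close>

lemma picard_close:
  "close_pairs (\<sigma> * (d\<^sub>0 * q ^ i)) (\<tau> * (d\<^sub>0 * q ^ i))
    (px (Suc (Suc i))) (ph (Suc (Suc i))) (px (Suc i)) (ph (Suc i))"
proof (induction i)
  case 0
  then show ?case
    using operator_close_first[OF picard_maps(1,2)[of 1] picard_maps(1,2)[of 0]] by simp
next
  case (Suc i)
  have "0 \<le> d\<^sub>0 * q ^ i" using d\<^sub>0 q by simp
  from operator_contracts[OF picard_maps(1,2) picard_maps(1,2) Suc this]
  show ?case by (simp add: mult_ac)
qed

definition lim_x :: "int \<Rightarrow> 'w \<Rightarrow> 'x \<Rightarrow> 'x" where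
  "lim_x n \<omega> \<xi> = lim (\<lambda>i. px (Suc i) n \<omega> \<xi>)"

definition lim_h :: "'w \<Rightarrow> 'x \<Rightarrow> 'x" where
  "lim_h \<omega> \<xi> = lim (\<lambda>i. ph (Suc i) \<omega> \<xi>)"

lemma picard_limit:
  assumes \<omega>: "\<omega> \<in> space M" and \<xi>: "Pc \<omega> \<xi> = \<xi>"
  shows "(\<lambda>i. px (Suc i) n \<omega> \<xi>) \<longlonglongrightarrow> lim_x n \<omega> \<xi>" "(\<lambda>i. ph (Suc i) \<omega> \<xi>) \<longlonglongrightarrow> lim_h \<omega> \<xi>"
    "norm (px (Suc i) n \<omega> \<xi> - lim_x n \<omega> \<xi>) \<le> \<sigma> * (d\<^sub>0 / (1 - q) * q ^ i) * \<alpha>c n \<omega> * norm \<xi>"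
    "norm (ph (Suc i) \<omega> \<xi> - lim_h \<omega> \<xi>) \<le> \<tau> * (d\<^sub>0 / (1 - q) * q ^ i) * norm \<xi>"
proof -
  have "norm (px (Suc (Suc i)) n \<omega> \<xi> - px (Suc i) n \<omega> \<xi>) \<le> \<sigma> * d\<^sub>0 * \<alpha>c n \<omega> * norm \<xi> * q ^ i" for i
    using picard_close[of i] \<omega> \<xi> unfolding close_pairs_def by (simp add: mult_ac)
  note x = geometric_limit[OF q, of "\<lambda>i. px (Suc i) n \<omega> \<xi>", OF this]
  have "norm (ph (Suc (Suc i)) \<omega> \<xi> - ph (Suc i) \<omega> \<xi>) \<le> \<tau> * d\<^sub>0 * norm \<xi> * q ^ i" for i
    using picard_close[of i] \<omega> \<xi> unfolding close_pairs_def by (simp add: mult_ac)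
  note h = geometric_limit[OF q, of "\<lambda>i. ph (Suc i) \<omega> \<xi>", OF this]
  show "(\<lambda>i. px (Suc i) n \<omega> \<xi>) \<longlonglongrightarrow> lim_x n \<omega> \<xi>" "(\<lambda>i. ph (Suc i) \<omega> \<xi>) \<longlonglongrightarrow> lim_h \<omega> \<xi>"
    unfolding lim_x_def lim_h_def by (rule x(1) h(1))+
  show "norm (px (Suc i) n \<omega> \<xi> - lim_x n \<omega> \<xi>) \<le> \<sigma> * (d\<^sub>0 / (1 - q) * q ^ i) * \<alpha>c n \<omega> * norm \<xi>"
    using x(2)[of i] by (simp add: lim_x_def mult_ac)
  show "norm (ph (Suc i) \<omega> \<xi> - lim_h \<omega> \<xi>) \<le> \<tau> * (d\<^sub>0 / (1 - q) * q ^ i) * norm \<xi>"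
    using h(2)[of i] by (simp add: lim_h_def mult_ac)
qed

lemma lim_maps: "center_family lim_x" "lipschitz_graph lim_h"
proof -
  show "center_family lim_x"
    unfolding center_family_def
  proof (intro ballI allI impI conjI)
    fix \<omega> n assume \<omega>: "\<omega> \<in> space M"
    show "lim_x n \<omega> 0 = 0"
      unfolding lim_x_def by (simp only: centerD(1)[OF picard_maps(1) \<omega>] lim_const)
    fix \<xi> assume \<xi>: "Pc \<omega> \<xi> = \<xi>"
    note x = picard_limit(1)[OF \<omega> \<xi>, of n]
    have "bounded_linear (Pc (\<theta> n \<omega>))" using \<omega> by (intro projections(1)) simp_all
    from bounded_linear.tendsto[OF this x]
    have "(\<lambda>i. px (Suc i) n \<omega> \<xi>) \<longlonglongrightarrow> Pc (\<theta> n \<omega>) (lim_x n \<omega> \<xi>)"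
      by (simp only: centerD(2)[OF picard_maps(1) \<omega> \<xi>])
    then show "Pc (\<theta> n \<omega>) (lim_x n \<omega> \<xi>) = lim_x n \<omega> \<xi>"
      using x by (rule LIMSEQ_unique)
    fix \<xi>' assume \<xi>': "Pc \<omega> \<xi>' = \<xi>'"
    show "norm (lim_x n \<omega> \<xi> - lim_x n \<omega> \<xi>') \<le> K * \<alpha>c n \<omega> * norm (\<xi> - \<xi>')"
      using centerD(3)[OF picard_maps(1) \<omega> \<xi> \<xi>']
      by (intro LIMSEQ_le_const2[OF tendsto_norm[OF tendsto_diff[OF x picard_limit(1)[OF \<omega> \<xi>', of n]]]]) blast
  qed
  show "lipschitz_graph lim_h"
    unfolding lipschitz_graph_def
  proof (intro ballI allI impI conjI)
    fix \<omega> assume \<omega>: "\<omega> \<in> space M"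
    show "lim_h \<omega> 0 = 0"
      unfolding lim_h_def by (simp only: graphD(1)[OF picard_maps(2) \<omega>] lim_const)
    fix \<xi> assume \<xi>: "Pc \<omega> \<xi> = \<xi>"
    note h = picard_limit(2)[OF \<omega> \<xi>]
    have "bounded_linear (Pc \<omega>)" using \<omega> by (intro projections(1)) simp_all
    from bounded_linear.tendsto[OF this h]
    have "(\<lambda>i. 0) \<longlonglongrightarrow> Pc \<omega> (lim_h \<omega> \<xi>)"
      by (simp only: graphD(2)[OF picard_maps(2) \<omega> \<xi>])
    then show "Pc \<omega> (lim_h \<omega> \<xi>) = 0"
      by (simp add: LIMSEQ_const_iff)
    fix \<xi>' assume \<xi>': "Pc \<omega> \<xi>' = \<xi>'"
    show "norm (lim_h \<omega> \<xi> - lim_h \<omega> \<xi>') \<le> N * norm (\<xi> - \<xi>')"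
      using graphD(3)[OF picard_maps(2) \<omega> \<xi> \<xi>']
      by (intro LIMSEQ_le_const2[OF tendsto_norm[OF tendsto_diff[OF h picard_limit(2)[OF \<omega> \<xi>']]]]) blast
  qed
qed

text \<open>No limit is taken inside the series. The contraction, applied to an iterate and the
  limit pair, shows that the next iterates converge to the image of the limit pair; uniqueness of
  limits does the rest.\<close>

lemma lim_fixed: "fixed_pair lim_x lim_h"
  unfolding fixed_pair_def
proof (intro ballI allI impI conjI)
  fix \<omega> \<xi> assume \<omega>: "\<omega> \<in> space M" and \<xi>: "Pc \<omega> \<xi> = \<xi>"
  have cl: "close_pairs (\<sigma> * (d\<^sub>0 / (1 - q) * q ^ i * q)) (\<tau> * (d\<^sub>0 / (1 - q) * q ^ i * q))
      (px (Suc (Suc i))) (ph (Suc (Suc i))) (Cop lim_x lim_h) (SUop lim_x lim_h)" for i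
  proof -
    have "close_pairs (\<sigma> * (d\<^sub>0 / (1 - q) * q ^ i)) (\<tau> * (d\<^sub>0 / (1 - q) * q ^ i))
        (px (Suc i)) (ph (Suc i)) lim_x lim_h"
      unfolding close_pairs_def using picard_limit(3,4) by blast
    moreover have "0 \<le> d\<^sub>0 / (1 - q) * q ^ i" using d\<^sub>0 q by simp
    ultimately show ?thesis
      unfolding picard.simps(2)[of "Suc i"] fst_conv snd_conv
      by (rule operator_contracts[OF picard_maps(1,2)[of "Suc i"] lim_maps])
  qed
  have "norm (ph (Suc (Suc i)) \<omega> \<xi> - SUop lim_x lim_h \<omega> \<xi>) \<le> \<tau> * (d\<^sub>0 / (1 - q)) * q * norm \<xi> * q ^ i" for i
    using cl[of i] \<omega> \<xi> unfolding close_pairs_def by (simp add: mult_ac)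
  from geometric_tendsto[OF q, of "\<lambda>i. ph (Suc (Suc i)) \<omega> \<xi>", OF this] LIMSEQ_Suc[OF picard_limit(2)[OF \<omega> \<xi>]]
  show "lim_h \<omega> \<xi> = SUop lim_x lim_h \<omega> \<xi>" by (rule LIMSEQ_unique[rotated])
  fix n
  have "norm (px (Suc (Suc i)) n \<omega> \<xi> - Cop lim_x lim_h n \<omega> \<xi>)
      \<le> \<sigma> * (d\<^sub>0 / (1 - q)) * q * \<alpha>c n \<omega> * norm \<xi> * q ^ i" for i
    using cl[of i] \<omega> \<xi> unfolding close_pairs_def by (simp add: mult_ac)
  from geometric_tendsto[OF q, of "\<lambda>i. px (Suc (Suc i)) n \<omega> \<xi>", OF this] LIMSEQ_Suc[OF picard_limit(1)[OF \<omega> \<xi>, of n]]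
  show "lim_x n \<omega> \<xi> = Cop lim_x lim_h n \<omega> \<xi>" by (rule LIMSEQ_unique[rotated])
qed

lemma lim_h_measurable: "strongly_measurable M (\<lambda>\<omega>. lim_h \<omega> (Pc \<omega> y))"
proof (rule strongly_measurable_LIMSEQ)
  show "strongly_measurable M (\<lambda>\<omega>. ph (Suc i) \<omega> (Pc \<omega> y))" for i
    using picard_maps(3)[of "Suc i"] unfolding measurable_pair_def by blast
  show "(\<lambda>i. ph (Suc i) \<omega> (Pc \<omega> y)) \<longlonglongrightarrow> lim_h \<omega> (Pc \<omega> y)" if "\<omega> \<in> space M" for \<omega>
    using that by (intro picard_limit(2) projections(2)) simp_all
qed

lemma lim_invariant: "invariant lim_h"
  unfolding invariant_def
proof (intro ballI allI impI)
  fix n \<omega> \<xi> assume *: "\<omega> \<in> space M" "Pc \<omega> \<xi> = \<xi>"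
  show "\<exists>\<zeta>. Pc (\<theta> n \<omega>) \<zeta> = \<zeta> \<and> \<Psi> n \<omega> (\<xi> + lim_h \<omega> \<xi>) = \<zeta> + lim_h (\<theta> n \<omega>) \<zeta>"
    using fixed_pair_orbit[OF lim_maps lim_fixed *, of n] centerD(2)[OF lim_maps(1) *, of n] by blast
qed

section \<open>Translation to the class of graph maps\<close>

lemma invariant_graph_iff:
  "invariant_graph M \<theta> Pc \<Psi> \<phi> \<longleftrightarrow> invariant (\<lambda>\<omega> \<xi>. \<phi> (\<omega>, \<xi>))"
proof -
  have "\<Psi> n \<omega> ` graph_at Pc \<phi> \<omega> \<subseteq> graph_at Pc \<phi> (\<theta> n \<omega>) \<longleftrightarrow>
      (\<forall>\<xi>. Pc \<omega> \<xi> = \<xi> \<longrightarrow> (\<exists>\<zeta>. Pc (\<theta> n \<omega>) \<zeta> = \<zeta> \<and> \<Psi> n \<omega> (\<xi> + \<phi> (\<omega>, \<xi>)) = \<zeta> + \<phi> (\<theta> n \<omega>, \<zeta>)))"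
    if "\<omega> \<in> space M" for n \<omega>
    using that unfolding graph_at_def by (simp add: range_Pc image_subset_iff) blast
  then show ?thesis unfolding invariant_graph_def invariant_def by simp
qed

lemma graph_maps_iff:
  "\<phi> \<in> graph_maps M Pc Ps Pu N \<longleftrightarrow> \<phi> \<in> extensional (SIGMA \<omega>:space M. range (Pc \<omega>)) \<and>
    (\<forall>x. strongly_measurable M (\<lambda>\<omega>. \<phi> (\<omega>, Pc \<omega> x))) \<and> lipschitz_graph (\<lambda>\<omega> \<xi>. \<phi> (\<omega>, \<xi>))"
proof -
  \<comment> \<open>The sum of the stable and unstable ranges is the kernel of
    \<open>Pc\<close>.\<close>
  have "v \<in> {y + z | y z. y \<in> range (Ps \<omega>) \<and> z \<in> range (Pu \<omega>)} \<longleftrightarrow> Pc \<omega> v = 0"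
    if \<omega>: "\<omega> \<in> space M" for \<omega> v
  proof
    assume "Pc \<omega> v = 0"
    then have "v = Ps \<omega> v + Pu \<omega> v" using P_sum[OF \<omega>, of v] by simp
    then show "v \<in> {y + z | y z. y \<in> range (Ps \<omega>) \<and> z \<in> range (Pu \<omega>)}" by blast
  qed (use \<omega> in \<open>auto simp: P_simps\<close>)
  then have "\<phi> (\<omega>, 0) = 0 \<and>
        (\<forall>\<xi>\<in>range (Pc \<omega>). \<phi> (\<omega>, \<xi>) \<in> {y + z | y z. y \<in> range (Ps \<omega>) \<and> z \<in> range (Pu \<omega>)}) \<and>
        (\<forall>\<xi>\<in>range (Pc \<omega>). \<forall>\<xi>'\<in>range (Pc \<omega>).
          norm (\<phi> (\<omega>, \<xi>) - \<phi> (\<omega>, \<xi>')) \<le> N * norm (\<xi> - \<xi>')) \<longleftrightarrow>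
      \<phi> (\<omega>, 0) = 0 \<and> (\<forall>\<xi>. Pc \<omega> \<xi> = \<xi> \<longrightarrow> Pc \<omega> (\<phi> (\<omega>, \<xi>)) = 0) \<and>
        (\<forall>\<xi> \<xi>'. Pc \<omega> \<xi> = \<xi> \<longrightarrow> Pc \<omega> \<xi>' = \<xi>' \<longrightarrow>
          norm (\<phi> (\<omega>, \<xi>) - \<phi> (\<omega>, \<xi>')) \<le> N * norm (\<xi> - \<xi>'))"
    if "\<omega> \<in> space M" for \<omega>
    unfolding Ball_def range_Pc[OF that] using that by blast
  from ball_cong[OF refl this, of "space M"] show ?thesis
    unfolding graph_maps_def lipschitz_graph_def by (simp only: mem_Collect_eq)
qed

lemma exists_unique_graph:
  "\<exists>!\<phi>. \<phi> \<in> graph_maps M Pc Ps Pu N \<and> invariant_graph M \<theta> Pc \<Psi> \<phi>"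
proof (rule ex_ex1I)
  let ?E = "SIGMA \<omega>:space M. range (Pc \<omega>)"
  \<comment> \<open>Restriction fixes the values off the domain, where \<open>lim_h\<close> carries
    no meaning, so that agreement on the domain becomes equality.\<close>
  define \<phi> where "\<phi> = restrict (\<lambda>(\<omega>, \<xi>). lim_h \<omega> \<xi>) ?E"
  have \<phi>: "\<phi> (\<omega>, \<xi>) = lim_h \<omega> \<xi>" if "\<omega> \<in> space M" "Pc \<omega> \<xi> = \<xi>" for \<omega> \<xi>
    using that by (simp add: \<phi>_def range_Pc)
  have "strongly_measurable M (\<lambda>\<omega>. \<phi> (\<omega>, Pc \<omega> y))" for y
    by (rule strongly_measurable_cong[OF _ lim_h_measurable[of y]]) (simp add: \<phi> projections(2))
  moreover have "lipschitz_graph (\<lambda>\<omega> \<xi>. \<phi> (\<omega>, \<xi>))"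
    using lim_maps(2) by (simp add: lipschitz_graph_def \<phi>)
  moreover have "invariant (\<lambda>\<omega> \<xi>. \<phi> (\<omega>, \<xi>))"
    unfolding invariant_def
  proof (intro ballI allI impI)
    fix n \<omega> \<xi> assume *: "\<omega> \<in> space M" "Pc \<omega> \<xi> = \<xi>"
    with lim_invariant obtain \<zeta> where "Pc (\<theta> n \<omega>) \<zeta> = \<zeta>"
        "\<Psi> n \<omega> (\<xi> + lim_h \<omega> \<xi>) = \<zeta> + lim_h (\<theta> n \<omega>) \<zeta>"
      unfolding invariant_def by blast
    with * show "\<exists>\<zeta>. Pc (\<theta> n \<omega>) \<zeta> = \<zeta> \<and> \<Psi> n \<omega> (\<xi> + \<phi> (\<omega>, \<xi>)) = \<zeta> + \<phi> (\<theta> n \<omega>, \<zeta>)"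
      by (intro exI[of _ \<zeta>]) (simp add: \<phi>)
  qed
  moreover have "\<phi> \<in> extensional ?E" by (simp add: \<phi>_def)
  ultimately show "\<exists>\<phi>. \<phi> \<in> graph_maps M Pc Ps Pu N \<and> invariant_graph M \<theta> Pc \<Psi> \<phi>"
    unfolding graph_maps_iff invariant_graph_iff by blast
next
  fix \<phi> \<psi>
  assume \<phi>: "\<phi> \<in> graph_maps M Pc Ps Pu N \<and> invariant_graph M \<theta> Pc \<Psi> \<phi>"
    and \<psi>: "\<psi> \<in> graph_maps M Pc Ps Pu N \<and> invariant_graph M \<theta> Pc \<Psi> \<psi>"
  show "\<phi> = \<psi>"
  proof (rule extensionalityI)
    show "\<phi> \<in> extensional (SIGMA \<omega>:space M. range (Pc \<omega>))" "\<psi> \<in> extensional (SIGMA \<omega>:space M. range (Pc \<omega>))"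
      using \<phi> \<psi> by (simp_all add: graph_maps_iff)
    fix p assume "p \<in> (SIGMA \<omega>:space M. range (Pc \<omega>))"
    then obtain \<omega> \<xi> where p: "p = (\<omega>, \<xi>)" "\<omega> \<in> space M" "Pc \<omega> \<xi> = \<xi>"
      by (auto simp: projections(2))
    show "\<phi> p = \<psi> p"
      unfolding p(1) using \<phi> \<psi> p(2,3) unfolding graph_maps_iff invariant_graph_iff
      by (intro invariant_unique[of "\<lambda>\<omega> \<xi>. \<phi> (\<omega>, \<xi>)" "\<lambda>\<omega> \<xi>. \<psi> (\<omega>, \<xi>)"]) blast+
  qed
qed

end

section \<open>The constants\<close>

text \<open>The root \<open>N\<close> of \<open>\<sigma> N\<^sup>2 + (\<sigma> + \<tau> - 1) N + \<tau>\<close> in \<open>]0, 1[\<close> solves \<open>N = \<tau> K (1 + N)\<close> for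
  \<open>K = 1 / (1 - \<sigma> (1 + N))\<close>.\<close>

lemma trichotomy_constants:
  fixes \<sigma> \<tau> :: real
  assumes \<sigma>: "0 \<le> \<sigma>" and \<tau>: "0 \<le> \<tau>" and less: "\<sigma> + \<tau> < 1 / 2"
  obtains N where "0 < N" "N < 1" "\<sigma> * (1 + N) < 1"
    "\<tau> * (1 / (1 - \<sigma> * (1 + N))) * (1 + N) \<le> N"
    "(1 + N) * \<sigma> + 1 / (1 - \<sigma> * (1 + N)) * \<tau> < 1"
    "\<tau> = 0 \<or> 1 / (1 - \<sigma> * (1 + N)) * (1 + N) = N / \<tau>"
proof (cases "\<tau> = 0")
  case True
  \<comment> \<open>For \<open>\<tau> = 0\<close> the quadratic has no root in ]0, 1[. The required
    inequality then has left side 0, and 1/2 also satisfies the remaining bounds since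
    \<open>\<sigma> < 1 / 2\<close>.\<close>
  show ?thesis by (rule that[of "1 / 2"]) (use True \<sigma> less in \<open>simp_all add: field_simps\<close>)
next
  case False
  define p where "p x = \<sigma> * x * x + (\<sigma> + \<tau> - 1) * x + \<tau>" for x
  have "\<exists>x\<ge>0. x \<le> 1 \<and> p x = 0"
    using \<tau> less unfolding p_def by (intro IVT2') (auto intro!: continuous_intros)
  then obtain N where N: "0 \<le> N" "N \<le> 1" "p N = 0" by blast
  moreover have "N \<noteq> 0" "N \<noteq> 1" using N(3) False less by (auto simp: p_def)
  ultimately have N01: "0 < N" "N < 1" by auto
  have "\<sigma> * (1 + N) \<le> \<sigma> * 2" using \<sigma> N by (intro mult_left_mono) auto
  then have D: "\<sigma> * (1 + N) < 1" using less \<tau> by simp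
  have root: "N * (1 - \<sigma> * (1 + N)) = \<tau> * (1 + N)"
    using N(3) by (simp add: p_def algebra_simps)
  \<comment> \<open>A convexity argument: the secant of \<open>p\<close> from \<open>N\<close> to 1
    has negative slope, hence so does the tangent at \<open>N\<close>, whose slope is 2 \<sigma> N +
    \<sigma> + \<tau> - 1.\<close>
  have "p 1 < 0" using less by (simp add: p_def)
  moreover have "p 1 - p N = (1 - N) * (\<sigma> * (1 + N) + \<sigma> + \<tau> - 1)"
    by (simp add: p_def algebra_simps)
  ultimately have "(1 - N) * (\<sigma> * (1 + N) + \<sigma> + \<tau> - 1) < 0" using N(3) by simp
  then have "\<sigma> * (1 + N) + \<sigma> + \<tau> < 1" using N01 by (simp add: mult_less_0_iff)
  moreover have "\<sigma> * N \<le> \<sigma>" using \<sigma> N by (simp add: mult_left_le)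
  ultimately have p': "2 * (\<sigma> * N) + \<sigma> + \<tau> < 1" by (simp add: algebra_simps)
  \<comment> \<open>With p' for the derivative, N p'(N) - p(N) = \<sigma> N^2 - \<tau>, where p'(N)
    < 0 and p(N) = 0.\<close>
  from mult_strict_right_mono[OF this N01(1)] N(3) have "\<sigma> * N * N < \<tau>"
    by (simp add: p_def algebra_simps)
  \<comment> \<open>This is the contraction condition multiplied by \<open>1 + N\<close>, because K
    \<tau> = N / (1 + N).\<close>
  with p' have sq: "\<sigma> * (1 + N) * (1 + N) < 1" by (simp add: algebra_simps)
  have \<tau>_eq: "\<tau> = N * (1 - \<sigma> * (1 + N)) / (1 + N)"
    using root N01 by (simp add: field_simps)
  have K\<tau>: "1 / (1 - \<sigma> * (1 + N)) * \<tau> = N / (1 + N)"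
    unfolding \<tau>_eq using D by simp
  show ?thesis
  proof (rule that[OF N01 D])
    show "\<tau> * (1 / (1 - \<sigma> * (1 + N))) * (1 + N) \<le> N"
      using K\<tau> N01 by (simp add: mult.commute)
    have "(\<sigma> * (1 + N) * (1 + N) + N) / (1 + N) < 1" using sq N01 by (simp add: divide_less_eq)
    then show "(1 + N) * \<sigma> + 1 / (1 - \<sigma> * (1 + N)) * \<tau> < 1"
      unfolding K\<tau> using N01 by (simp add: add_divide_distrib mult.commute)
    show "\<tau> = 0 \<or> 1 / (1 - \<sigma> * (1 + N)) * (1 + N) = N / \<tau>"
      using root False D by (simp add: frac_eq_eq mult.commute)
  qed
qed

lemma sigma_const_bounds:
  assumes \<omega>: "\<omega> \<in> space M" and \<alpha>: "\<And>n. 0 < \<alpha>c n \<omega>" and \<sigma>: "sigma_const M \<theta> \<alpha>c f = ennreal \<sigma>" "0 \<le> \<sigma>"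
  shows "1 \<le> n \<Longrightarrow>
      (\<Sum>k=0..n-1. \<alpha>c (n - k - 1) (\<theta> (k + 1) \<omega>) * Lip (f (\<theta> k \<omega>)) * \<alpha>c k \<omega>) \<le> \<sigma> * \<alpha>c n \<omega>"
    "n \<le> -1 \<Longrightarrow>
      (\<Sum>k=n..-1. \<alpha>c (n - k - 1) (\<theta> (k + 1) \<omega>) * Lip (f (\<theta> k \<omega>)) * \<alpha>c k \<omega>) \<le> \<sigma> * \<alpha>c n \<omega>"
proof -
  have "max (sigma_minus \<theta> \<alpha>c f \<omega>) (sigma_plus \<theta> \<alpha>c f \<omega>) \<le> ennreal \<sigma>"
    unfolding \<sigma>(1)[symmetric] sigma_const_def using \<omega> by (rule SUP_upper)
  then have le: "sigma_minus \<theta> \<alpha>c f \<omega> \<le> ennreal \<sigma>" "sigma_plus \<theta> \<alpha>c f \<omega> \<le> ennreal \<sigma>" by auto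
  have *: "s \<le> \<sigma> * \<alpha>c n \<omega>" if "ennreal (1 / \<alpha>c n \<omega> * s) \<le> ennreal \<sigma>" for n s
    using that \<sigma>(2) \<alpha>[of n] by (simp add: ennreal_le_iff divide_le_eq)
  show "(\<Sum>k=0..n-1. \<alpha>c (n - k - 1) (\<theta> (k + 1) \<omega>) * Lip (f (\<theta> k \<omega>)) * \<alpha>c k \<omega>) \<le> \<sigma> * \<alpha>c n \<omega>"
    if "1 \<le> n"
    by (rule *, rule order_trans[OF _ le(2)], unfold sigma_plus_def, rule SUP_upper) (use that in simp)
  show "(\<Sum>k=n..-1. \<alpha>c (n - k - 1) (\<theta> (k + 1) \<omega>) * Lip (f (\<theta> k \<omega>)) * \<alpha>c k \<omega>) \<le> \<sigma> * \<alpha>c n \<omega>"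
    if "n \<le> -1"
    using order_trans[OF SUP_upper[of "-n" "{1..}"] le(1)[unfolded sigma_minus_def]] that
    by (intro *) simp
qed

lemma finite_sum_le_infsum_ennreal:
  fixes g :: "'i \<Rightarrow> ennreal"
  assumes "finite B" "B \<subseteq> A"
  shows "sum g B \<le> (\<Sum>\<^sub>\<infinity>i\<in>A. g i)"
proof -
  have "infsum g B \<le> infsum g A"
    using assms by (intro infsum_mono_neutral nonneg_summable_on_complete) auto
  then show ?thesis using assms by simp
qed

lemma tau_const_bound:
  assumes \<omega>: "\<omega> \<in> space M" and \<tau>: "tau_const M \<theta> \<alpha>c \<alpha>s \<alpha>u f = ennreal \<tau>" "0 \<le> \<tau>"
    and nn_s: "\<And>j. 0 \<le> \<alpha>s (int j) (\<theta> (- int j) \<omega>) * Lip (f (\<theta> (-1 - int j) \<omega>)) * \<alpha>c (-1 - int j) \<omega>"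
    and nn_u: "\<And>j. 0 \<le> \<alpha>u (- int j - 1) (\<theta> (int j + 1) \<omega>) * Lip (f (\<theta> (int j) \<omega>)) * \<alpha>c (int j) \<omega>"
  shows "(\<Sum>j<m. \<alpha>s (int j) (\<theta> (- int j) \<omega>) * Lip (f (\<theta> (-1 - int j) \<omega>)) * \<alpha>c (-1 - int j) \<omega>) +
      (\<Sum>j<m. \<alpha>u (- int j - 1) (\<theta> (int j + 1) \<omega>) * Lip (f (\<theta> (int j) \<omega>)) * \<alpha>c (int j) \<omega>) \<le> \<tau>"
    (is "(\<Sum>j<m. ?a j) + (\<Sum>j<m. ?b j) \<le> \<tau>")
proof -
  let ?s = "\<lambda>k. ennreal (\<alpha>s (- k - 1) (\<theta> (k + 1) \<omega>) * Lip (f (\<theta> k \<omega>)) * \<alpha>c k \<omega>)"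
  let ?u = "\<lambda>k. ennreal (\<alpha>u (- k - 1) (\<theta> (k + 1) \<omega>) * Lip (f (\<theta> k \<omega>)) * \<alpha>c k \<omega>)"
  \<comment> \<open>Nonnegativity of the terms matters: \<open>ennreal\<close> sends negative reals
    to 0, so it commutes with sums only for nonnegative terms.\<close>
  have "ennreal (\<Sum>j<m. ?a j) = (\<Sum>j<m. ?s (-1 - int j))"
    using nn_s by (subst sum_ennreal[symmetric]) (simp_all add: add.commute)
  also have "\<dots> = sum ?s ((\<lambda>j. -1 - int j) ` {..<m})"
    by (subst sum.reindex) (auto simp: inj_on_def)
  also have "\<dots> \<le> tau_minus \<theta> \<alpha>c \<alpha>s f \<omega>"
    unfolding tau_minus_def by (rule finite_sum_le_infsum_ennreal) auto
  finally have a: "ennreal (\<Sum>j<m. ?a j) \<le> tau_minus \<theta> \<alpha>c \<alpha>s f \<omega>" .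
  have "ennreal (\<Sum>j<m. ?b j) = (\<Sum>j<m. ?u (int j))"
    using nn_u by (subst sum_ennreal[symmetric]) simp_all
  also have "\<dots> = sum ?u (int ` {..<m})"
    by (subst sum.reindex) (auto simp: inj_on_def)
  also have "\<dots> \<le> tau_plus \<theta> \<alpha>c \<alpha>u f \<omega>"
    unfolding tau_plus_def by (rule finite_sum_le_infsum_ennreal) auto
  finally have b: "ennreal (\<Sum>j<m. ?b j) \<le> tau_plus \<theta> \<alpha>c \<alpha>u f \<omega>" .
  have "ennreal ((\<Sum>j<m. ?a j) + (\<Sum>j<m. ?b j)) = ennreal (\<Sum>j<m. ?a j) + ennreal (\<Sum>j<m. ?b j)"
    by (intro ennreal_plus sum_nonneg nn_s nn_u)
  also have "\<dots> \<le> tau_minus \<theta> \<alpha>c \<alpha>s f \<omega> + tau_plus \<theta> \<alpha>c \<alpha>u f \<omega>"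
    using a b by (rule add_mono)
  also have "\<dots> \<le> ennreal \<tau>"
    unfolding \<tau>(1)[symmetric] tau_const_def using \<omega> by (rule SUP_upper)
  finally show ?thesis using \<tau>(2) by (simp add: ennreal_le_iff)
qed

theorem theorem4p1:
  fixes M :: "'w measure"
    and \<theta> :: "int \<Rightarrow> 'w \<Rightarrow> 'w"
    and \<Phi> \<Psi> :: "int \<Rightarrow> 'w \<Rightarrow> 'x::banach \<Rightarrow> 'x"
    and \<alpha>c \<alpha>s \<alpha>u :: "int \<Rightarrow> 'w \<Rightarrow> real"
    and Pc Ps Pu :: "'w \<Rightarrow> 'x \<Rightarrow> 'x"
    and f :: "'w \<Rightarrow> 'x \<Rightarrow> 'x"
  assumes "measure_preserving_ds M \<theta>"
    and "measurable_linear_rds M \<theta> \<Phi>"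
    and "trichotomy M \<theta> \<Phi> \<alpha>c \<alpha>s \<alpha>u Pc Ps Pu"
    and "f \<in> perturbations M"
    and "measurable_rds M \<theta> \<Psi>"
    and "\<And>n \<omega> x. \<omega> \<in> space M \<Longrightarrow> \<Psi> n \<omega> x =
      (if n \<ge> 1 then
         \<Phi> n \<omega> x + (\<Sum>k=0..n-1. \<Phi> (n - k - 1) (\<theta> (k + 1) \<omega>) (f (\<theta> k \<omega>) (\<Psi> k \<omega> x)))
       else if n = 0 then x
       else
         \<Phi> n \<omega> x - (\<Sum>k=n..-1. \<Phi> (n - k - 1) (\<theta> (k + 1) \<omega>) (f (\<theta> k \<omega>) (\<Psi> k \<omega> x))))"
    and "\<And>\<omega>. \<omega> \<in> space M \<Longrightarrow> ((\<lambda>n. \<alpha>s (- n) (\<theta> n \<omega>) * \<alpha>c n \<omega>) \<longlongrightarrow> 0) at_bot"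
    and "\<And>\<omega>. \<omega> \<in> space M \<Longrightarrow> ((\<lambda>n. \<alpha>u (- n) (\<theta> n \<omega>) * \<alpha>c n \<omega>) \<longlongrightarrow> 0) at_top"
    and "sigma_const M \<theta> \<alpha>c f + tau_const M \<theta> \<alpha>c \<alpha>s \<alpha>u f < 1 / 2"
  shows "\<exists>N::real. 0 < N \<and> N < 1 \<and>
    (\<exists>!\<phi>. \<phi> \<in> graph_maps M Pc Ps Pu N \<and> invariant_graph M \<theta> Pc \<Psi> \<phi>) \<and>
    (\<forall>\<phi>. \<phi> \<in> graph_maps M Pc Ps Pu N \<and> invariant_graph M \<theta> Pc \<Psi> \<phi> \<longrightarrow>
      (\<forall>n. \<forall>\<omega>\<in>space M. \<forall>\<xi>\<in>range (Pc \<omega>). \<forall>\<xi>'\<in>range (Pc \<omega>).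
        ennreal (norm (\<Psi> n \<omega> (\<xi> + \<phi> (\<omega>, \<xi>)) - \<Psi> n \<omega> (\<xi>' + \<phi> (\<omega>, \<xi>'))))
          \<le> ennreal N / tau_const M \<theta> \<alpha>c \<alpha>s \<alpha>u f * ennreal (\<alpha>c n \<omega>) * ennreal (norm (\<xi> - \<xi>'))))"
proof -
  let ?\<tau> = "tau_const M \<theta> \<alpha>c \<alpha>s \<alpha>u f"
  have half: "(1 / 2 :: ennreal) = ennreal (1 / 2)"
    by (metis divide_ennreal ennreal_1 ennreal_numeral zero_le_numeral zero_le_one zero_less_numeral)
  \<comment> \<open>A sum below 1/2 excludes the value infinity for both constants, so real
    representatives exist.\<close>
  obtain \<sigma> where \<sigma>: "0 \<le> \<sigma>" "sigma_const M \<theta> \<alpha>c f = ennreal \<sigma>"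
    using assms(9) by (cases "sigma_const M \<theta> \<alpha>c f") auto
  obtain \<tau> where \<tau>: "0 \<le> \<tau>" "?\<tau> = ennreal \<tau>"
    using assms(9) by (cases ?\<tau>) auto
  have "ennreal (\<sigma> + \<tau>) < ennreal (1 / 2)"
    using assms(9) unfolding \<sigma>(2) \<tau>(2) half ennreal_plus[OF \<sigma>(1) \<tau>(1)] .
  then have less: "\<sigma> + \<tau> < 1 / 2"
    using ennreal_less_iff[of "\<sigma> + \<tau>" "1 / 2"] \<sigma>(1) \<tau>(1) by simp
  obtain N where N_props: "0 < N" "N < 1" "\<sigma> * (1 + N) < 1"
    "\<tau> * (1 / (1 - \<sigma> * (1 + N))) * (1 + N) \<le> N"
    "(1 + N) * \<sigma> + 1 / (1 - \<sigma> * (1 + N)) * \<tau> < 1"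
    "\<tau> = 0 \<or> 1 / (1 - \<sigma> * (1 + N)) * (1 + N) = N / \<tau>"
    by (rule trichotomy_constants[OF \<sigma>(1) \<tau>(1) less])
  have \<theta>: "\<theta> n \<omega> \<in> space M" if "\<omega> \<in> space M" for n \<omega>
    using assms(1) that measurable_space[of "\<lambda>(n, \<omega>). \<theta> n \<omega>" "count_space UNIV \<Otimes>\<^sub>M M" M "(n, \<omega>)"]
    unfolding measure_preserving_ds_def by (simp add: space_pair_measure)
  have \<alpha>: "0 < \<alpha>c n \<omega>" "0 \<le> n \<Longrightarrow> 0 < \<alpha>s n \<omega>" "n \<le> 0 \<Longrightarrow> 0 < \<alpha>u n \<omega>" if "\<omega> \<in> space M" for n \<omega>
    using assms(3) that unfolding trichotomy_def by blast+
  have Lip: "0 \<le> Lip (f \<omega>)" if "\<omega> \<in> space M" for \<omega>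
    using assms(4) that unfolding perturbations_def by (intro lipschitz_Lip(1)) blast
  have at_bot: "filterlim (\<lambda>m. - int m) at_bot sequentially"
    unfolding filterlim_at_bot eventually_sequentially
  proof
    show "\<exists>m\<^sub>0. \<forall>m\<ge>m\<^sub>0. - int m \<le> Z" for Z by (intro exI[of _ "nat (- Z)"]) arith
  qed
  interpret trichotomy_estimates M \<theta> \<Phi> \<Psi> \<alpha>c \<alpha>s \<alpha>u Pc Ps Pu f \<sigma> \<tau> N "1 / (1 - \<sigma> * (1 + N))"
  proof (unfold_locales; (intro assms(1-5) \<sigma>(1) \<tau>(1) N_props(1-5) refl sigma_const_bounds[OF _ \<alpha>(1) \<sigma>(2,1)]; assumption)?)
    \<comment> \<open>At \<open>n = 1\<close> the formula for \<open>\<Psi>\<close> has the single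
      summand \<open>k = 0\<close>, transported by the identity \<open>\<Phi> 0\<close>.\<close>
    fix \<omega> x assume \<omega>: "\<omega> \<in> space M"
    have "\<theta> 0 \<omega> = \<omega>" using assms(1) \<omega> unfolding measure_preserving_ds_def by blast
    moreover have "\<Phi> 0 (\<theta> 1 \<omega>) v = v" for v
      using assms(2) \<theta>[OF \<omega>] unfolding measurable_linear_rds_def measurable_rds_def by blast
    moreover have "\<Psi> 0 \<omega> x = x"
      using assms(5) \<omega> unfolding measurable_rds_def by blast
    ultimately show "\<Psi> 1 \<omega> x = \<Phi> 1 \<omega> x + f \<omega> x"
      using assms(6)[OF \<omega>, of 1 x] by simp
  next
    fix \<omega> assume \<omega>: "\<omega> \<in> space M"
    show "(\<lambda>m. \<alpha>s (int m) (\<theta> (- int m) \<omega>) * \<alpha>c (- int m) \<omega>) \<longlonglongrightarrow> 0"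
      using filterlim_compose[OF assms(7)[OF \<omega>] at_bot] by simp
    show "(\<lambda>m. \<alpha>u (- int m) (\<theta> (int m) \<omega>) * \<alpha>c (int m) \<omega>) \<longlonglongrightarrow> 0"
      using filterlim_compose[OF assms(8)[OF \<omega>] filterlim_int_sequentially] by simp
    fix m
    show "(\<Sum>j<m. \<alpha>s (int j) (\<theta> (- int j) \<omega>) * Lip (f (\<theta> (-1 - int j) \<omega>)) * \<alpha>c (-1 - int j) \<omega>) +
      (\<Sum>j<m. \<alpha>u (- int j - 1) (\<theta> (int j + 1) \<omega>) * Lip (f (\<theta> (int j) \<omega>)) * \<alpha>c (int j) \<omega>) \<le> \<tau>"
      by (rule tau_const_bound[OF \<omega> \<tau>(2,1)];
          intro mult_nonneg_nonneg Lip \<theta> less_imp_le[OF \<alpha>(1)] less_imp_le[OF \<alpha>(2)]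
            less_imp_le[OF \<alpha>(3)] \<omega>; simp)
  qed
  show ?thesis
  proof (intro exI[of _ N] conjI exists_unique_graph allI impI ballI)
    fix \<phi> n \<omega> \<xi> \<xi>'
    assume "\<phi> \<in> graph_maps M Pc Ps Pu N \<and> invariant_graph M \<theta> Pc \<Psi> \<phi>"
      and \<omega>: "\<omega> \<in> space M" and \<xi>: "\<xi> \<in> range (Pc \<omega>)" "\<xi>' \<in> range (Pc \<omega>)"
    then have bound: "norm (\<Psi> n \<omega> (\<xi> + \<phi> (\<omega>, \<xi>)) - \<Psi> n \<omega> (\<xi>' + \<phi> (\<omega>, \<xi>')))
        \<le> 1 / (1 - \<sigma> * (1 + N)) * (1 + N) * \<alpha>c n \<omega> * norm (\<xi> - \<xi>')" (is "?d \<le> _")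
      unfolding graph_maps_iff invariant_graph_iff range_Pc[OF \<omega>]
      by (intro invariant_orbit_lipschitz[of "\<lambda>\<omega> \<xi>. \<phi> (\<omega>, \<xi>)"]) blast+
    have \<alpha>c: "0 < \<alpha>c n \<omega>" by (rule \<alpha>(1)[OF \<omega>])
    show "ennreal ?d \<le> ennreal N / ?\<tau> * ennreal (\<alpha>c n \<omega>) * ennreal (norm (\<xi> - \<xi>'))"
    \<comment> \<open>For \<open>\<tau> = 0\<close> the quotient is infinite. The product on the
      right is then infinite when the points differ, and 0 when they coincide, where the left side
      is 0 as well.\<close>
    proof (cases "\<xi> = \<xi>'")
      case False
      show ?thesis
      proof (cases "\<tau> = 0")
        case True
        with False show ?thesis
          using N_props(1) \<alpha>c \<tau>(2) by (simp add: ennreal_top_mult ennreal_mult_top divide_ennreal_def)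
      next
        case False
        then have "0 < \<tau>" using \<tau>(1) by simp
        have "1 / (1 - \<sigma> * (1 + N)) * (1 + N) = N / \<tau>" using N_props(6) False by blast
        from bound[unfolded this] have "ennreal ?d \<le> ennreal (N / \<tau> * \<alpha>c n \<omega> * norm (\<xi> - \<xi>'))" by (rule ennreal_leI)
        also have "\<dots> = ennreal N / ?\<tau> * ennreal (\<alpha>c n \<omega>) * ennreal (norm (\<xi> - \<xi>'))"
          using \<open>0 < \<tau>\<close> N_props(1) \<alpha>c unfolding \<tau>(2)
          by (simp add: ennreal_mult divide_ennreal del: times_divide_eq_left)
        finally show ?thesis .
      qed
    qed simp
  qed (use N_props in auto)
qed

end
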